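(* $P_3$-Matching has kernels with $O(k^{2.5})$ edges.
   Context: $P_3$ denotes the simple path with $3$ edges (4 vertices). $P_3$-Matching: given a graph $G$ and an integer $k$ (the parameter), decide whether $G$ contains $k$ pairwise vertex-disjoint subgraphs each isomorphic to $P_3$. A kernel is a polynomial-time algorithm mapping an instance $(G,k)$ to an equivalent instance $(G',k')$ of the same problem (yes iff yes) whose size is bounded by a function of $k$; "kernels with $O(g(k))$ edges" means the output graph has $O(g(k))$ edges. *)

theory Defs
  imports
    "HOL-Computational_Algebra.Polynomial"
    "HOL-Library.Landau_Symbols"
begin

record 'v sgraph =
  verts :: "'v set"
  edges :: "'v set set"

definition simple_graph :: "'v sgraph \<Rightarrow> bool" where
  "simple_graph G \<longleftrightarrow> finite (verts G) \<and> edges G \<subseteq> {e. e \<subseteq> verts G \<and> card e = 2}"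

definition subgraph_of :: "'v sgraph \<Rightarrow> 'v sgraph \<Rightarrow> bool" where
  "subgraph_of H G \<longleftrightarrow> simple_graph H \<and> verts H \<subseteq> verts G \<and> edges H \<subseteq> edges G"

definition isomorphic :: "'v sgraph \<Rightarrow> 'w sgraph \<Rightarrow> bool" where
  "isomorphic G H \<longleftrightarrow>
     (\<exists>f. bij_betw f (verts G) (verts H) \<and> edges H = (\<lambda>e. f ` e) ` edges G)"

text \<open>The index counts edges, so \<open>path_graph m\<close> has \<open>m + 1\<close> vertices.\<close>

definition path_graph :: "nat \<Rightarrow> nat sgraph" where
  "path_graph m = \<lparr>verts = {0..m}, edges = {{i, Suc i} | i. i < m}\<rparr>"

definition graph_matching :: "'w sgraph \<Rightarrow> 'v sgraph \<times> nat \<Rightarrow> bool" where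
  "graph_matching F = (\<lambda>(G, k).
     \<exists>M. finite M \<and> card M = k
       \<and> (\<forall>H\<in>M. subgraph_of H G \<and> isomorphic F H)
       \<and> pairwise (\<lambda>H H'. disjnt (verts H) (verts H')) M)"

text \<open>
  The machine model is the WHILE language over binary trees (N. D. Jones,
  Computability and Complexity from a Programming Perspective). Every operation is
  charged the full size of each tree that it reads or builds, without credit for
  sharing. Hence running times agree with those of Turing machines up to a polynomial,
  and a program cannot build an output larger than its input and running time together.
\<close>

datatype data = Nl | Pr data data

fun dsize :: "data \<Rightarrow> nat" where
  "dsize Nl = 1"
| "dsize (Pr a b) = 1 + dsize a + dsize b"

fun dhd :: "data \<Rightarrow> data" where
  "dhd Nl = Nl"
| "dhd (Pr a b) = a"

fun dtl :: "data \<Rightarrow> data" where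
  "dtl Nl = Nl"
| "dtl (Pr a b) = b"

definition dbool :: "bool \<Rightarrow> data" where
  "dbool b = (if b then Pr Nl Nl else Nl)"

datatype expr =
    EVar nat
  | ENil
  | ECons expr expr
  | EHd expr
  | ETl expr
  | EEq expr expr

type_synonym store = "nat \<Rightarrow> data"

fun eval :: "expr \<Rightarrow> store \<Rightarrow> data" where
  "eval (EVar x) s = s x"
| "eval ENil s = Nl"
| "eval (ECons e f) s = Pr (eval e s) (eval f s)"
| "eval (EHd e) s = dhd (eval e s)"
| "eval (ETl e) s = dtl (eval e s)"
| "eval (EEq e f) s = dbool (eval e s = eval f s)"

fun cost :: "expr \<Rightarrow> store \<Rightarrow> nat" where
  "cost (EVar x) s = dsize (eval (EVar x) s)"
| "cost ENil s = dsize (eval ENil s)"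
| "cost (ECons e f) s = cost e s + cost f s + dsize (eval (ECons e f) s)"
| "cost (EHd e) s = cost e s + dsize (eval (EHd e) s)"
| "cost (ETl e) s = cost e s + dsize (eval (ETl e) s)"
| "cost (EEq e f) s = cost e s + cost f s + dsize (eval (EEq e f) s)"

datatype com =
    Assign nat expr
  | Seq com com
  | Cond expr com com
  | While expr com

text \<open>
  \<open>exec c s t s'\<close>: started in store \<open>s\<close>, the program \<open>c\<close> halts in store \<open>s'\<close> after
  time \<open>t\<close>. A test succeeds iff its value differs from \<open>Nl\<close>.
\<close>

inductive exec :: "com \<Rightarrow> store \<Rightarrow> nat \<Rightarrow> store \<Rightarrow> bool" where
  Assign: "exec (Assign x e) s (1 + cost e s) (s(x := eval e s))"
| Seq: "exec c s t s' \<Longrightarrow> exec d s' u s'' \<Longrightarrow> exec (Seq c d) s (t + u) s''"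
| CondTrue: "eval b s \<noteq> Nl \<Longrightarrow> exec c s t s' \<Longrightarrow> exec (Cond b c d) s (1 + cost b s + t) s'"
| CondFalse: "eval b s = Nl \<Longrightarrow> exec d s t s' \<Longrightarrow> exec (Cond b c d) s (1 + cost b s + t) s'"
| WhileFalse: "eval b s = Nl \<Longrightarrow> exec (While b c) s (1 + cost b s) s"
| WhileTrue: "eval b s \<noteq> Nl \<Longrightarrow> exec c s t s' \<Longrightarrow> exec (While b c) s' u s''
     \<Longrightarrow> exec (While b c) s (1 + cost b s + t + u) s''"

text \<open>Input and output are passed in variable \<open>0\<close>; all other variables start as \<open>Nl\<close>.\<close>

definition runs :: "com \<Rightarrow> data \<Rightarrow> nat \<Rightarrow> data \<Rightarrow> bool" where
  "runs c a t b \<longleftrightarrow> (\<exists>s. exec c ((\<lambda>_. Nl)(0 := a)) t s \<and> s 0 = b)"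

definition polytime_computable_on ::
    "'a set \<Rightarrow> ('a \<Rightarrow> data) \<Rightarrow> ('b \<Rightarrow> data) \<Rightarrow> ('a \<Rightarrow> 'b) \<Rightarrow> bool" where
  "polytime_computable_on A enc enc' f \<longleftrightarrow>
     (\<exists>c (p :: nat poly). \<forall>x\<in>A. \<exists>t. t \<le> poly p (dsize (enc x)) \<and> runs c (enc x) t (enc' (f x)))"

text \<open>
  As inputs and outputs of algorithms, graphs have vertex set \<open>{..<n}\<close> for some \<open>n\<close>.
  A graph is encoded by its adjacency matrix (a list of rows) and the parameter in binary,
  least significant bit first.
\<close>

definition instances :: "(nat sgraph \<times> nat) set" where
  "instances = {(G, k). simple_graph G \<and> (\<exists>n. verts G = {..<n})}"

fun enc_list :: "data list \<Rightarrow> data" where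
  "enc_list [] = Nl"
| "enc_list (x # xs) = Pr x (enc_list xs)"

fun enc_nat :: "nat \<Rightarrow> data" where
  "enc_nat n = (if n = 0 then Nl else Pr (dbool (odd n)) (enc_nat (n div 2)))"

declare enc_nat.simps [simp del]

definition enc_graph :: "nat sgraph \<Rightarrow> data" where
  "enc_graph G = (let n = card (verts G) in
     enc_list (map (\<lambda>u. enc_list (map (\<lambda>v. dbool ({u, v} \<in> edges G)) [0..<n])) [0..<n]))"

fun enc_instance :: "nat sgraph \<times> nat \<Rightarrow> data" where
  "enc_instance (G, k) = Pr (enc_graph G) (enc_nat k)"

definition kernelization ::
    "(nat sgraph \<times> nat \<Rightarrow> bool) \<Rightarrow> (nat sgraph \<times> nat \<Rightarrow> nat sgraph \<times> nat) \<Rightarrow> bool" where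
  "kernelization Q K \<longleftrightarrow>
     polytime_computable_on instances enc_instance enc_instance K
   \<and> (\<forall>x\<in>instances. K x \<in> instances \<and> (Q (K x) \<longleftrightarrow> Q x))
   \<and> (\<exists>h. \<forall>(G, k)\<in>instances. dsize (enc_instance (K (G, k))) \<le> h k)"

definition has_kernels_with_edges ::
    "(nat sgraph \<times> nat \<Rightarrow> bool) \<Rightarrow> (nat \<Rightarrow> real) \<Rightarrow> bool" where
  "has_kernels_with_edges Q g \<longleftrightarrow>
     (\<exists>K. kernelization Q K \<and>
       (\<exists>f \<in> O(g). \<forall>(G, k)\<in>instances. real (card (edges (fst (K (G, k))))) \<le> f k))"

end

theory Submission
  imports Defs
begin

text \<open>
  Fix a maximal packing of 4-vertex paths with vertex set \<open>S\<close>, where \<open>\<bar>S\<bar> < 4k\<close>. Without \<open>S\<close> the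
  graph falls into triangles and stars. Let \<open>C\<close> contain the triangles, the single edges and the
  centers of the larger stars; the set \<open>B\<close> of all other vertices outside \<open>S\<close> is independent.
  A vertex of \<open>S\<close> that reaches \<open>12k\<close> vertices of \<open>C\<close> within two steps outside \<open>S\<close> has a path of its
  own whatever \<open>k - 1\<close> disjoint paths are chosen elsewhere, so it is deleted and \<open>k\<close> decreases.
  Once these vertices and the edges on no path are gone, only \<open>O(k\<^sup>2)\<close> edges avoid \<open>B\<close>, and only
  \<open>O(k\<^sup>2)\<close> pairs \<open>(a, p)\<close> of vertices outside \<open>B\<close>, the pairs \<open>(a, a)\<close> included, have a common
  neighbour in \<open>B\<close>.

  It remains to keep \<open>O(\<surd>k)\<close> vertices of \<open>B\<close> for each such pair. To that end each \<open>a\<close> assigns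
  every neighbour \<open>b \<in> B\<close> to one neighbour \<open>p\<close> of \<open>b\<close>, such that the loads of the various \<open>p\<close> are
  locally balanced, and keeps up to \<open>T + 1\<close> vertices per \<open>p\<close>, where \<open>T\<^sup>2 > 16k\<close>. Suppose that a
  packing uses a path \<open>\<dots> a b p \<dots>\<close> whose edge \<open>ab\<close> has been dropped. Balance implies that \<open>p\<close> has
  \<open>T + 1\<close> kept vertices \<open>b'\<close>. If all of them are used, they lie on at least \<open>T / 4\<close> other paths, on
  which they have distinct neighbours \<open>c\<close>, and by balance each \<open>c\<close> has \<open>T\<close> kept vertices of its own
  with respect to \<open>a\<close>. These are more than \<open>4k\<close> vertices in total, so one of them, say \<open>b''\<close>, is
  unused. Replacing \<open>a b p\<close> and \<open>c b' c'\<close> by \<open>a b'' c\<close> and \<open>p b' c'\<close> decreases the number of dropped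
  edges; \<open>c\<close> is chosen among the two neighbours of \<open>b'\<close> such that both new paths have four vertices.
\<close>

section \<open>Packings of paths on four vertices\<close>

text \<open>Keeping \<open>4k + 1\<close> common neighbours in \<open>B\<close> for every pair
  \<open>(a, p)\<close> would make a replacement for a dropped vertex available at once, but it
  costs order \<open>k\<close> vertices for each of \<open>O(k^2)\<close> pairs, hence cubic size.
  The square root comes from searching one step further: a bin has only about \<open>T\<close> kept
  vertices, but if all of them are occupied, they lead to \<open>T / 4\<close> further bins with
  about \<open>T\<close> kept vertices each, so \<open>T^2 / 4\<close> candidates compete with at
  most \<open>4k\<close> used vertices. This requires bins that are disjoint and not nearly empty.
  Therefore \<open>a\<close> puts every \<open>b\<close> into exactly one bin, and balance is
  demanded along the edges at \<open>b\<close>: global balance is out of reach, since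
  \<open>b\<close> may enter only the bins of its own neighbours. The exchanges prove that a packing
  without dropped edges exists and are never executed. The algorithm has to find only the maximal
  packing, the sets around it and the balanced assignments, each by a loop whose length is fixed in
  advance.\<close>

type_synonym 'a quad = "'a \<times> 'a \<times> 'a \<times> 'a"

fun P4 :: "('a \<Rightarrow> 'a \<Rightarrow> bool) \<Rightarrow> 'a quad \<Rightarrow> bool" where
  "P4 E (a, b, c, d) \<longleftrightarrow> distinct [a, b, c, d] \<and> E a b \<and> E b c \<and> E c d"

fun qverts :: "'a quad \<Rightarrow> 'a set" where
  "qverts (a, b, c, d) = {a, b, c, d}"

fun quad_rev :: "'a quad \<Rightarrow> 'a quad" where
  "quad_rev (a, b, c, d) = (d, c, b, a)"

definition packing :: "('a \<Rightarrow> 'a \<Rightarrow> bool) \<Rightarrow> 'a quad set \<Rightarrow> bool" where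
  "packing E M \<longleftrightarrow> finite M \<and> (\<forall>q\<in>M. P4 E q) \<and> (\<forall>q\<in>M. \<forall>r\<in>M. q \<noteq> r \<longrightarrow> qverts q \<inter> qverts r = {})"

definition has_packing :: "('a \<Rightarrow> 'a \<Rightarrow> bool) \<Rightarrow> nat \<Rightarrow> bool" where
  "has_packing E k \<longleftrightarrow> (\<exists>M. packing E M \<and> card M = k)"

definition covered :: "'a quad set \<Rightarrow> 'a set" where
  "covered M = (\<Union>q\<in>M. qverts q)"

lemma qverts_finite [simp]: "finite (qverts q)" and card_qverts: "card (qverts q) \<le> 4" and qverts_nonempty [simp]: "qverts q \<noteq> {}"
  by (cases q; simp add: card_insert_if)+

lemma qverts_quad_rev [simp]: "qverts (quad_rev q) = qverts q"
  by (cases q) auto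

lemma P4_quad_rev: "(\<And>u v. E u v \<Longrightarrow> E v u) \<Longrightarrow> P4 E q \<Longrightarrow> P4 E (quad_rev q)"
  by (cases q) auto

lemma finite_covered: "finite M \<Longrightarrow> finite (covered M)"
  by (simp add: covered_def)

lemma card_covered: "finite M \<Longrightarrow> card (covered M) \<le> 4 * card M"
proof -
  assume "finite M"
  then have "card (covered M) \<le> (\<Sum>q\<in>M. card (qverts q))" unfolding covered_def by (rule card_UN_le)
  also have "\<dots> \<le> of_nat (card M) * 4" by (rule sum_bounded_above) (rule card_qverts)
  finally show ?thesis by simp
qed

text \<open>One step of a local search with weight \<open>w\<close>. The new path brings in a single
  vertex \<open>x\<close> that no path of \<open>M\<close> covers, so it stays disjoint from the
  untouched paths.\<close>

lemma packing_replace: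
  fixes w :: "'a quad \<Rightarrow> nat"
  assumes M: "packing E M" and q: "q \<in> M"
    and q': "P4 E q'" "qverts q' \<subseteq> insert x (qverts q)" and x: "x \<notin> covered M" and w: "w q' < w q"
  shows "\<exists>M'. packing E M' \<and> card M' = card M \<and> sum w M' < sum w M"
proof (intro exI conjI)
  let ?N = "M - {q}"
  have fin: "finite ?N" using M by (simp add: packing_def)
  have dis: "qverts q' \<inter> qverts s = {}" if "s \<in> ?N" for s
  proof -
    have "qverts q \<inter> qverts s = {}" using M q that by (auto simp: packing_def)
    moreover have "x \<notin> qverts s" using x that by (auto simp: covered_def)
    ultimately show ?thesis using q'(2) by blast
  qed
  have nq: "q' \<notin> ?N" using dis qverts_nonempty[of q'] by (metis Int_absorb)
  show "packing E (insert q' ?N)"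
    using M q'(1) dis fin unfolding packing_def by (auto simp: Int_commute)
  have finM: "finite M" using M by (simp add: packing_def)
  show "card (insert q' ?N) = card M"
    unfolding card_insert_disjoint[OF fin nq] by (rule card.remove[OF finM q, symmetric])
  show "sum w (insert q' ?N) < sum w M"
    unfolding sum.insert[OF fin nq] sum.remove[OF finM q] using w by simp
qed

lemma packing_replace2:
  fixes w :: "'a quad \<Rightarrow> nat"
  assumes M: "packing E M" and qr: "q \<in> M" "r \<in> M" "q \<noteq> r"
    and q': "P4 E q'" "P4 E r'" "qverts q' \<inter> qverts r' = {}" "qverts q' \<union> qverts r' \<subseteq> insert x (qverts q \<union> qverts r)"
    and x: "x \<notin> covered M" and w: "w q' + w r' < w q + w r"
  shows "\<exists>M'. packing E M' \<and> card M' = card M \<and> sum w M' < sum w M"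
proof (intro exI conjI)
  let ?N = "M - {q, r}"
  have fin: "finite ?N" using M by (simp add: packing_def)
  have dis: "qverts q' \<inter> qverts s = {}" "qverts r' \<inter> qverts s = {}" if "s \<in> ?N" for s
  proof -
    have "qverts q \<inter> qverts s = {}" "qverts r \<inter> qverts s = {}" using M qr that by (auto simp: packing_def)
    moreover have "x \<notin> qverts s" using x that by (auto simp: covered_def)
    ultimately show "qverts q' \<inter> qverts s = {}" "qverts r' \<inter> qverts s = {}" using q'(4) by blast+
  qed
  have nq: "q' \<notin> ?N" "r' \<notin> ?N" using dis qverts_nonempty[of q'] qverts_nonempty[of r'] by (metis Int_absorb)+
  have ne: "q' \<noteq> r'" using q'(3) by auto
  show "packing E (insert q' (insert r' ?N))"
    using M q'(1-3) dis fin unfolding packing_def by (auto simp: Int_commute)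
  have nq': "q' \<notin> insert r' ?N" and fin': "finite (insert r' ?N)" using nq ne fin by blast+
  have finM: "finite M" "finite (M - {q})" and rN: "r \<in> M - {q}" and N: "M - {q} - {r} = ?N"
    using M qr by (auto simp: packing_def)
  show "card (insert q' (insert r' ?N)) = card M"
    unfolding card_insert_disjoint[OF fin' nq'] card_insert_disjoint[OF fin nq(2)]
      card.remove[OF finM(1) qr(1)] card.remove[OF finM(2) rN] N ..
  show "sum w (insert q' (insert r' ?N)) < sum w M"
    unfolding sum.insert[OF fin' nq'] sum.insert[OF fin nq(2)]
      sum.remove[OF finM(1) qr(1)] sum.remove[OF finM(2) rN] N using w by simp
qed

section \<open>Sparsification: removing dropped edges from a packing by exchanges\<close>

text \<open>Here \<open>f a b\<close> is the bin into which \<open>a\<close> puts \<open>b\<close>, and \<open>Kp a b\<close> means that \<open>a\<close> keeps \<open>b\<close>.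
  By \<open>bal\<close>, moving one element to another admissible bin does not improve the balance.\<close>

locale sparsification =
  fixes E :: "'a \<Rightarrow> 'a \<Rightarrow> bool" and B :: "'a set" and f :: "'a \<Rightarrow> 'a \<Rightarrow> 'a" and Kp :: "'a \<Rightarrow> 'a \<Rightarrow> bool"
    and T k :: nat
  assumes sym: "E u v \<Longrightarrow> E v u"
    and irr: "\<not> E u u"
    and fin: "finite {b. E a b}"
    and indep: "b \<in> B \<Longrightarrow> b' \<in> B \<Longrightarrow> \<not> E b b'"
    and bin: "a \<notin> B \<Longrightarrow> b \<in> B \<Longrightarrow> E a b \<Longrightarrow> E b (f a b)"
    and bal: "a \<notin> B \<Longrightarrow> b \<in> B \<Longrightarrow> E a b \<Longrightarrow> E b p \<Longrightarrow>
      card {b' \<in> B. E a b' \<and> f a b' = f a b} \<le> card {b' \<in> B. E a b' \<and> f a b' = p} + 1"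
    and keep: "Kp a b \<Longrightarrow> a \<notin> B \<and> b \<in> B \<and> E a b"
    and keep_card: "a \<notin> B \<Longrightarrow> min (card {b \<in> B. E a b \<and> f a b = p}) (T + 1) \<le> card {b. Kp a b \<and> f a b = p}"
    and keep_full: "a \<notin> B \<Longrightarrow> b \<in> B \<Longrightarrow> E a b \<Longrightarrow> \<not> Kp a b \<Longrightarrow>
      T + 2 \<le> card {b' \<in> B. E a b' \<and> f a b' = f a b}"
    and T: "16 * k < T * T"
begin

definition load :: "'a \<Rightarrow> 'a \<Rightarrow> nat" where
  "load a p = card {b \<in> B. E a b \<and> f a b = p}"

text \<open>Besides \<open>ab\<close>, the edge from \<open>b\<close> to its bin
  \<open>f a b\<close> survives. Hence every kept \<open>b\<close> provides a connection of two
  surviving edges from \<open>a\<close> to \<open>f a b\<close>.\<close>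

definition E' :: "'a \<Rightarrow> 'a \<Rightarrow> bool" where
  "E' u v \<longleftrightarrow> E u v \<and> ((u \<notin> B \<and> v \<notin> B) \<or> Kp u v \<or> Kp v u
     \<or> (\<exists>a. Kp a u \<and> f a u = v) \<or> (\<exists>a. Kp a v \<and> f a v = u))"

lemma E'_sym: "E' u v \<Longrightarrow> E' v u"
  unfolding E'_def using sym by blast

lemma E'_E: "E' u v \<Longrightarrow> E u v"
  by (simp add: E'_def)

lemma Kp_E': "Kp a b \<Longrightarrow> E' a b" "Kp a b \<Longrightarrow> E' b a"
  using keep sym unfolding E'_def by blast+

lemma Kp_bin_E': "Kp a b \<Longrightarrow> E' (f a b) b" "Kp a b \<Longrightarrow> E' b (f a b)"
  using keep bin sym unfolding E'_def by blast+

lemma load_balanced: "a \<notin> B \<Longrightarrow> b \<in> B \<Longrightarrow> E a b \<Longrightarrow> E b p \<Longrightarrow> load a (f a b) \<le> load a p + 1"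
  using bal[of a b p] by (simp add: load_def)

text \<open>The bin of a vertex that is not kept has load at least \<open>T + 2\<close>; balance
  loses one on the way to the bin of another neighbour \<open>p\<close>.\<close>

lemma load_dropped:
  assumes "a \<notin> B" "b \<in> B" "E a b" "\<not> E' a b" "E b p"
  shows "T + 1 \<le> load a p"
proof -
  have "\<not> Kp a b" using assms Kp_E' by blast
  then have "T + 2 \<le> load a (f a b)" using keep_full[of a b] assms by (simp add: load_def)
  then show ?thesis using load_balanced[of a b p] assms by linarith
qed

lemma finite_kept: "finite {b. Kp a b \<and> P b}"
  by (rule finite_subset[OF _ fin[of a]]) (use keep in auto)

text \<open>The counting core of the exchange. \<open>NB\<close> leaves open which neighbour
  \<open>c\<close> of \<open>b'\<close> is chosen on each other path \<open>r\<close>, as this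
  depends on the shape of the exchange. At most one element of \<open>R\<close> lies on the path
  \<open>q\<close> under repair, so at least \<open>T\<close> of the \<open>T + 1\<close> elements
  are spread over other paths, at most four on each.\<close>

lemma augment:
  assumes a: "a \<notin> B" "b \<in> B" "E a b" "\<not> E' a b" "E b p"
    and M: "packing E M" "card M \<le> k" and q: "q \<in> M"
    and R: "R = {b. Kp a b \<and> f a b = p}" "R \<subseteq> covered M" "card (R \<inter> qverts q) \<le> 1"
    and NB: "\<And>r b'. r \<in> M - {q} \<Longrightarrow> b' \<in> R \<Longrightarrow> b' \<in> qverts r \<Longrightarrow> \<exists>c. NB r b' c \<and> c \<in> qverts r \<and> E b' c"
  obtains r b' c b'' where "r \<in> M" "r \<noteq> q" "b' \<in> R" "b' \<in> qverts r" "NB r b' c" "c \<in> qverts r"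
    "Kp a b''" "f a b'' = c" "b'' \<notin> covered M"
proof -
  have finM: "finite M" using M by (simp add: packing_def)
  have finR: "finite R" unfolding R by (rule finite_kept)
  have lp: "T + 1 \<le> load a p" using load_dropped a by blast
  have cR: "T + 1 \<le> card R" using keep_card[OF a(1), of p] lp by (simp add: R load_def)
  define Q where "Q = {r \<in> M - {q}. R \<inter> qverts r \<noteq> {}}"
  have finQ: "finite Q" using finM by (simp add: Q_def)
  have "\<forall>r\<in>Q. \<exists>b' c. b' \<in> R \<and> b' \<in> qverts r \<and> NB r b' c \<and> c \<in> qverts r \<and> E b' c"
    using NB unfolding Q_def by blast
  then obtain g d where gd: "\<And>r. r \<in> Q \<Longrightarrow> g r \<in> R \<and> g r \<in> qverts r \<and> NB r (g r) (d r) \<and> d r \<in> qverts r \<and> E (g r) (d r)"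
    by metis
  have "R \<subseteq> (R \<inter> qverts q) \<union> covered Q"
    using R(2) unfolding covered_def Q_def by blast
  then have "card R \<le> card ((R \<inter> qverts q) \<union> covered Q)" using finQ by (intro card_mono) (auto simp: finite_covered)
  also have "\<dots> \<le> 1 + card (covered Q)" using card_Un_le[of "R \<inter> qverts q" "covered Q"] R(3) by linarith
  also have "\<dots> \<le> 1 + 4 * card Q" using card_covered[OF finQ] by simp
  finally have TQ: "T \<le> 4 * card Q" using cR by linarith
  define U where "U = (\<lambda>r. {b. Kp a b \<and> f a b = d r})"
  have U: "T \<le> card (U r)" if "r \<in> Q" for r
  proof -
    \<comment> \<open>\<open>g r\<close> lies in bin \<open>p\<close> and is adjacent to
      \<open>d r\<close>, so balance bounds the load of \<open>p\<close> by that of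
      \<open>d r\<close> plus one. A load of at least \<open>T\<close> then means at least
      \<open>T\<close> kept vertices.\<close>
    have "Kp a (g r)" "f a (g r) = p" using gd[OF that] R(1) by auto
    then have "load a p \<le> load a (d r) + 1" using load_balanced[of a "g r" "d r"] keep gd[OF that] by auto
    then show ?thesis using keep_card[OF a(1), of "d r"] lp by (simp add: U_def load_def)
  qed
  have inj: "d r \<noteq> d s" if "r \<in> Q" "s \<in> Q" "r \<noteq> s" for r s
  proof -
    have "qverts r \<inter> qverts s = {}" using M that by (auto simp: packing_def Q_def)
    then show ?thesis using gd[OF that(1)] gd[OF that(2)] by auto
  qed
  have "card (\<Union>r\<in>Q. U r) = (\<Sum>r\<in>Q. card (U r))"
  proof (rule card_UN_disjoint[OF finQ])
    show "\<forall>r\<in>Q. finite (U r)"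
    proof
      show "finite (U r)" for r unfolding U_def by (rule finite_kept)
    qed
    show "\<forall>r\<in>Q. \<forall>s\<in>Q. r \<noteq> s \<longrightarrow> U r \<inter> U s = {}"
    proof (intro ballI impI)
      fix r s assume "r \<in> Q" "s \<in> Q" "r \<noteq> s"
      then have "d r \<noteq> d s" by (rule inj)
      then show "U r \<inter> U s = {}" unfolding U_def by auto
    qed
  qed
  moreover have "of_nat (card Q) * T \<le> (\<Sum>r\<in>Q. card (U r))"
    by (rule sum_bounded_below) (rule U)
  ultimately have QU: "card Q * T \<le> card (\<Union>r\<in>Q. U r)" by simp
  have "T * T \<le> 4 * (card Q * T)" using mult_right_mono[OF TQ, of T] by (simp add: mult.assoc)
  moreover have "card (covered M) \<le> 4 * k" using card_covered[OF finM] M by linarith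
  ultimately have "card (covered M) < card (\<Union>r\<in>Q. U r)" using T QU by linarith
  then have "\<not> (\<Union>r\<in>Q. U r) \<subseteq> covered M" using card_mono[OF finite_covered[OF finM]] by (metis leD)
  then obtain r b'' where "r \<in> Q" "b'' \<in> U r" "b'' \<notin> covered M" by blast
  then show thesis using that[of r "g r" "d r" b''] gd[of r] by (auto simp: U_def Q_def)
qed

fun dropped :: "'a quad \<Rightarrow> nat" where
  "dropped (a, b, c, d) = of_bool (\<not> E' a b) + of_bool (\<not> E' b c) + of_bool (\<not> E' c d)"

lemma dropped_quad_rev [simp]: "dropped (quad_rev q) = dropped q"
  by (cases q) (auto simp: of_bool_def dest: E'_sym)

text \<open>Up to reversal a vertex is the first or the second of its path, which leaves two shapes
  for every exchange.\<close>

lemma quad_around: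
  assumes "P4 E r" "b \<in> qverts r"
  obtains c z x where "r = (b, c, z, x) \<or> quad_rev r = (b, c, z, x)"
  | c c' x where "r = (c, b, c', x) \<or> quad_rev r = (c, b, c', x)"
  using assms by (cases r) auto

abbreviation same :: "'a quad \<Rightarrow> 'a quad \<Rightarrow> bool" where
  "same q q1 \<equiv> qverts q = qverts q1 \<and> dropped q = dropped q1 \<and> P4 E q1"

lemma quad_around_same:
  assumes "P4 E r" "b \<in> qverts r"
  shows "(\<exists>c z x. same r (b, c, z, x)) \<or> (\<exists>c c' x. same r (c, b, c', x))"
proof -
  have *: "same r r" "same r (quad_rev r)" using assms P4_quad_rev[of E r] sym by auto
  from assms show ?thesis
  proof (cases rule: quad_around)
    case (1 c z x)
    then show ?thesis using * by metis
  next
    case (2 c c' x)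
    then show ?thesis using * by metis
  qed
qed

text \<open>The flag tells whether \<open>a\<close> or \<open>p\<close> is an endpoint of the path.\<close>

lemma improve_middle:
  assumes M: "packing E M" "card M \<le> k" "q \<in> M"
    and q: "same q (if fl then (a, b, p, y) else (p, b, a, y))" and b: "b \<in> B" and d: "\<not> E' a b"
  shows "\<exists>M'. packing E M' \<and> card M' = card M \<and> sum dropped M' < sum dropped M"
proof -
  have ab: "a \<notin> B" "E a b" "E b p" "p \<notin> B" "E b a"
    using q b indep sym by (auto split: if_splits)
  have d': "\<not> E' b a" using d E'_sym by blast
  have qvq: "qverts q = {a, b, p, y}" using q by (auto split: if_splits)
  have dq: "dropped q = dropped (if fl then (a, b, p, y) else (p, b, a, y))" using q by blast
  have pq: "P4 E (if fl then (a, b, p, y) else (p, b, a, y))" using q by blast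
  define R where "R = {b. Kp a b \<and> f a b = p}"
  have R: "b' \<in> B" "E' a b'" "E' b' a" "E' p b'" "E' b' p" if "b' \<in> R" for b'
    using that keep[of a b'] Kp_E'[of a b'] Kp_bin_E'[of a b'] by (auto simp: R_def)
  have bR: "b \<notin> R" using R(2) d by blast
  have qM: "{a, b, p, y} \<subseteq> covered M" using M(3) qvq by (auto simp: covered_def)
  show ?thesis
  proof (cases "R \<subseteq> covered M")
    case False
    then obtain b' where b': "b' \<in> R" "b' \<notin> covered M" by blast
    show ?thesis
    proof (rule packing_replace[OF M(1,3), of "(if fl then (a, b', p, y) else (p, b', a, y))" b'])
      show "P4 E (if fl then (a, b', p, y) else (p, b', a, y))" using pq b' qM R[of b'] E'_E by (auto split: if_splits)
      show "qverts (if fl then (a, b', p, y) else (p, b', a, y)) \<subseteq> insert b' (qverts q)" unfolding qvq by (auto split: if_splits)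
      show "dropped (if fl then (a, b', p, y) else (p, b', a, y)) < dropped q" unfolding dq using R[OF b'(1)] d d' by simp
    qed (rule b')
  next
    case True
    \<comment> \<open>If \<open>b'\<close> is the second vertex of its path, \<open>c\<close> has to
      be the neighbour followed by the tail \<open>x\<close> when \<open>a\<close> is an endpoint of
      its own path, and the other neighbour when \<open>a\<close> carries the tail \<open>y\<close>.
      In this way each of the two new paths gets exactly one tail and thus four vertices.\<close>
    define NB where "NB = (\<lambda>r b' c. (\<exists>z x. same r (b', c, z, x)) \<or> (\<exists>c' x. same r (if fl then (c', b', c, x) else (c, b', c', x))))"
    obtain r b' c b'' where r: "r \<in> M" "r \<noteq> q" "b' \<in> R" "b' \<in> qverts r" "NB r b' c" "c \<in> qverts r"
      "Kp a b''" "f a b'' = c" "b'' \<notin> covered M"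
    proof (rule augment[OF ab(1) b ab(2) d ab(3) M R_def True, of NB])
      \<comment> \<open>\<open>a\<close> and \<open>p\<close> are outside \<open>B\<close>, and
        \<open>b\<close> is not kept because the edge \<open>ab\<close> is dropped; only the tail
        \<open>y\<close> can belong to \<open>R\<close>.\<close>
      have "R \<inter> qverts q \<subseteq> {y}" using qvq bR ab R(1) by auto
      from card_mono[OF _ this] show "card (R \<inter> qverts q) \<le> 1" by simp
      show "\<exists>c. NB r b' c \<and> c \<in> qverts r \<and> E b' c" if "r \<in> M - {q}" "b' \<in> R" "b' \<in> qverts r" for r b'
      proof -
        have "P4 E r" using M(1) that by (auto simp: packing_def)
        from quad_around_same[OF this that(3)] show ?thesis
        proof (elim disjE exE)
          fix c z x assume s: "same r (b', c, z, x)"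
          then have "NB r b' c" unfolding NB_def by blast
          moreover have "c \<in> qverts r" "E b' c" using s by auto
          ultimately show ?thesis by blast
        next
          fix c c' x assume s: "same r (c, b', c', x)"
          then have "NB r b' (if fl then c' else c)" unfolding NB_def by (cases fl) auto
          moreover have "(if fl then c' else c) \<in> qverts r" "E b' (if fl then c' else c)" using s sym by auto
          ultimately show ?thesis by blast
        qed
      qed
    qed blast
    have dis: "qverts q \<inter> qverts r = {}" using M r by (auto simp: packing_def)
    have rM: "qverts r \<subseteq> covered M" using r(1) by (auto simp: covered_def)
    have new: "b'' \<notin> qverts q" "b'' \<notin> qverts r" using r(9) M(3) rM by (auto simp: covered_def)
    have b'': "E' a b''" "E' b'' a" "E' c b''" "E' b'' c" using Kp_E'[of a b''] Kp_bin_E'[of a b''] r by auto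
    note b' = R[OF r(3)]
    note edges = b' b'' b'(2-)[THEN E'_E] b''[THEN E'_E]
    from r(5) show ?thesis unfolding NB_def
    proof (elim disjE exE)
      \<comment> \<open>\<open>b'\<close> is an endpoint of \<open>r\<close>: it takes the place of
        \<open>b\<close> in \<open>q\<close>, and \<open>b''\<close> becomes the new endpoint next
        to \<open>c\<close>.\<close>
      fix z x assume s: "same r (b', c, z, x)"
      then have qvr: "qverts r = {b', c, z, x}" by auto
      have dr: "dropped r = dropped (b', c, z, x)" using s by blast
      have pr: "P4 E (b', c, z, x)" using s by blast
      have ne: "distinct [a, b, p, y, b', c, z, x, b'']"
        using pq pr dis new unfolding qvq qvr by (auto split: if_splits)
      have ne': "distinct (rev [a, b, p, y, b', c, z, x, b''])" using ne unfolding distinct_rev .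
      show ?thesis
      proof (rule packing_replace2[OF M(1,3) r(1) r(2)[symmetric], of "(if fl then (a, b', p, y) else (p, b', a, y))" "(b'', c, z, x)" b''])
        show "P4 E (if fl then (a, b', p, y) else (p, b', a, y))" using ne ne' pq edges by (cases fl) simp_all
        show "P4 E (b'', c, z, x)" using ne ne' pr edges by (cases fl) simp_all
        show "qverts (if fl then (a, b', p, y) else (p, b', a, y)) \<inter> qverts (b'', c, z, x) = {}" using ne by (auto split: if_splits)
        show "qverts (if fl then (a, b', p, y) else (p, b', a, y)) \<union> qverts (b'', c, z, x) \<subseteq> insert b'' (qverts q \<union> qverts r)"
          unfolding qvq qvr by (auto split: if_splits)
        show "dropped (if fl then (a, b', p, y) else (p, b', a, y)) + dropped (b'', c, z, x) < dropped q + dropped r"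
          unfolding dq dr using b' b'' d d' by (cases fl) simp_all
      qed (rule r(9))
    next
      \<comment> \<open>\<open>b'\<close> is an inner vertex of \<open>r\<close>: the paths are
        recombined. The new edges \<open>a b''\<close>, \<open>b'' c\<close> and \<open>p b'\<close>
        all survive, the other edges are inherited, and the dropped edge \<open>ab\<close>
        disappears.\<close>
      fix c' x assume s: "same r (if fl then (c', b', c, x) else (c, b', c', x))"
      then have qvr: "qverts r = {c, b', c', x}" by (auto split: if_splits)
      have dr: "dropped r = dropped (if fl then (c', b', c, x) else (c, b', c', x))" using s by blast
      have pr: "P4 E (if fl then (c', b', c, x) else (c, b', c', x))" using s by blast
      have ne: "distinct [a, b, p, y, c, b', c', x, b'']"
        using pq pr dis new unfolding qvq qvr by (auto split: if_splits)
      have ne': "distinct (rev [a, b, p, y, c, b', c', x, b''])" using ne unfolding distinct_rev .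
      show ?thesis
      proof (rule packing_replace2[OF M(1,3) r(1) r(2)[symmetric], of "(if fl then (a, b'', c, x) else (c, b'', a, y))" "(if fl then (c', b', p, y) else (p, b', c', x))" b''])
        show "P4 E (if fl then (a, b'', c, x) else (c, b'', a, y))" using ne ne' pq pr edges by (cases fl) simp_all
        show "P4 E (if fl then (c', b', p, y) else (p, b', c', x))" using ne ne' pq pr edges by (cases fl) simp_all
        show "qverts (if fl then (a, b'', c, x) else (c, b'', a, y)) \<inter> qverts (if fl then (c', b', p, y) else (p, b', c', x)) = {}" using ne by (auto split: if_splits)
        show "qverts (if fl then (a, b'', c, x) else (c, b'', a, y)) \<union> qverts (if fl then (c', b', p, y) else (p, b', c', x)) \<subseteq> insert b'' (qverts q \<union> qverts r)"
          unfolding qvq qvr by (auto split: if_splits)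
        show "dropped (if fl then (a, b'', c, x) else (c, b'', a, y)) + dropped (if fl then (c', b', p, y) else (p, b', c', x)) < dropped q + dropped r"
          unfolding dq dr using b' b'' d d' by (cases fl) simp_all
      qed (rule r(9))
    qed
  qed
qed

text \<open>Here \<open>b\<close> is an endpoint with sole path neighbour \<open>a\<close>, so any
  uncovered vertex kept by \<open>a\<close> can replace it. \<open>augment\<close> with
  \<open>p = a\<close> yields one; this is where \<open>a\<close> occurs as its own partner.\<close>

lemma improve_end:
  assumes M: "packing E M" "card M \<le> k" "q \<in> M"
    and q: "same q (b, a, x, y)" and b: "b \<in> B" and d: "\<not> E' b a"
  shows "\<exists>M'. packing E M' \<and> card M' = card M \<and> sum dropped M' < sum dropped M"
proof -
  have ab: "a \<notin> B" "E a b" "E b a" "E x y" using q b indep sym by auto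
  have d': "\<not> E' a b" using d E'_sym by blast
  define R where "R = {b. Kp a b \<and> f a b = a}"
  have qM: "{a, b, x, y} \<subseteq> covered M" using M(3) q by (auto simp: covered_def)
  have "\<exists>b''. Kp a b'' \<and> b'' \<notin> covered M"
  proof (cases "R \<subseteq> covered M")
    case False
    then show ?thesis by (auto simp: R_def)
  next
    case True
    obtain r b' c b'' where "Kp a b''" "b'' \<notin> covered M"
    proof (rule augment[OF ab(1) b ab(2) d' ab(3) M R_def True, of "\<lambda>_ _ _. True"])
      have "b' \<in> B \<and> b' \<noteq> a \<and> b' \<noteq> b" if "b' \<in> R" for b'
        using that keep[of a b'] Kp_E'[of a b'] d' irr by (auto simp: R_def)
      \<comment> \<open>\<open>x\<close> and \<open>y\<close> are adjacent and \<open>B\<close> is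
        independent, so not both of them are in \<open>R\<close>.\<close>
      then have "R \<inter> qverts q \<subseteq> {x} \<or> R \<inter> qverts q \<subseteq> {y}" using q ab(4) indep by auto
      then show "card (R \<inter> qverts q) \<le> 1" using card_mono[of "{_}" "R \<inter> qverts q"] by (metis card_1_singleton_iff finite.emptyI finite.insertI One_nat_def)
      show "\<exists>c. True \<and> c \<in> qverts r \<and> E b' c" if "r \<in> M - {q}" "b' \<in> R" "b' \<in> qverts r" for r b'
      proof -
        have "P4 E r" using M(1) that by (auto simp: packing_def)
        from quad_around_same[OF this that(3)] show ?thesis by (elim disjE exE) (auto intro: sym)
      qed
    qed blast
    then show ?thesis by blast
  qed
  then obtain b'' where b'': "Kp a b''" "b'' \<notin> covered M" by blast
  show ?thesis
  proof (rule packing_replace[OF M(1,3), of "(b'', a, x, y)" b''])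
    show "P4 E (b'', a, x, y)" using q b'' qM Kp_E'[of a b''] E'_E by auto
    show "dropped (b'', a, x, y) < dropped q" using q Kp_E'[of a b''] b'' d by simp
  qed (use q b'' in auto)
qed

text \<open>Every dropped edge has an end \<open>b\<close> in \<open>B\<close>. Up to reversal,
  \<open>b\<close> is an endpoint of the path (\<open>improve_end\<close>), or an inner vertex whose
  outer edge (flag \<open>True\<close>) or middle edge (flag \<open>False\<close>) is
  dropped.\<close>

lemma improve:
  assumes M: "packing E M" "card M \<le> k" "q \<in> M" and d: "dropped q \<noteq> 0"
  shows "\<exists>M'. packing E M' \<and> card M' = card M \<and> sum dropped M' < sum dropped M"
proof -
  obtain v1 v2 v3 v4 where q: "q = (v1, v2, v3, v4)" by (metis prod_cases4)
  have p: "P4 E q" using M by (auto simp: packing_def)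
  have s: "same q (v1, v2, v3, v4)" "same q (v4, v3, v2, v1)"
    using p q P4_quad_rev[of E q] dropped_quad_rev[of q] qverts_quad_rev[of q] sym by auto
  have e: "u \<in> B \<or> v \<in> B" if "E u v" "\<not> E' u v" for u v using that by (auto simp: E'_def)
  from d consider "\<not> E' v1 v2" | "\<not> E' v2 v3" | "\<not> E' v3 v4" by (auto simp: q split: if_splits)
  then show ?thesis
  proof cases
    case 1
    then have "v1 \<in> B \<or> v2 \<in> B" using e p q by auto
    then show ?thesis using improve_end[OF M s(1)] improve_middle[where fl = True, unfolded if_True, OF M s(1)] 1 by blast
  next
    case 2
    then have "v2 \<in> B \<or> v3 \<in> B" using e p q by auto
    then show ?thesis using improve_middle[where fl = False, unfolded if_False, OF M s(1)]
      improve_middle[where fl = False, unfolded if_False, OF M s(2)] 2 E'_sym by blast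
  next
    case 3
    then have "v3 \<in> B \<or> v4 \<in> B" using e p q by auto
    then show ?thesis using improve_end[OF M s(2)] improve_middle[where fl = True, unfolded if_True, OF M s(2)] 3 E'_sym by blast
  qed
qed

text \<open>Among all packings of \<open>k\<close> paths, one with the fewest dropped edges has
  none, since \<open>improve\<close> would produce one with fewer.\<close>

lemma sparsified_packing:
  assumes "has_packing E k" shows "has_packing E' k"
proof -
  obtain M0 where "packing E M0 \<and> card M0 = k" using assms by (auto simp: has_packing_def)
  from ex_has_least_nat[of "\<lambda>M. packing E M \<and> card M = k", OF this, of "sum dropped"]
  obtain M where M: "packing E M" "card M = k"
    and least: "\<And>N. packing E N \<Longrightarrow> card N = k \<Longrightarrow> sum dropped M \<le> sum dropped N" by blast
  have "P4 E' q" if qM: "q \<in> M" for q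
  proof -
    have "dropped q = 0"
    proof (rule ccontr)
      assume "dropped q \<noteq> 0"
      then obtain N where "packing E N" "card N = card M" "sum dropped N < sum dropped M"
        using improve[OF M(1) _ qM] M(2) by blast
      then show False using least[of N] M(2) by simp
    qed
    moreover have "P4 E q" using M(1) qM by (auto simp: packing_def)
    ultimately show ?thesis by (cases q) (auto split: if_splits)
  qed
  then have "packing E' M" using M(1) unfolding packing_def by blast
  then show ?thesis using M(2) by (auto simp: has_packing_def)
qed

end

section \<open>The graph around a maximal packing: rich vertices, useful edges and counting\<close>

lemma packing_subset:
  assumes "packing E M" "N \<subseteq> M" shows "packing E N"
  unfolding packing_def
proof (intro conjI ballI impI)
  show "finite N" using assms finite_subset by (auto simp: packing_def)
next
  fix q assume "q \<in> N"
  then have "q \<in> M" using assms(2) by (rule subsetD[rotated])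
  then show "P4 E q" using assms(1) by (simp add: packing_def)
next
  fix q r assume "q \<in> N" "r \<in> N" "q \<noteq> r"
  moreover from this have "q \<in> M" "r \<in> M" using assms(2) by (simp_all only: subsetD)
  ultimately show "qverts q \<inter> qverts r = {}" using assms(1) by (simp add: packing_def)
qed

lemma has_packing_mono:
  assumes "has_packing E k" "j \<le> k" shows "has_packing E j"
proof -
  obtain M where M: "packing E M" "card M = k" using assms by (auto simp: has_packing_def)
  obtain N where "N \<subseteq> M" "card N = j" using obtain_subset_with_card_n[of j M] assms(2) M(2) by blast
  then show ?thesis using packing_subset[OF M(1)] unfolding has_packing_def by blast
qed

lemma card_le_2:
  assumes "\<And>x y z. x \<in> A \<Longrightarrow> y \<in> A \<Longrightarrow> z \<in> A \<Longrightarrow> x \<noteq> y \<Longrightarrow> x \<noteq> z \<Longrightarrow> y \<noteq> z \<Longrightarrow> False"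
  shows "card A \<le> 2"
proof (rule ccontr)
  assume "\<not> card A \<le> 2"
  then obtain B where "B \<subseteq> A" "card B = 3" using obtain_subset_with_card_n[of 3 A] by auto
  then obtain x y z where "B = {x, y, z}" "x \<noteq> y" "x \<noteq> z" "y \<noteq> z" by (auto simp: card_3_iff)
  with \<open>B \<subseteq> A\<close> assms show False by blast
qed

lemma card_UN_bound:
  assumes "finite I" "\<And>i. i \<in> I \<Longrightarrow> card (A i) \<le> m"
  shows "card (\<Union>i\<in>I. A i) \<le> card I * m"
proof -
  have "card (\<Union>i\<in>I. A i) \<le> (\<Sum>i\<in>I. card (A i))" by (rule card_UN_le[OF assms(1)])
  also have "\<dots> \<le> of_nat (card I) * m" by (rule sum_bounded_above) (rule assms(2))
  finally show ?thesis by simp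
qed

lemma card_Sigma_bound:
  assumes "finite I" "\<And>i. i \<in> I \<Longrightarrow> finite (A i)" "\<And>i. i \<in> I \<Longrightarrow> card (A i) \<le> m"
  shows "card (Sigma I A) \<le> card I * m"
proof -
  have "card (Sigma I A) = (\<Sum>i\<in>I. card (A i))" using assms by (intro card_SigmaI) auto
  also have "\<dots> \<le> of_nat (card I) * m" by (rule sum_bounded_above) (rule assms(3))
  finally show ?thesis by simp
qed

text \<open>The maximal packing enters through its vertex set: a set \<open>S\<close> of at most
  \<open>4 * k\<close> vertices that meets every path on four vertices.\<close>

locale maximal_packing =
  fixes E :: "'a \<Rightarrow> 'a \<Rightarrow> bool" and V S :: "'a set" and k :: nat
  assumes sym: "E u v \<Longrightarrow> E v u"
    and irr: "\<not> E u u"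
    and finV: "finite V"
    and EV: "E u v \<Longrightarrow> u \<in> V"
    and SV: "S \<subseteq> V"
    and card_S: "card S \<le> 4 * k"
    and maximal: "P4 E q \<Longrightarrow> qverts q \<inter> S \<noteq> {}"
begin

definition R :: "'a set" where "R = V - S"

text \<open>The components of the graph induced by \<open>R\<close> are triangles and stars. \<open>C\<close> consists of the
  triangles, the single edges and the centers of the larger stars; \<open>B\<close> consists of the leaves of
  the larger stars and the isolated vertices.\<close>

definition C :: "'a set" where
  "C = {v \<in> R. (\<exists>u\<in>R. \<exists>w\<in>R. u \<noteq> w \<and> E v u \<and> E v w) \<or> (\<exists>w\<in>R. E v w \<and> (\<forall>x\<in>R. E w x \<longrightarrow> x = v))}"

definition B :: "'a set" where "B = R - C"

definition Gam :: "'a \<Rightarrow> 'a set" where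
  "Gam s = {c \<in> C. E s c \<or> (\<exists>r\<in>R. E s r \<and> E r c)}"

definition X :: "'a set" where
  "X = {s \<in> S. 12 * k \<le> card (Gam s)}"

lemma CR: "C \<subseteq> R" and BR: "B \<subseteq> R" and GamC: "Gam s \<subseteq> C" and XS: "X \<subseteq> S"
  by (auto simp: C_def B_def Gam_def X_def)

lemma finite_sets: "finite S" "finite R" "finite C" "finite (Gam s)" "finite X"
proof -
  show "finite S" using finV SV by (rule finite_subset[rotated])
  then show "finite X" using XS by (rule finite_subset[rotated])
  show "finite R" using finV by (simp add: R_def)
  then show "finite C" using CR by (rule finite_subset[rotated])
  then show "finite (Gam s)" using GamC by (rule finite_subset[rotated])
qed

lemma RI: "E u v \<Longrightarrow> u \<in> S \<or> u \<in> R"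
  using EV by (auto simp: R_def)

lemma no_path: "a \<in> R \<Longrightarrow> b \<in> R \<Longrightarrow> c \<in> R \<Longrightarrow> d \<in> R \<Longrightarrow> distinct [a, b, c, d] \<Longrightarrow>
    E a b \<Longrightarrow> E b c \<Longrightarrow> E c d \<Longrightarrow> False"
  using maximal[of "(a, b, c, d)"] by (auto simp: R_def)

lemma C_nbr: "c \<in> C \<Longrightarrow> \<exists>w\<in>R. E c w"
  by (auto simp: C_def)

lemma B_one: "b \<in> B \<Longrightarrow> x \<in> R \<Longrightarrow> y \<in> R \<Longrightarrow> E b x \<Longrightarrow> E b y \<Longrightarrow> x = y"
  unfolding B_def C_def by blast

text \<open>Otherwise \<open>b'\<close> would be the only neighbour of \<open>b\<close> in
  \<open>R\<close>, and the second clause of \<open>C\<close>, with witness \<open>b\<close>, would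
  put \<open>b'\<close> into \<open>C\<close>.\<close>

lemma B_indep: "b \<in> B \<Longrightarrow> b' \<in> B \<Longrightarrow> \<not> E b b'"
proof
  assume b: "b \<in> B" "b' \<in> B" "E b b'"
  then have "b \<in> R" "b' \<in> R" using BR by auto
  moreover have "\<forall>x\<in>R. E b x \<longrightarrow> x = b'" using B_one b BR by blast
  ultimately have "b' \<in> C" unfolding C_def using b sym by blast
  then show False using b by (simp add: B_def)
qed

text \<open>Let \<open>x\<close>, \<open>y\<close>, \<open>z\<close> be three such neighbours of
  \<open>v\<close>. Since \<open>x\<close> is in \<open>C\<close>, it has a further neighbour
  \<open>u\<close> in \<open>R\<close>: a witness \<open>v\<close> for the second clause is excluded
  because \<open>v\<close> is also adjacent to \<open>y\<close>. Then \<open>u x v\<close> extends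
  to a path inside \<open>R\<close> by whichever of \<open>y\<close> and \<open>z\<close> differs
  from \<open>u\<close>.\<close>

lemma C_nbrs: assumes v: "v \<in> R" shows "card {c \<in> C. E v c} \<le> 2"
proof (rule card_le_2)
  fix x y z assume *: "x \<in> {c \<in> C. E v c}" "y \<in> {c \<in> C. E v c}" "z \<in> {c \<in> C. E v c}"
    and ne: "x \<noteq> y" "x \<noteq> z" "y \<noteq> z"
  have R: "x \<in> R" "y \<in> R" "z \<in> R" and e: "E v x" "E v y" "E v z" using * CR by auto
  have nv: "v \<noteq> x" "v \<noteq> y" "v \<noteq> z" using e irr by auto
  have "\<exists>u\<in>R. u \<noteq> v \<and> E x u"
  proof (rule ccontr)
    assume no: "\<not> ?thesis"
    then have only: "u = v" if "u \<in> R" "E x u" for u using that by auto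
    have "(\<exists>u\<in>R. \<exists>w\<in>R. u \<noteq> w \<and> E x u \<and> E x w) \<or> (\<exists>w\<in>R. E x w \<and> (\<forall>x'\<in>R. E w x' \<longrightarrow> x' = x))"
      using * by (simp add: C_def)
    then show False
    proof (elim disjE bexE conjE)
      fix u w assume "u \<in> R" "w \<in> R" "u \<noteq> w" "E x u" "E x w"
      then show False using only[of u] only[of w] by simp
    next
      fix w assume w: "w \<in> R" "E x w" "\<forall>x'\<in>R. E w x' \<longrightarrow> x' = x"
      then have "w = v" using only by simp
      then have "y = x" using w(3) R(2) e(2) by simp
      then show False using ne by simp
    qed
  qed
  then obtain u where u: "u \<in> R" "u \<noteq> v" "E x u" by blast
  have ux: "u \<noteq> x" using u irr by auto
  show False
  proof (cases "u = y")
    case True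
    then show False using no_path[of z v x u] R v e u ux nv ne sym by auto
  next
    case False
    then show False using no_path[of y v x u] R v e u ux nv ne sym by auto
  qed
qed

text \<open>A vertex of \<open>U\<close> blocks itself and its at most two neighbours in
  \<open>C\<close>, three vertices in all. An unblocked \<open>c\<close> in \<open>Gam s\<close> is
  outside \<open>U\<close> and has no neighbour in \<open>U\<close> within \<open>R\<close>; so both
  \<open>c\<close> and its neighbour, be it the intermediate vertex \<open>r\<close> or any
  neighbour given by \<open>C_nbr\<close>, are free.\<close>

lemma pendant_edge:
  assumes s: "s \<in> S" and U: "finite U" "3 * card U < card (Gam s)"
  obtains y z where "y \<in> R" "z \<in> R" "y \<notin> U" "z \<notin> U" "E s y" "E y z"
proof -
  let ?bl = "U \<union> (\<Union>v\<in>U \<inter> R. {c \<in> C. E v c})"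
  have "card ?bl \<le> card U + card (\<Union>v\<in>U \<inter> R. {c \<in> C. E v c})" by (rule card_Un_le)
  also have "card (\<Union>v\<in>U \<inter> R. {c \<in> C. E v c}) \<le> card (U \<inter> R) * 2"
    using U C_nbrs by (intro card_UN_bound) auto
  also have "card (U \<inter> R) \<le> card U" using U by (intro card_mono) auto
  finally have "card ?bl < card (Gam s)" using U by linarith
  moreover have "finite ?bl" using U finite_sets by auto
  ultimately have "\<not> Gam s \<subseteq> ?bl" using card_mono by (metis leD)
  then obtain c where c: "c \<in> Gam s" "c \<notin> ?bl" by blast
  have cC: "c \<in> C" "c \<in> R" using c GamC CR by auto
  from c(1) consider "E s c" | r where "r \<in> R" "E s r" "E r c" by (auto simp: Gam_def)
  then show thesis
  proof cases
    case 1
    obtain w where w: "w \<in> R" "E c w" using C_nbr cC by blast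
    then have "w \<notin> U" using c cC sym by blast
    then show thesis using that[of c w] 1 c cC w by blast
  next
    case 2
    then have "r \<notin> U" using c cC by blast
    then show thesis using that[of r c] 2 c cC by blast
  qed
qed

text \<open>Two applications of \<open>pendant_edge\<close> give a path \<open>x s y z\<close>: one
  for \<open>y z\<close>, the other for \<open>x\<close> with \<open>y\<close> and \<open>z\<close>
  forbidden as well. At most \<open>4k - 4 + 2\<close> vertices are then blocked, and three times
  this number is below \<open>12k\<close>, which explains the constant in \<open>X\<close>.\<close>

lemma rich_path:
  assumes s: "s \<in> X" and U: "finite U" "card U + 4 \<le> 4 * k" "s \<notin> U"
  obtains q where "P4 E q" "s \<in> qverts q" "qverts q \<inter> U = {}" "qverts q \<subseteq> insert s R"
proof -
  have sS: "s \<in> S" and G: "12 * k \<le> card (Gam s)" using s by (auto simp: X_def)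
  have "3 * card U < card (Gam s)" using G U(2) by linarith
  then obtain y z where yz: "y \<in> R" "z \<in> R" "y \<notin> U" "z \<notin> U" "E s y" "E y z"
    using pendant_edge[OF sS U(1)] by blast
  have "card (insert y (insert z U)) \<le> card U + 2" using U(1) by (simp add: card_insert_if)
  then have "3 * card (insert y (insert z U)) < card (Gam s)" using G U(2) by linarith
  then obtain x w where x: "x \<in> R" "x \<notin> insert y (insert z U)" "E s x"
    using pendant_edge[OF sS, of "insert y (insert z U)"] U(1) by blast
  have "s \<notin> R" using sS by (simp add: R_def)
  then have "P4 E (x, s, y, z)" using x yz sym irr by auto
  then show thesis using x yz U(3) by (intro that[of "(x, s, y, z)"]) auto
qed

definition E1 :: "'a \<Rightarrow> 'a \<Rightarrow> bool" where
  "E1 u v \<longleftrightarrow> E u v \<and> u \<notin> X \<and> v \<notin> X"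

lemma P4_E1: "P4 E1 q \<longleftrightarrow> P4 E q \<and> qverts q \<inter> X = {}"
  by (cases q) (auto simp: E1_def)

text \<open>The path added for \<open>x\<close> meets \<open>S\<close> in \<open>x\<close> alone, so
  the rich vertices not yet treated remain uncovered.\<close>

lemma extend_rich:
  assumes M: "packing E M" "card M = j" "covered M \<inter> X = {}" and Y: "finite Y" "Y \<subseteq> X" "j + card Y \<le> k"
  shows "\<exists>N. packing E N \<and> card N = j + card Y \<and> covered N \<inter> (X - Y) = {}"
  using Y
proof (induction Y rule: finite_induct)
  case empty
  then show ?case using M by auto
next
  case (insert x Y)
  then obtain N where N: "packing E N" "card N = j + card Y" "covered N \<inter> (X - Y) = {}" by auto
  have fin: "finite N" using N by (simp add: packing_def)
  have "card (covered N) + 4 \<le> 4 * k" using card_covered[OF fin] N insert by simp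
  moreover have "x \<notin> covered N" using N insert by auto
  moreover have "x \<in> X" using insert by auto
  ultimately obtain q where q: "P4 E q" "x \<in> qverts q" "qverts q \<inter> covered N = {}" "qverts q \<subseteq> insert x R"
    using rich_path[of x "covered N"] finite_covered[OF fin] by blast
  have qN: "q \<notin> N" using q by (auto simp: covered_def)
  have RX: "R \<inter> X = {}" using XS by (auto simp: R_def)
  have dis: "qverts q \<inter> qverts r = {}" if "r \<in> N" for r using q(3) that by (auto simp: covered_def)
  have "packing E (insert q N)"
    using N(1) q(1) dis fin unfolding packing_def by (auto simp: Int_commute)
  moreover have "card (insert q N) = j + card (insert x Y)" using N(2) fin qN insert by simp
  moreover have "covered (insert q N) \<inter> (X - insert x Y) = {}"
    using N(3) q(4) RX by (auto simp: covered_def)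
  ultimately show ?case by blast
qed

lemma delete_rich: "has_packing E1 (k - card X) \<longleftrightarrow> has_packing E k"
proof
  assume "has_packing E1 (k - card X)"
  then obtain M where M: "packing E1 M" "card M = k - card X" by (auto simp: has_packing_def)
  have ME: "packing E M" "covered M \<inter> X = {}" using M(1) P4_E1 by (auto simp: packing_def covered_def)
  show "has_packing E k"
  proof (cases "card X \<le> k")
    case True
    then show ?thesis using extend_rich[OF ME(1) M(2) ME(2) finite_sets(5) order_refl]
      by (auto simp: has_packing_def)
  next
    case False
    \<comment> \<open>With more than \<open>k\<close> rich vertices the truncated difference is
      \<open>0\<close>, and any \<open>k\<close> of them already yield \<open>k\<close> disjoint
      paths.\<close>
    then obtain Y where Y: "Y \<subseteq> X" "card Y = k" using obtain_subset_with_card_n[of k X] by auto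
    then show ?thesis
      using extend_rich[OF ME(1) M(2) ME(2) finite_subset[OF Y(1) finite_sets(5)] Y(1)] False
      by (auto simp: has_packing_def)
  qed
next
  assume "has_packing E k"
  then obtain M where M: "packing E M" "card M = k" by (auto simp: has_packing_def)
  have fin: "finite M" using M by (simp add: packing_def)
  \<comment> \<open>Disjoint paths through \<open>X\<close> use distinct vertices of
    \<open>X\<close>, so at most \<open>card X\<close> paths are lost by discarding
    \<open>?H\<close>.\<close>
  let ?H = "{q \<in> M. qverts q \<inter> X \<noteq> {}}"
  have "\<forall>q\<in>?H. \<exists>x. x \<in> qverts q \<inter> X" by blast
  from bchoice[OF this] obtain g where g': "\<forall>q\<in>?H. g q \<in> qverts q \<inter> X" ..
  note g = bspec[OF g']
  have "inj_on g ?H"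
  proof (rule inj_onI)
    fix q r assume *: "q \<in> ?H" "r \<in> ?H" "g q = g r"
    then have "g q \<in> qverts q \<inter> qverts r" using g[OF *(1)] g[OF *(2)] by simp
    moreover have "q \<in> M" "r \<in> M" using * by simp_all
    ultimately show "q = r" using M(1) unfolding packing_def by (metis empty_iff)
  qed
  moreover have "g ` ?H \<subseteq> X" using g by (intro image_subsetI) (rule IntD2)
  ultimately have "card ?H \<le> card X" using finite_sets(5) by (rule card_inj_on_le)
  moreover have "card M = card ?H + card (M - ?H)" 
    using card_Diff_subset[of ?H M] card_mono[of M ?H] fin by simp
  ultimately have "k - card X \<le> card (M - ?H)" using M by linarith
  moreover have "packing E1 (M - ?H)"
    using packing_subset[OF M(1), of "M - ?H"] by (auto simp: packing_def P4_E1)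
  then have "has_packing E1 (card (M - ?H))" by (auto simp: has_packing_def)
  ultimately show "has_packing E1 (k - card X)" using has_packing_mono by blast
qed

definition E2 :: "'a \<Rightarrow> 'a \<Rightarrow> bool" where
  "E2 u v \<longleftrightarrow> (\<exists>a b c d. P4 E1 (a, b, c, d) \<and> (u, v) \<in> {(a, b), (b, a), (b, c), (c, b), (c, d), (d, c)})"

lemma E2_E1: "E2 u v \<Longrightarrow> E1 u v"
  using sym by (auto simp: E2_def E1_def)

lemma E2_E: "E2 u v \<Longrightarrow> E u v" and E2_X: "E2 u v \<Longrightarrow> u \<notin> X \<and> v \<notin> X"
  using E2_E1 by (auto simp: E1_def)

lemma E2_sym: "E2 u v \<Longrightarrow> E2 v u"
  unfolding E2_def by blast

lemma P4_E2: "P4 E2 q \<longleftrightarrow> P4 E1 q"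
proof
  show "P4 E2 q \<Longrightarrow> P4 E1 q" by (cases q) (auto dest: E2_E1)
  assume *: "P4 E1 q"
  obtain a b c d where q: "q = (a, b, c, d)" by (metis prod_cases4)
  have "E2 a b" "E2 b c" "E2 c d" using * unfolding E2_def q by blast+
  then show "P4 E2 q" using * q by simp
qed

lemma has_packing_E2: "has_packing E2 j \<longleftrightarrow> has_packing E1 j"
  by (simp add: has_packing_def packing_def P4_E2)

abbreviation S' :: "'a set" where "S' \<equiv> S - X"

definition Cn :: "'a set" where
  "Cn = {c \<in> C. \<exists>v. E2 c v}"

lemma Gam_poor: "s \<in> S' \<Longrightarrow> card (Gam s) \<le> 12 * k"
  by (auto simp: X_def)

lemma card_S': "card S' \<le> 4 * k"
  using card_S card_mono[of S S'] finite_sets by auto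

lemma E2_Gam: "E2 s c \<Longrightarrow> s \<in> S \<Longrightarrow> c \<in> C \<Longrightarrow> s \<in> S' \<and> c \<in> Gam s"
  using E2_E E2_X by (auto simp: Gam_def)

text \<open>This is the gain from deleting the edges on no path: a vertex of \<open>C\<close> that
  still has an edge lies on a path of \<open>E1\<close>, which avoids \<open>X\<close> but meets
  \<open>S\<close>, so a vertex of \<open>S'\<close> is at most three steps away.\<close>

lemma touched:
  assumes "c \<in> Cn"
  shows "\<exists>s\<in>S'. c \<in> Gam s \<or> (\<exists>r\<in>Gam s. E r c)"
proof -
  have step: "\<exists>s\<in>S'. c \<in> Gam s \<or> (\<exists>r\<in>Gam s. E r c)"
    if q: "P4 E1 (x, y, z, w)" and c: "c \<in> C" and S: "{x, y, z, w} \<inter> S \<noteq> {}" "c \<in> {x, y}" for x y z w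
  proof -
    have cR: "c \<in> R" "c \<notin> S" using c CR by (auto simp: R_def)
    have e: "E x y" "E y z" "E z w" "E y x" "E z y" "E w z" and nX: "x \<notin> X" "y \<notin> X" "z \<notin> X" "w \<notin> X"
      and ne: "x \<noteq> y" "x \<noteq> z" "y \<noteq> z" "y \<noteq> w"
      using q sym by (auto simp: E1_def)
    have SR: "x \<in> S \<or> x \<in> R" "y \<in> S \<or> y \<in> R" "z \<in> S \<or> z \<in> R" "w \<in> S \<or> w \<in> R" using RI e by blast+
    show ?thesis
    proof (cases "c = x")
      case True
      consider "y \<in> S" | "y \<in> R" "z \<in> S" | "y \<in> R" "z \<in> R" "w \<in> S" using S SR True cR by blast
      then show ?thesis
      proof cases
        case 1
        then show ?thesis using True c e nX by (intro bexI[of _ y]) (auto simp: Gam_def)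
      next
        case 2
        then show ?thesis using True c e nX by (intro bexI[of _ z]) (auto simp: Gam_def)
      next
        case 3
        \<comment> \<open>Here \<open>w\<close> is three steps away from \<open>c\<close>, too far
          for \<open>Gam w\<close>. But \<open>y\<close> has the two neighbours \<open>x\<close> and
          \<open>z\<close> in \<open>R\<close>, hence belongs to \<open>C\<close> and so to
          \<open>Gam w\<close>; this is the source of the second alternative.\<close>
        have "y \<in> C" unfolding C_def using 3 cR True e ne by blast
        then have "y \<in> Gam w" using 3 e by (auto simp: Gam_def)
        then show ?thesis using True 3 e nX by (intro bexI[of _ w]) auto
      qed
    next
      case False
      then have cy: "c = y" using S by simp
      consider "x \<in> S" | "z \<in> S" | "z \<in> R" "w \<in> S" using S SR cy cR by blast
      then show ?thesis
      proof cases
        case 1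
        then show ?thesis using cy c e nX by (intro bexI[of _ x]) (auto simp: Gam_def)
      next
        case 2
        then show ?thesis using cy c e nX by (intro bexI[of _ z]) (auto simp: Gam_def)
      next
        case 3
        then show ?thesis using cy c e nX by (intro bexI[of _ w]) (auto simp: Gam_def)
      qed
    qed
  qed
  obtain v where c: "c \<in> C" "E2 c v" using assms by (auto simp: Cn_def)
  then obtain x y z w where q: "P4 E1 (x, y, z, w)" "c \<in> {x, y, z, w}" unfolding E2_def by auto
  have q': "P4 E1 (w, z, y, x)" using q(1) sym by (auto simp: E1_def)
  have "{x, y, z, w} \<inter> S \<noteq> {}" 
    using maximal[of "(x, y, z, w)"] q(1)[unfolded P4_E1] by simp
  then have S: "{x, y, z, w} \<inter> S \<noteq> {}" "{w, z, y, x} \<inter> S \<noteq> {}" by auto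
  from q(2) have "c \<in> {x, y} \<or> c \<in> {w, z}" by auto
  then show ?thesis using step[OF q(1) c(1) S(1)] step[OF q' c(1) S(2)] by blast
qed

text \<open>By \<open>touched\<close>: at most \<open>4k\<close> vertices \<open>s\<close>, for each
  of them at most \<open>12k\<close> vertices in \<open>Gam s\<close>, and at most
  \<open>24k\<close> neighbours of these in \<open>C\<close>.\<close>

lemma card_Cn: "card Cn \<le> 144 * k\<^sup>2"
proof -
  let ?A = "\<lambda>s. Gam s \<union> (\<Union>r\<in>Gam s. {c \<in> C. E r c})"
  have "Cn \<subseteq> (\<Union>s\<in>S'. ?A s)"
  proof
    fix c assume c: "c \<in> Cn"
    then have "c \<in> C" by (simp add: Cn_def)
    then show "c \<in> (\<Union>s\<in>S'. ?A s)" using touched[OF c] by blast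
  qed
  moreover have "finite (\<Union>s\<in>S'. ?A s)" using finite_sets by auto
  ultimately have "card Cn \<le> card (\<Union>s\<in>S'. ?A s)" by (intro card_mono)
  also have "\<dots> \<le> card S' * (36 * k)"
  proof (rule card_UN_bound)
    fix s assume s: "s \<in> S'"
    have "card (\<Union>r\<in>Gam s. {c \<in> C. E r c}) \<le> card (Gam s) * 2"
      using GamC CR C_nbrs finite_sets by (intro card_UN_bound) auto
    then show "card (?A s) \<le> 36 * k"
      using card_Un_le[of "Gam s" "\<Union>r\<in>Gam s. {c \<in> C. E r c}"] Gam_poor[OF s] by linarith
  qed (use finite_sets in auto)
  also have "\<dots> \<le> (4 * k) * (36 * k)" using card_S' by (rule mult_right_mono) simp
  finally show ?thesis by (simp add: power2_eq_square)
qed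

lemma card_SS: "card (S' \<times> S') \<le> 16 * k\<^sup>2"
  using mult_mono[OF card_S' card_S'] by (simp add: card_cartesian_product power2_eq_square)

lemma card_SGam: "card (Sigma S' Gam) \<le> 48 * k\<^sup>2"
proof -
  have "card (Sigma S' Gam) \<le> card S' * (12 * k)"
    using Gam_poor finite_sets by (intro card_Sigma_bound) auto
  also have "\<dots> \<le> (4 * k) * (12 * k)" using card_S' by (rule mult_right_mono) simp
  finally show ?thesis by (simp add: power2_eq_square)
qed

lemma E2_SC: "E2 u v \<Longrightarrow> u \<notin> B \<Longrightarrow> u \<in> S' \<or> u \<in> Cn"
  using RI[of u v] E2_E[of u v] E2_X[of u v] by (auto simp: B_def Cn_def)

text \<open>Common frame of the two counts below. The pairs that involve \<open>S'\<close>
  contribute \<open>16 + 48 + 48 = 112\<close> times \<open>k^2\<close>; only the set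
  \<open>Q\<close> of pairs inside \<open>Cn\<close> differs from one count to the other.\<close>

lemma outer_pair:
  assumes "u \<in> S' \<or> u \<in> Cn" "v \<in> S' \<or> v \<in> Cn"
    and "u \<in> S' \<Longrightarrow> v \<in> Cn \<Longrightarrow> v \<in> Gam u" "v \<in> S' \<Longrightarrow> u \<in> Cn \<Longrightarrow> u \<in> Gam v"
    and "u \<in> Cn \<Longrightarrow> v \<in> Cn \<Longrightarrow> (u, v) \<in> Q"
  shows "(u, v) \<in> S' \<times> S' \<union> Sigma S' Gam \<union> prod.swap ` Sigma S' Gam \<union> Q"
  using assms by (auto simp: image_iff)

lemma card_outer_pairs:
  assumes "A \<subseteq> S' \<times> S' \<union> Sigma S' Gam \<union> prod.swap ` Sigma S' Gam \<union> Q" "finite Q"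
  shows "card A \<le> 112 * k\<^sup>2 + card Q"
proof -
  let ?P = "Sigma S' Gam"
  have fin: "finite ?P" "finite (S' \<times> S')" using finite_sets by auto
  then have "card A \<le> card (S' \<times> S' \<union> ?P \<union> prod.swap ` ?P \<union> Q)"
    using assms by (intro card_mono) auto
  also have "\<dots> \<le> card (S' \<times> S') + card ?P + card (prod.swap ` ?P) + card Q"
    by (intro order_trans[OF card_Un_le] add_mono order_refl)
  also have "card (prod.swap ` ?P) \<le> card ?P" by (rule card_image_le[OF fin(1)])
  finally show ?thesis using card_SS card_SGam by linarith
qed

text \<open>These are ordered pairs. Inside \<open>Cn\<close> every vertex has at most two
  neighbours in \<open>C\<close>, so \<open>2 * 144\<close> is added to \<open>112\<close>.\<close>

lemma card_outer_edges: "card {(u, v). E2 u v \<and> u \<notin> B \<and> v \<notin> B} \<le> 400 * k\<^sup>2"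
proof -
  let ?Q = "Sigma Cn (\<lambda>c. {c' \<in> C. E c c'})"
  have finCn: "finite Cn" using finite_sets by (auto simp: Cn_def)
  have "(u, v) \<in> S' \<times> S' \<union> Sigma S' Gam \<union> prod.swap ` Sigma S' Gam \<union> ?Q"
    if e: "E2 u v" "u \<notin> B" "v \<notin> B" for u v
  proof (rule outer_pair)
    show "u \<in> S' \<or> u \<in> Cn" "v \<in> S' \<or> v \<in> Cn" using E2_SC e E2_sym by blast+
    show "v \<in> Gam u" if "u \<in> S'" "v \<in> Cn" using that E2_Gam e by (auto simp: Cn_def)
    show "u \<in> Gam v" if "v \<in> S'" "u \<in> Cn" using that E2_Gam[of v u] E2_sym e by (auto simp: Cn_def)
    show "(u, v) \<in> ?Q" if "u \<in> Cn" "v \<in> Cn" using that E2_E e by (auto simp: Cn_def)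
  qed
  then have sub: "{(u, v). E2 u v \<and> u \<notin> B \<and> v \<notin> B} \<subseteq>
      S' \<times> S' \<union> Sigma S' Gam \<union> prod.swap ` Sigma S' Gam \<union> ?Q" by blast
  have "finite ?Q" using finite_sets finCn by auto
  with sub have "card {(u, v). E2 u v \<and> u \<notin> B \<and> v \<notin> B} \<le> 112 * k\<^sup>2 + card ?Q"
    by (rule card_outer_pairs)
  also have "card ?Q \<le> card Cn * 2"
    using finCn finite_sets C_nbrs CR by (intro card_Sigma_bound) (auto simp: Cn_def)
  finally show ?thesis using card_Cn by linarith
qed

definition Partners :: "('a \<times> 'a) set" where
  "Partners = {(a, p). a \<notin> B \<and> (\<exists>b\<in>B. E2 a b \<and> E2 b p)}"

text \<open>The common neighbour \<open>b\<close> lies in \<open>R\<close>, so a partner in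
  \<open>Cn\<close> of some \<open>s\<close> in \<open>S'\<close> is in \<open>Gam s\<close>. Two
  partners in \<open>Cn\<close> coincide, because \<open>b\<close> has at most one neighbour in
  \<open>R\<close>; so \<open>Cn\<close> adds only a diagonal, and \<open>112 + 144 = 256\<close>
  below.\<close>

lemma partners_sub: "Partners \<subseteq> S' \<times> S' \<union> Sigma S' Gam \<union> prod.swap ` Sigma S' Gam \<union> (\<lambda>c. (c, c)) ` Cn"
proof
  fix x assume "x \<in> Partners"
  then obtain a p b where x: "x = (a, p)" and b: "b \<in> B" "E2 a b" "E2 b p" "a \<notin> B"
    by (auto simp: Partners_def)
  have p: "p \<notin> B" using b B_indep E2_E by blast
  have bR: "b \<in> R" using b BR by blast
  have e: "E a b" "E b p" "E b a" "E p b" using b E2_E sym by blast+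
  show "x \<in> S' \<times> S' \<union> Sigma S' Gam \<union> prod.swap ` Sigma S' Gam \<union> (\<lambda>c. (c, c)) ` Cn"
    unfolding x
  proof (rule outer_pair)
    show "a \<in> S' \<or> a \<in> Cn" "p \<in> S' \<or> p \<in> Cn" using E2_SC b p E2_sym by blast+
    show "p \<in> Gam a" if "a \<in> S'" "p \<in> Cn" using that e bR by (auto simp: Cn_def Gam_def)
    show "a \<in> Gam p" if "p \<in> S'" "a \<in> Cn" using that e bR by (auto simp: Cn_def Gam_def)
    show "(a, p) \<in> (\<lambda>c. (c, c)) ` Cn" if "a \<in> Cn" "p \<in> Cn"
    proof -
      have "a \<in> R" "p \<in> R" using that CR by (auto simp: Cn_def)
      then have "a = p" using B_one[OF b(1)] e by blast
      then show ?thesis using that by simp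
    qed
  qed
qed

lemma finite_Partners: "finite Partners"
  using finite_subset[OF partners_sub] finite_sets by (auto simp: Cn_def)

lemma card_Partners: "card Partners \<le> 256 * k\<^sup>2"
proof -
  have finCn: "finite Cn" using finite_sets by (auto simp: Cn_def)
  have "card Partners \<le> 112 * k\<^sup>2 + card ((\<lambda>c. (c, c)) ` Cn)"
    by (rule card_outer_pairs[OF partners_sub]) (use finCn in simp)
  also have "card ((\<lambda>c. (c, c)) ` Cn) \<le> card Cn" by (rule card_image_le[OF finCn])
  finally show ?thesis using card_Cn by linarith
qed

end

section \<open>The number of edges after sparsification\<close>

context sparsification
begin

text \<open>A kept pair \<open>(a, b)\<close> accounts for the edges \<open>ab\<close> and
  \<open>b (f a b)\<close>, each in both orientations, whence the factor 4. Each of the pairs in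
  \<open>P\<close> has at most \<open>T + 1\<close> kept vertices.\<close>

lemma card_sparsified:
  assumes P: "finite P" "\<And>a b. Kp a b \<Longrightarrow> (a, f a b) \<in> P"
    and le: "\<And>a p. card {b. Kp a b \<and> f a b = p} \<le> T + 1"
    and A: "finite {(u, v). E u v \<and> u \<notin> B \<and> v \<notin> B}"
  shows "finite {(u, v). E' u v}"
    and "card {(u, v). E' u v} \<le> card {(u, v). E u v \<and> u \<notin> B \<and> v \<notin> B} + 4 * (card P * (T + 1))"
proof -
  let ?K = "{(a, b). Kp a b}" and ?A = "{(u, v). E u v \<and> u \<notin> B \<and> v \<notin> B}"
  let ?L = "\<Union>x\<in>P. (\<lambda>b. (fst x, b)) ` {b. Kp (fst x) b \<and> f (fst x) b = snd x}"
  have KL: "?K \<subseteq> ?L" using P(2) by fastforce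
  have finL: "finite ?L" using P(1) finite_kept by auto
  have finK: "finite ?K" using KL finL by (rule finite_subset)
  have "card ?K \<le> card ?L" using KL finL by (intro card_mono)
  also have "\<dots> \<le> card P * (T + 1)"
    using P(1) le by (intro card_UN_bound) (auto intro: order_trans[OF card_image_le[OF finite_kept]])
  finally have cK: "card ?K \<le> card P * (T + 1)" .
  let ?g = "\<lambda>(a, b). (b, f a b)" and ?h = "\<lambda>(a, b). (f a b, b)"
  let ?U = "?A \<union> ?K \<union> prod.swap ` ?K \<union> ?g ` ?K \<union> ?h ` ?K"
  have sub: "{(u, v). E' u v} \<subseteq> ?U"
  proof
    fix x assume "x \<in> {(u, v). E' u v}"
    then obtain u v where x: "x = (u, v)" and e: "E' u v" by auto
    from e consider "E u v" "u \<notin> B" "v \<notin> B" | "Kp u v" | "Kp v u"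
      | a where "Kp a u" "f a u = v" | a where "Kp a v" "f a v = u"
      unfolding E'_def by blast
    then show "x \<in> ?U" unfolding x
    proof cases
      case 4 then have "(u, v) = ?g (a, u)" "(a, u) \<in> ?K" by auto then show "(u, v) \<in> ?U" by blast
    next
      case 5 then have "(u, v) = ?h (a, v)" "(a, v) \<in> ?K" by auto then show "(u, v) \<in> ?U" by blast
    next
      case 3 then have "(u, v) = prod.swap (v, u)" "(v, u) \<in> ?K" by auto then show "(u, v) \<in> ?U" by blast
    qed auto
  qed
  have finU: "finite ?U" using A finK by auto
  then show "finite {(u, v). E' u v}" using sub by (rule finite_subset[rotated])
  have "card {(u, v). E' u v} \<le> card ?U" using sub finU by (intro card_mono)
  also have "\<dots> \<le> card ?A + card ?K + card (prod.swap ` ?K) + card (?g ` ?K) + card (?h ` ?K)"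
    by (intro order_trans[OF card_Un_le] add_mono order_refl)
  also have "\<dots> \<le> card ?A + card ?K + card ?K + card ?K + card ?K"
    using finK by (intro add_mono card_image_le order_refl)
  finally show "card {(u, v). E' u v} \<le> card ?A + 4 * (card P * (T + 1))" using cK by linarith
qed

end

section \<open>Polynomial time\<close>

text \<open>The variables from \<open>N\<close> on are untouched, so that a surrounding program can
  store intermediate values there. The bound on the output size makes the polynomials
  compose.\<close>

definition computes :: "data set \<Rightarrow> com \<Rightarrow> nat \<Rightarrow> nat poly \<Rightarrow> (data \<Rightarrow> data) \<Rightarrow> bool" where
  "computes D c N p f \<longleftrightarrow> (\<forall>s. s 0 \<in> D \<longrightarrow> (\<exists>t s'.
     exec c s t s' \<and> t \<le> poly p (dsize (s 0)) \<and> s' 0 = f (s 0)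
     \<and> dsize (f (s 0)) \<le> poly p (dsize (s 0)) \<and> (\<forall>v\<ge>N. s' v = s v)))"

definition ptime_on :: "data set \<Rightarrow> (data \<Rightarrow> data) \<Rightarrow> bool" where
  "ptime_on D f \<longleftrightarrow> (\<exists>c N p. computes D c N p f)"

lemma computesD:
  "computes D c N p f \<Longrightarrow> s 0 = x \<Longrightarrow> x \<in> D \<Longrightarrow> \<exists>t s'. exec c s t s' \<and> t \<le> poly p (dsize x)
    \<and> s' 0 = f x \<and> dsize (f x) \<le> poly p (dsize x) \<and> (\<forall>v\<ge>N. s' v = s v)"
  unfolding computes_def by blast

lemma ptime_onI:
  assumes "\<And>s. s 0 \<in> D \<Longrightarrow> \<exists>t s'. exec c s t s' \<and> t \<le> poly p (dsize (s 0)) \<and> s' 0 = f (s 0)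
     \<and> dsize (f (s 0)) \<le> poly p (dsize (s 0)) \<and> (\<forall>v\<ge>N. s' v = s v)"
  shows "ptime_on D f"
  using assms unfolding ptime_on_def computes_def by blast

lemma poly_nat_mono: "m \<le> n \<Longrightarrow> poly p m \<le> poly (p :: nat poly) n"
  by (induction p) (auto intro: add_mono mult_mono)

lemma ptime_on_expr:
  assumes "\<And>s. eval e s = f (s 0)"
    and "\<And>s. cost e s \<le> poly p (dsize (s 0))"
    and "\<And>x. dsize (f x) \<le> poly p (dsize x)"
  shows "ptime_on D f"
proof (rule ptime_onI)
  fix s :: store assume s: "s 0 \<in> D"
  let ?s' = "s(0 := eval e s)"
  have *: "dsize (f (s 0)) \<le> poly p (dsize (s 0))" by (rule assms(3))
  show "\<exists>t s'. exec (Assign 0 e) s t s' \<and> t \<le> poly (p + 1) (dsize (s 0)) \<and> s' 0 = f (s 0)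
     \<and> dsize (f (s 0)) \<le> poly (p + 1) (dsize (s 0)) \<and> (\<forall>v\<ge>1. s' v = s v)"
    using exec.Assign[of 0 e s] assms(1,2)[of s] * by (intro exI[of _ "1 + cost e s"] exI[of _ ?s']) auto
qed

lemma dsize_pos: "0 < dsize x" by (cases x) auto

lemma ptime_on_id: "ptime_on D (\<lambda>x. x)"
  by (rule ptime_on_expr[of "EVar 0" _ "[:0, 1:]"]) auto

lemma ptime_on_hd: "ptime_on D dhd"
proof (rule ptime_on_expr[of "EHd (EVar 0)" _ "[:0, 2:]"])
  have *: "dsize (dhd x) \<le> dsize x" for x by (cases x) auto
  show "cost (EHd (EVar 0)) s \<le> poly [:0, 2:] (dsize (s 0))" for s using *[of "s 0"] by simp
  show "dsize (dhd x) \<le> poly [:0, 2:] (dsize x)" for x using *[of x] by simp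
qed auto

lemma ptime_on_tl: "ptime_on D dtl"
proof (rule ptime_on_expr[of "ETl (EVar 0)" _ "[:0, 2:]"])
  have *: "dsize (dtl x) \<le> dsize x" for x by (cases x) auto
  show "cost (ETl (EVar 0)) s \<le> poly [:0, 2:] (dsize (s 0))" for s using *[of "s 0"] by simp
  show "dsize (dtl x) \<le> poly [:0, 2:] (dsize x)" for x using *[of x] by simp
qed auto

lemma ptime_on_const: "ptime_on D (\<lambda>_. d)"
proof -
  have "\<exists>e. (\<forall>s. eval e s = d) \<and> (\<exists>c. \<forall>s. cost e s = c)"
  proof (induction d)
    case Nl
    show ?case by (intro exI[of _ ENil]) auto
  next
    case (Pr a b)
    then obtain e f c d where "\<forall>s. eval e s = a" "\<forall>s. cost e s = c" "\<forall>s. eval f s = b" "\<forall>s. cost f s = d"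
      by metis
    then show ?case by (intro exI[of _ "ECons e f"]) auto
  qed
  then obtain e c where "\<forall>s. eval e s = d" "\<forall>s. cost e s = c" by blast
  then show ?thesis by (intro ptime_on_expr[of e _ "[:c + dsize d:]"]) auto
qed

lemma ptime_on_eq: "ptime_on D (\<lambda>x. dbool (dhd x = dtl x))"
proof (rule ptime_on_expr[of "EEq (EHd (EVar 0)) (ETl (EVar 0))" _ "[:3, 4:]"])
  have *: "dsize (dhd x) \<le> dsize x" "dsize (dtl x) \<le> dsize x" "dsize (dbool b) \<le> 3" for x b
    by (cases x; auto simp: dbool_def)+
  show "cost (EEq (EHd (EVar 0)) (ETl (EVar 0))) s \<le> poly [:3, 4:] (dsize (s 0))" for s
    using *(1,2)[of "s 0"] *(3)[of "dhd (s 0) = dtl (s 0)"] by simp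
  show "dsize (dbool (dhd x = dtl x)) \<le> poly [:3, 4:] (dsize x)" for x
    using *(3)[of "dhd x = dtl x"] by simp
qed auto

lemma ptime_on_size:
  assumes "ptime_on D f"
  obtains p :: "nat poly" where "\<And>x. x \<in> D \<Longrightarrow> dsize (f x) \<le> poly p (dsize x)"
proof -
  obtain c N p where *: "computes D c N p f" using assms unfolding ptime_on_def by blast
  have "dsize (f x) \<le> poly p (dsize x)" if "x \<in> D" for x
    using computesD[OF *, of "\<lambda>_. x" x] that by blast
  then show thesis by (rule that)
qed

lemma ptime_on_comp:
  assumes "ptime_on D f" "ptime_on D' g" and dom: "\<And>x. x \<in> D \<Longrightarrow> f x \<in> D'"
  shows "ptime_on D (\<lambda>x. g (f x))"
proof -
  obtain c M p where f: "computes D c M p f" using assms(1) unfolding ptime_on_def by blast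
  obtain d N q where g: "computes D' d N q g" using assms(2) unfolding ptime_on_def by blast
  show ?thesis
  proof (rule ptime_onI)
    fix s :: store assume s: "s 0 \<in> D"
    obtain t s' where 1: "exec c s t s'" "t \<le> poly p (dsize (s 0))" "s' 0 = f (s 0)"
      "dsize (f (s 0)) \<le> poly p (dsize (s 0))" "\<forall>v\<ge>M. s' v = s v" using computesD[OF f _ s, of s] by blast
    obtain u s'' where 2: "exec d s' u s''" "u \<le> poly q (dsize (s' 0))" "s'' 0 = g (s' 0)"
      "dsize (g (s' 0)) \<le> poly q (dsize (s' 0))" "\<forall>v\<ge>N. s'' v = s' v" using computesD[OF g refl, of s'] dom[OF s] 1(3) by auto
    have "poly q (dsize (s' 0)) \<le> poly (pcompose q p) (dsize (s 0))"
      using 1 by (simp add: poly_pcompose poly_nat_mono)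
    then show "\<exists>t s'. exec (Seq c d) s t s' \<and> t \<le> poly (p + pcompose q p) (dsize (s 0)) \<and> s' 0 = g (f (s 0))
      \<and> dsize (g (f (s 0))) \<le> poly (p + pcompose q p) (dsize (s 0)) \<and> (\<forall>v\<ge>max M N. s' v = s v)"
      using 1 2 by (intro exI[of _ "t + u"] exI[of _ s'']) (auto intro: exec.Seq)
  qed
qed

lemma ptime_on_pair:
  assumes "ptime_on D f" "ptime_on D g"
  shows "ptime_on D (\<lambda>x. Pr (f x) (g x))"
proof -
  obtain c M p where f: "computes D c M p f" using assms(1) unfolding ptime_on_def by blast
  obtain d N q where g: "computes D d N q g" using assms(2) unfolding ptime_on_def by blast
  \<comment> \<open>\<open>m\<close> and \<open>Suc m\<close> lie beyond the variables of both
    programs and differ from \<open>0\<close>: the input stored in \<open>m\<close> survives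
    \<open>c\<close>, and the first result stored in \<open>Suc m\<close> survives
    \<open>d\<close>.\<close>
  define m where "m = Suc (max M N)"
  let ?c = "Seq (Assign m (EVar 0)) (Seq c (Seq (Assign (Suc m) (EVar 0)) (Seq (Assign 0 (EVar m))
     (Seq d (Assign 0 (ECons (EVar (Suc m)) (EVar 0)))))))"
  let ?p = "[:5, 2:] + 4 * p + 4 * q :: nat poly"
  show ?thesis
  proof (rule ptime_onI)
    fix s :: store assume s: "s 0 \<in> D"
    let ?s1 = "s(m := s 0)"
    obtain t s2 where 1: "exec c ?s1 t s2" "t \<le> poly p (dsize (s 0))" "s2 0 = f (s 0)"
      "dsize (f (s 0)) \<le> poly p (dsize (s 0))" "\<forall>v\<ge>M. s2 v = ?s1 v"
      using computesD[OF f, of ?s1 "s 0"] s by (simp add: m_def, blast)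
    let ?s3 = "s2(Suc m := f (s 0))"
    let ?s4 = "?s3(0 := s 0)"
    have s2m: "s2 m = s 0" using 1(5) by (simp add: m_def)
    obtain u s5 where 2: "exec d ?s4 u s5" "u \<le> poly q (dsize (s 0))" "s5 0 = g (s 0)"
      "dsize (g (s 0)) \<le> poly q (dsize (s 0))" "\<forall>v\<ge>N. s5 v = ?s4 v"
      using computesD[OF g, of ?s4 "s 0"] s by (simp, blast)
    have s5m: "s5 (Suc m) = f (s 0)" using 2(5) by (simp add: m_def)
    let ?s6 = "s5(0 := Pr (f (s 0)) (g (s 0)))"
    have E1: "exec (Assign m (EVar 0)) s (1 + dsize (s 0)) ?s1" using exec.Assign[of m "EVar 0" s] by simp
    have E3: "exec (Assign (Suc m) (EVar 0)) s2 (1 + dsize (f (s 0))) ?s3"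
      using exec.Assign[of "Suc m" "EVar 0" s2] 1 by simp
    have E4: "exec (Assign 0 (EVar m)) ?s3 (1 + dsize (s 0)) ?s4"
      using exec.Assign[of 0 "EVar m" ?s3] s2m by simp
    have E6: "exec (Assign 0 (ECons (EVar (Suc m)) (EVar 0))) s5
       (1 + (dsize (f (s 0)) + dsize (g (s 0)) + (1 + dsize (f (s 0)) + dsize (g (s 0))))) ?s6"
      using exec.Assign[of 0 "ECons (EVar (Suc m)) (EVar 0)" s5] s5m 2 by simp
    note E = exec.Seq[OF E1 exec.Seq[OF 1(1) exec.Seq[OF E3 exec.Seq[OF E4 exec.Seq[OF 2(1) E6]]]]]
    have pp: "poly ?p (dsize (s 0)) = 5 + 2 * dsize (s 0) + 4 * poly p (dsize (s 0)) + 4 * poly q (dsize (s 0))"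
      by simp
    show "\<exists>t s'. exec ?c s t s' \<and> t \<le> poly ?p (dsize (s 0)) \<and> s' 0 = Pr (f (s 0)) (g (s 0))
      \<and> dsize (Pr (f (s 0)) (g (s 0))) \<le> poly ?p (dsize (s 0)) \<and> (\<forall>v\<ge>m+2. s' v = s v)"
    proof (intro exI conjI)
      show "exec ?c s (1 + dsize (s 0) + (t + (1 + dsize (f (s 0)) + (1 + dsize (s 0) + (u + (1 + (dsize (f (s 0)) + dsize (g (s 0)) + (1 + dsize (f (s 0)) + dsize (g (s 0)))))))))) ?s6" by (rule E)
      show "?s6 0 = Pr (f (s 0)) (g (s 0))" by simp
      show "\<forall>v\<ge>m+2. ?s6 v = s v" using 1(5) 2(5) by (simp add: m_def)
      show "dsize (Pr (f (s 0)) (g (s 0))) \<le> poly ?p (dsize (s 0))" unfolding pp using 1(4) 2(4) by simp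
      show "1 + dsize (s 0) + (t + (1 + dsize (f (s 0)) + (1 + dsize (s 0) + (u +
        (1 + (dsize (f (s 0)) + dsize (g (s 0)) + (1 + dsize (f (s 0)) + dsize (g (s 0)))))))))
        \<le> poly ?p (dsize (s 0))"
        unfolding pp using 1(2,4) 2(2,4) by linarith
    qed
  qed
qed

text \<open>The input is first paired with the value of the test, so the conditional can inspect
  this value and then restore the input for the chosen branch.\<close>

lemma ptime_on_if:
  assumes "ptime_on D b" "ptime_on D f" "ptime_on D g"
  shows "ptime_on D (\<lambda>x. if b x \<noteq> Nl then f x else g x)"
proof -
  obtain c M p where f: "computes D c M p f" using assms(2) unfolding ptime_on_def by blast
  obtain d N q where g: "computes D d N q g" using assms(3) unfolding ptime_on_def by blast
  let ?D = "(\<lambda>x. Pr x (b x)) ` D"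
  let ?c = "Cond (ETl (EVar 0)) (Seq (Assign 0 (EHd (EVar 0))) c) (Seq (Assign 0 (EHd (EVar 0))) d)"
  let ?p = "[:5, 5:] + p + q :: nat poly"
  let ?h = "\<lambda>z. if dtl z \<noteq> Nl then f (dhd z) else g (dhd z)"
  have "ptime_on ?D ?h"
  proof (rule ptime_onI)
    fix s :: store assume "s 0 \<in> ?D"
    then obtain x y where x: "s 0 = Pr x y" "x \<in> D" by blast
    let ?s = "s(0 := x)" and ?n = "dsize (s 0)"
    have E: "exec (Assign 0 (EHd (EVar 0))) s (1 + (?n + dsize x)) ?s"
      using exec.Assign[of 0 "EHd (EVar 0)" s] x by simp
    have n: "dsize x \<le> ?n" "dsize y \<le> ?n" using x by auto
    have pp: "poly ?p ?n = 5 + 5 * ?n + poly p ?n + poly q ?n" by simp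
    show "\<exists>t s'. exec ?c s t s' \<and> t \<le> poly ?p ?n \<and> s' 0 = ?h (s 0)
      \<and> dsize (?h (s 0)) \<le> poly ?p ?n \<and> (\<forall>v\<ge>Suc (max M N). s' v = s v)"
    proof (cases "y = Nl")
      case True
      obtain t s' where t: "exec d ?s t s'" "t \<le> poly q (dsize x)" "s' 0 = g x"
        "dsize (g x) \<le> poly q (dsize x)" "\<forall>v\<ge>N. s' v = ?s v"
        using computesD[OF g, of ?s x] x by auto
      have "exec ?c s (1 + (?n + dsize y) + (1 + (?n + dsize x) + t)) s'"
        using exec.CondFalse[of "ETl (EVar 0)" s, OF _ exec.Seq[OF E t(1)]] x True by simp
      moreover have "poly q (dsize x) \<le> poly q ?n" using n by (intro poly_nat_mono)
      ultimately show ?thesis unfolding pp using t n x True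
        by (intro exI[of _ "1 + (?n + dsize y) + (1 + (?n + dsize x) + t)"] exI[of _ s']) simp
    next
      case False
      obtain t s' where t: "exec c ?s t s'" "t \<le> poly p (dsize x)" "s' 0 = f x"
        "dsize (f x) \<le> poly p (dsize x)" "\<forall>v\<ge>M. s' v = ?s v"
        using computesD[OF f, of ?s x] x by auto
      have "exec ?c s (1 + (?n + dsize y) + (1 + (?n + dsize x) + t)) s'"
        using exec.CondTrue[of "ETl (EVar 0)" s, OF _ exec.Seq[OF E t(1)]] x False by simp
      moreover have "poly p (dsize x) \<le> poly p ?n" using n by (intro poly_nat_mono)
      ultimately show ?thesis unfolding pp using t n x False
        by (intro exI[of _ "1 + (?n + dsize y) + (1 + (?n + dsize x) + t)"] exI[of _ s']) simp
    qed
  qed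
  from ptime_on_comp[OF ptime_on_pair[OF ptime_on_id assms(1)] this] show ?thesis by (simp cong: if_cong)
qed

section \<open>Loops over lists\<close>

primrec dfold :: "(data \<Rightarrow> data) \<Rightarrow> data \<Rightarrow> data \<Rightarrow> data list \<Rightarrow> data" where
  "dfold g e a [] = a"
| "dfold g e a (x # xs) = dfold g e (g (Pr e (Pr a x))) xs"

text \<open>The loop keeps the environment, the remaining list and the accumulator in the
  variables \<open>m\<close>, \<open>m + 1\<close> and \<open>m + 2\<close>; the accumulator has to stay polynomially
  small throughout.\<close>

lemma loop_exec:
  assumes g: "computes D c M p g"
    and m: "m = Suc M"
    and st: "s m = e" "s (m + 1) = enc_list xs" "s (m + 2) = a"
    and bd: "\<And>ys zs. xs = ys @ zs \<Longrightarrow> dsize (dfold g e a ys) \<le> Z"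
    and dom: "\<And>ys z zs. xs = ys @ z # zs \<Longrightarrow> Pr e (Pr (dfold g e a ys) z) \<in> D"
    and Z: "dsize e \<le> Z" "dsize (enc_list xs) \<le> Z"
  shows "\<exists>t s'. exec (While (EVar (m + 1))
      (Seq (Assign 0 (ECons (EVar m) (ECons (EVar (m + 2)) (EHd (EVar (m + 1))))))
      (Seq c (Seq (Assign (m + 2) (EVar 0)) (Assign (m + 1) (ETl (EVar (m + 1)))))))) s t s'
    \<and> t \<le> 2 + length xs * (30 * Z + 30 + poly p (5 * Z + 5)) \<and> s' (m + 2) = dfold g e a xs
    \<and> (\<forall>v\<ge>m + 3. s' v = s v)"
  (is "\<exists>t s'. exec (While ?b ?c) s t s' \<and> _")
  using st bd Z(2) dom
proof (induction xs arbitrary: s a)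
  case Nil
  have "exec (While ?b ?c) s (1 + cost ?b s) s" using Nil by (intro exec.WhileFalse) simp
  then show ?case using Nil by (intro exI[of _ "1 + cost ?b s"] exI[of _ s]) auto
next
  case (Cons x xs)
  let ?y = "Pr e (Pr a x)"
  let ?s1 = "s(0 := ?y)"
  have aZ: "dsize a \<le> Z" using Cons.prems(4)[of "[]"] by simp
  have E1: "exec (Assign 0 (ECons (EVar m) (ECons (EVar (m + 2)) (EHd (EVar (m + 1)))))) s
     (1 + cost (ECons (EVar m) (ECons (EVar (m + 2)) (EHd (EVar (m + 1))))) s) ?s1"
    using exec.Assign[of 0 "ECons (EVar m) (ECons (EVar (m + 2)) (EHd (EVar (m + 1))))" s] Cons.prems by simp
  obtain t s2 where 2: "exec c ?s1 t s2" "t \<le> poly p (dsize ?y)" "s2 0 = g ?y"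
    "dsize (g ?y) \<le> poly p (dsize ?y)" "\<forall>v\<ge>M. s2 v = ?s1 v" using computesD[OF g, of ?s1 ?y] Cons.prems(6)[of "[]" x xs] by (simp, blast)
  let ?s3 = "s2(m + 2 := g ?y)"
  let ?s4 = "?s3(m + 1 := enc_list xs)"
  have s2: "s2 m = e" "s2 (m + 1) = enc_list (x # xs)" using 2(5) Cons.prems by (auto simp: m)
  have E3: "exec (Assign (m + 2) (EVar 0)) s2 (1 + dsize (g ?y)) ?s3"
    using exec.Assign[of "m + 2" "EVar 0" s2] 2 by simp
  have E4: "exec (Assign (m + 1) (ETl (EVar (m + 1)))) ?s3 (1 + (dsize (enc_list (x # xs)) + dsize (enc_list xs))) ?s4"
    using exec.Assign[of "m + 1" "ETl (EVar (m + 1))" ?s3] s2 by simp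
  have "\<exists>t s'. exec (While ?b ?c) ?s4 t s'
    \<and> t \<le> 2 + length xs * (30 * Z + 30 + poly p (5 * Z + 5)) \<and> s' (m + 2) = dfold g e (g ?y) xs
    \<and> (\<forall>v\<ge>m + 3. s' v = ?s4 v)"
  proof (rule Cons.IH)
    show "dsize (dfold g e (g ?y) ys) \<le> Z" if "xs = ys @ zs" for ys zs
      using Cons.prems(4)[of "x # ys" zs] that by simp
    show "Pr e (Pr (dfold g e (g ?y) ys) z) \<in> D" if "xs = ys @ z # zs" for ys z zs
      using Cons.prems(6)[of "x # ys" z zs] that by simp
  qed (use s2 Cons.prems in auto)
  then obtain u s5 where 5: "exec (While ?b ?c) ?s4 u s5" "u \<le> 2 + length xs * (30 * Z + 30 + poly p (5 * Z + 5))"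
    "s5 (m + 2) = dfold g e (g ?y) xs" "\<forall>v\<ge>m + 3. s5 v = ?s4 v" by blast
  have nz: "eval ?b s \<noteq> Nl" using Cons.prems by simp
  note E = exec.WhileTrue[OF nz exec.Seq[OF E1 exec.Seq[OF 2(1) exec.Seq[OF E3 E4]]] 5(1)]
  have xZ: "dsize x \<le> Z" "dsize (enc_list xs) \<le> Z" using Cons.prems(5) by auto
  have gZ: "dsize (g ?y) \<le> Z" using Cons.prems(4)[of "[x]"] by simp
  have "dsize ?y \<le> 5 * Z + 5" using aZ xZ Z by simp
  then have "poly p (dsize ?y) \<le> poly p (5 * Z + 5)" by (rule poly_nat_mono)
  then have tb: "t \<le> poly p (5 * Z + 5)" using 2 by simp
  show ?case
  proof (intro exI conjI)
    show "exec (While ?b ?c) s (1 + cost ?b s + (1 + cost (ECons (EVar m) (ECons (EVar (m + 2)) (EHd (EVar (m + 1))))) s + (t + (1 + dsize (g ?y) + (1 + (dsize (enc_list (x # xs)) + dsize (enc_list xs)))))) + u) s5" by (rule E)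
    show "s5 (m + 2) = dfold g e a (x # xs)" using 5 by simp
    show "\<forall>v\<ge>m + 3. s5 v = s v" using 5(4) 2(5) by (simp add: m)
    have sm: "s m = e" "s (m + 1) = enc_list (x # xs)" "s (m + 2) = a" using Cons.prems by auto
    have LZ: "dsize (enc_list (x # xs)) \<le> Z" by (rule Cons.prems(5))
    show "1 + cost ?b s + (1 + cost (ECons (EVar m) (ECons (EVar (m + 2)) (EHd (EVar (m + 1))))) s + (t +
       (1 + dsize (g ?y) + (1 + (dsize (enc_list (x # xs)) + dsize (enc_list xs)))))) + u
       \<le> 2 + length (x # xs) * (30 * Z + 30 + poly p (5 * Z + 5))"
      using 5(2) tb LZ xZ aZ gZ Z(1) sm by simp
  qed
qed

text \<open>Inverse to \<open>enc_list\<close>: every tree encodes a list, so a loop can run over an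
  arbitrary tree.\<close>

primrec spine :: "data \<Rightarrow> data list" where
  "spine Nl = []"
| "spine (Pr a b) = a # spine b"

lemma enc_list_spine [simp]: "enc_list (spine x) = x"
  by (induction x) auto

lemma spine_enc_list [simp]: "spine (enc_list xs) = xs"
  by (induction xs) auto

lemma ptime_on_dfold:
  assumes "ptime_on D' g" "ptime_on D l" "ptime_on D i"
    and dom: "\<And>x ys z zs. x \<in> D \<Longrightarrow> spine (l x) = ys @ z # zs \<Longrightarrow> Pr x (Pr (dfold g x (i x) ys) z) \<in> D'"
    and bd: "\<And>x ys zs. x \<in> D \<Longrightarrow> spine (l x) = ys @ zs \<Longrightarrow> dsize (dfold g x (i x) ys) \<le> poly Z (dsize x)"
  shows "ptime_on D (\<lambda>x. dfold g x (i x) (spine (l x)))"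
proof -
  obtain c M p where g: "computes D' c M p g" using assms(1) unfolding ptime_on_def by blast
  define m where "m = Suc M"
  let ?D = "(\<lambda>x. Pr x (Pr (l x) (i x))) ` D"
  let ?h = "\<lambda>z. dfold g (dhd z) (dtl (dtl z)) (spine (dhd (dtl z)))"
  let ?loop = "While (EVar (m + 1))
      (Seq (Assign 0 (ECons (EVar m) (ECons (EVar (m + 2)) (EHd (EVar (m + 1))))))
      (Seq c (Seq (Assign (m + 2) (EVar 0)) (Assign (m + 1) (ETl (EVar (m + 1)))))))"
  let ?c = "Seq (Assign m (EHd (EVar 0))) (Seq (Assign (m + 1) (EHd (ETl (EVar 0))))
     (Seq (Assign (m + 2) (ETl (ETl (EVar 0)))) (Seq ?loop (Assign 0 (EVar (m + 2))))))"
  define W where "W = [:0, 1:] + Z"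
  let ?p = "[:20:] + 20 * W + W * ([:30:] + 30 * W + pcompose p ([:5:] + 5 * W)) :: nat poly"
  have "ptime_on ?D ?h"
  proof (rule ptime_onI)
    fix s :: store assume "s 0 \<in> ?D"
    then obtain x where x: "s 0 = Pr x (Pr (l x) (i x))" "x \<in> D" by blast
    define xs where "xs = spine (l x)"
    have xs: "l x = enc_list xs" by (simp add: xs_def)
    let ?n = "dsize (s 0)" and ?r = "dfold g x (i x) xs"
    let ?Z = "poly W ?n"
    have nx: "dsize x \<le> ?n" "dsize (l x) \<le> ?n" "dsize (i x) \<le> ?n" "dsize (Pr (l x) (i x)) \<le> ?n" using x by auto
    have Z: "poly Z (dsize x) \<le> poly Z ?n" using nx(1) by (rule poly_nat_mono)
    have Wn: "?Z = ?n + poly Z ?n" by (simp add: W_def)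
    let ?s1 = "s(m := x)" and ?s2 = "s(m := x, m + 1 := l x)" and ?s3 = "s(m := x, m + 1 := l x, m + 2 := i x)"
    have m0: "m > 0" by (simp add: m_def)
    have E1: "exec (Assign m (EHd (EVar 0))) s (1 + (?n + dsize x)) ?s1"
      using exec.Assign[of m "EHd (EVar 0)" s] x by simp
    have E2: "exec (Assign (m + 1) (EHd (ETl (EVar 0)))) ?s1 (1 + (?n + dsize (Pr (l x) (i x)) + dsize (l x))) ?s2"
      using exec.Assign[of "m + 1" "EHd (ETl (EVar 0))" ?s1] x m0 by simp
    have E3: "exec (Assign (m + 2) (ETl (ETl (EVar 0)))) ?s2 (1 + (?n + dsize (Pr (l x) (i x)) + dsize (i x))) ?s3"
      using exec.Assign[of "m + 2" "ETl (ETl (EVar 0))" ?s2] x m0 by simp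
    have "\<exists>t s'. exec ?loop ?s3 t s' \<and> t \<le> 2 + length xs * (30 * ?Z + 30 + poly p (5 * ?Z + 5))
       \<and> s' (m + 2) = ?r \<and> (\<forall>v\<ge>m + 3. s' v = ?s3 v)"
    proof (rule loop_exec[OF g m_def])
      show "dsize (dfold g x (i x) ys) \<le> ?Z" if "xs = ys @ zs" for ys zs
        using bd[OF x(2), of ys zs] that Z Wn by (simp add: xs_def)
      show "Pr x (Pr (dfold g x (i x) ys) z) \<in> D'" if "xs = ys @ z # zs" for ys z zs
        using dom[OF x(2)] that by (simp add: xs_def)
      show "dsize x \<le> ?Z" "dsize (enc_list xs) \<le> ?Z" using nx Wn xs by auto
    qed (use xs in auto)
    then obtain t s' where t: "exec ?loop ?s3 t s'" "t \<le> 2 + length xs * (30 * ?Z + 30 + poly p (5 * ?Z + 5))"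
       "s' (m + 2) = ?r" "\<forall>v\<ge>m + 3. s' v = ?s3 v" by blast
    have E4: "exec (Assign 0 (EVar (m + 2))) s' (1 + dsize ?r) (s'(0 := ?r))"
      using exec.Assign[of 0 "EVar (m + 2)" s'] t(3) by simp
    note E = exec.Seq[OF E1 exec.Seq[OF E2 exec.Seq[OF E3 exec.Seq[OF t(1) E4]]]]
    have rb: "dsize ?r \<le> ?Z" using bd[OF x(2), of xs "[]"] Z Wn by (simp add: xs_def)
    have "length xs \<le> dsize (enc_list xs)" by (induction xs) auto
    then have "length xs \<le> ?Z" using nx(2) Wn xs by simp
    then have "length xs * (30 * ?Z + 30 + poly p (5 * ?Z + 5)) \<le> ?Z * (30 * ?Z + 30 + poly p (5 * ?Z + 5))"
      by (rule mult_right_mono) simp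
    then have tb: "t \<le> 2 + ?Z * (30 * ?Z + 30 + poly p (5 * ?Z + 5))" using t(2) by linarith
    have pp: "poly ?p ?n = 20 + 20 * ?Z + ?Z * (30 * ?Z + 30 + poly p (5 * ?Z + 5))"
      by (simp add: poly_pcompose algebra_simps)
    have h: "?h (s 0) = ?r" by (simp add: x xs_def)
    show "\<exists>t s'. exec ?c s t s' \<and> t \<le> poly ?p ?n \<and> s' 0 = ?h (s 0)
      \<and> dsize (?h (s 0)) \<le> poly ?p ?n \<and> (\<forall>v\<ge>m+3. s' v = s v)"
      unfolding h
    proof (intro exI conjI)
      show "exec ?c s (1 + (?n + dsize x) + (1 + (?n + dsize (Pr (l x) (i x)) + dsize (l x)) +
        (1 + (?n + dsize (Pr (l x) (i x)) + dsize (i x)) + (t + (1 + dsize ?r))))) (s'(0 := ?r))" by (rule E)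
      show "1 + (?n + dsize x) + (1 + (?n + dsize (Pr (l x) (i x)) + dsize (l x)) +
        (1 + (?n + dsize (Pr (l x) (i x)) + dsize (i x)) + (t + (1 + dsize ?r)))) \<le> poly ?p ?n"
        unfolding pp using nx rb tb Wn by linarith
      show "dsize ?r \<le> poly ?p ?n" unfolding pp using rb by simp
      show "\<forall>v\<ge>m+3. (s'(0 := ?r)) v = s v" using t(4) by simp
    qed simp
  qed
  from ptime_on_comp[OF ptime_on_pair[OF ptime_on_id ptime_on_pair[OF assms(2,3)]] this] show ?thesis by simp
qed

section \<open>Polynomial time on encoded values\<close>

text \<open>Encodings by type turn polynomial time into a property of ordinary HOL functions, which
  the rules \<open>ptime_intros\<close> then derive along the structure of a term. Injectivity is
  what lets a comparison of trees decide equality of values.\<close>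

class encodable =
  fixes encode :: "'a \<Rightarrow> data"
  assumes encode_inj: "encode x = encode y \<Longrightarrow> x = y"

lemma encode_eq_iff [simp]: "encode x = encode y \<longleftrightarrow> x = y"
  using encode_inj by blast

instantiation bool :: encodable
begin
definition "encode_bool = dbool"
instance by standard (auto simp: encode_bool_def dbool_def split: if_splits)
end

text \<open>Numbers are encoded in unary, so that they can serve as loop bounds. The binary encoding
  of the parameter is handled separately as a list of bits.\<close>

instantiation nat :: encodable
begin
primrec encode_nat :: "nat \<Rightarrow> data" where
  "encode_nat 0 = Nl"
| "encode_nat (Suc n) = Pr Nl (encode_nat n)"
instance
proof
  fix x y :: nat
  show "encode x = encode y \<Longrightarrow> x = y"
  proof (induction x arbitrary: y)
    case 0 then show ?case by (cases y) auto
  next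
    case (Suc x) then show ?case by (cases y) auto
  qed
qed
end

instantiation prod :: (encodable, encodable) encodable
begin
definition "encode_prod p = Pr (encode (fst p)) (encode (snd p))"
instance by standard (auto simp: encode_prod_def prod_eq_iff)
end

lemma enc_list_inj: "enc_list xs = enc_list ys \<Longrightarrow> xs = ys"
  by (induction xs arbitrary: ys; case_tac ys; simp)

instantiation list :: (encodable) encodable
begin
definition encode_list :: "'a list \<Rightarrow> data" where "encode_list xs = enc_list (map encode xs)"
instance
proof
  fix x y :: "'a list"
  assume "encode x = encode y"
  then have "map encode x = map (encode :: 'a \<Rightarrow> data) y" by (auto simp: encode_list_def dest: enc_list_inj)
  then show "x = y" by (rule map_injective) (auto simp: inj_on_def)
qed
end

lemma encode_Nil [simp]: "encode [] = Nl" and encode_Cons [simp]: "encode (x # xs) = Pr (encode x) (encode xs)"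
  by (auto simp: encode_list_def)

lemma encode_Pair [simp]: "encode (x, y) = Pr (encode x) (encode y)"
  by (simp add: encode_prod_def)

lemma encode_False [simp]: "encode False = Nl" and encode_True [simp]: "encode True = Pr Nl Nl"
  by (auto simp: encode_bool_def dbool_def)

abbreviation esize :: "'a::encodable \<Rightarrow> nat" where "esize x \<equiv> dsize (encode x)"

definition ptime :: "('a::encodable \<Rightarrow> 'b::encodable) \<Rightarrow> bool" where
  "ptime f \<longleftrightarrow> (\<exists>g. ptime_on (range (encode :: 'a \<Rightarrow> data)) g \<and> (\<forall>x. g (encode x) = encode (f x)))"

named_theorems ptime_intros

lemma ptimeI:
  "ptime_on (range (encode :: 'a \<Rightarrow> data)) g \<Longrightarrow> (\<And>x. g (encode x) = encode (f x)) \<Longrightarrow> ptime (f :: 'a::encodable \<Rightarrow> 'b::encodable)"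
  unfolding ptime_def by blast

lemma ptimeE:
  assumes "ptime (f :: 'a::encodable \<Rightarrow> 'b::encodable)"
  obtains g where "ptime_on (range (encode :: 'a \<Rightarrow> data)) g" "\<And>x. g (encode x) = encode (f x)"
  using assms unfolding ptime_def by blast

lemma ptime_size:
  assumes "ptime (f :: 'a::encodable \<Rightarrow> 'b::encodable)"
  obtains p where "\<And>x. esize (f x) \<le> poly p (esize x)"
proof -
  obtain g where g: "ptime_on (range (encode :: 'a \<Rightarrow> data)) g" "\<And>x. g (encode x) = encode (f x)"
    using assms unfolding ptime_def by blast
  obtain p where "\<And>x. x \<in> range (encode :: 'a \<Rightarrow> data) \<Longrightarrow> dsize (g x) \<le> poly p (dsize x)"
    using ptime_on_size[OF g(1)] by blast
  then show thesis using that g(2) by (metis rangeI)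
qed

lemma ptime_comp:
  fixes f :: "'a::encodable \<Rightarrow> 'b::encodable" and g :: "'b \<Rightarrow> 'c::encodable"
  assumes "ptime g" "ptime f"
  shows "ptime (\<lambda>e. g (f e))"
proof -
  obtain G where G: "ptime_on (range (encode :: 'b \<Rightarrow> data)) G" "\<And>x. G (encode x) = encode (g x)"
    using assms(1) unfolding ptime_def by blast
  obtain F where F: "ptime_on (range (encode :: 'a \<Rightarrow> data)) F" "\<And>x. F (encode x) = encode (f x)"
    using assms(2) unfolding ptime_def by blast
  show ?thesis by (rule ptimeI[OF ptime_on_comp[OF F(1) G(1)]]) (auto simp: F G)
qed

lemma ptime_id [ptime_intros]: "ptime (\<lambda>e. e)"
  by (rule ptimeI[OF ptime_on_id]) simp

lemma ptime_const [ptime_intros]: "ptime (\<lambda>_. c)"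
  by (rule ptimeI[OF ptime_on_const]) simp

lemma ptime_Pair [ptime_intros]:
  fixes f :: "'a::encodable \<Rightarrow> 'b::encodable" and g :: "'a \<Rightarrow> 'c::encodable"
  assumes "ptime f" "ptime g"
  shows "ptime (\<lambda>e. (f e, g e))"
proof -
  obtain G where G: "ptime_on (range (encode :: 'a \<Rightarrow> data)) G" "\<And>x. G (encode x) = encode (g x)"
    using assms(2) unfolding ptime_def by blast
  obtain F where F: "ptime_on (range (encode :: 'a \<Rightarrow> data)) F" "\<And>x. F (encode x) = encode (f x)"
    using assms(1) unfolding ptime_def by blast
  show ?thesis by (rule ptimeI[OF ptime_on_pair[OF F(1) G(1)]]) (simp add: F G)
qed

lemma ptime_fst [ptime_intros]: "ptime f \<Longrightarrow> ptime (\<lambda>e. fst (f e))"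
  by (rule ptime_comp[of fst]) (auto intro!: ptimeI[OF ptime_on_hd] simp: encode_prod_def)

lemma ptime_snd [ptime_intros]: "ptime f \<Longrightarrow> ptime (\<lambda>e. snd (f e))"
  by (rule ptime_comp[of snd]) (auto intro!: ptimeI[OF ptime_on_tl] simp: encode_prod_def)

lemma ptime_cong: "ptime f \<Longrightarrow> (\<And>e. f e = g e) \<Longrightarrow> ptime g"
  by (metis ext)

text \<open>An operation with two arguments is treated once, on the projections of a pair, and then
  lifted to arbitrary argument terms.\<close>

lemma ptime_comp2:
  assumes "ptime (\<lambda>p. g (fst p) (snd p))" "ptime f" "ptime h"
  shows "ptime (\<lambda>e. g (f e) (h e))"
  using ptime_comp[OF assms(1) ptime_Pair[OF assms(2,3)]] by simp

lemma ptime_Cons [ptime_intros]: "ptime f \<Longrightarrow> ptime g \<Longrightarrow> ptime (\<lambda>e. f e # g e)"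
  by (rule ptime_comp2[of Cons]) (auto intro!: ptimeI[OF ptime_on_id] simp: encode_prod_def)

lemma ptime_tl [ptime_intros]: "ptime (f :: _ \<Rightarrow> 'b::encodable list) \<Longrightarrow> ptime (\<lambda>e. tl (f e))"
proof (rule ptime_comp[of tl])
  have "dtl (encode xs) = encode (tl xs)" for xs :: "'b list" by (cases xs) auto
  then show "ptime (tl :: 'b list \<Rightarrow> _)" by (rule ptimeI[OF ptime_on_tl])
qed

lemma ptime_Suc [ptime_intros]: "ptime f \<Longrightarrow> ptime (\<lambda>e. Suc (f e))"
  by (rule ptime_comp[of Suc]) (auto intro!: ptimeI[OF ptime_on_pair[OF ptime_on_const[of _ Nl] ptime_on_id]])

lemma ptime_pred: "ptime f \<Longrightarrow> ptime (\<lambda>e. f e - Suc 0)"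
proof (rule ptime_comp[of "\<lambda>n. n - Suc 0"])
  have "dtl (encode n) = encode (n - Suc 0)" for n :: nat by (cases n) auto
  then show "ptime (\<lambda>n. n - Suc 0)" by (rule ptimeI[OF ptime_on_tl])
qed

lemma ptime_If [ptime_intros]:
  fixes f :: "'a::encodable \<Rightarrow> 'b::encodable"
  assumes "ptime b" "ptime f" "ptime g"
  shows "ptime (\<lambda>e. if b e then f e else g e)"
proof -
  obtain G where G: "ptime_on (range (encode :: 'a \<Rightarrow> data)) G" "\<And>x. G (encode x) = encode (g x)"
    using assms(3) unfolding ptime_def by blast
  obtain F where F: "ptime_on (range (encode :: 'a \<Rightarrow> data)) F" "\<And>x. F (encode x) = encode (f x)"
    using assms(2) unfolding ptime_def by blast
  obtain B where B: "ptime_on (range (encode :: 'a \<Rightarrow> data)) B" "\<And>x. B (encode x) = encode (b x)"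
    using assms(1) unfolding ptime_def by blast
  show ?thesis
    by (rule ptimeI[OF ptime_on_if[OF B(1) F(1) G(1)]]) (auto simp: F G B)
qed

lemma ptime_conj [ptime_intros]: "ptime a \<Longrightarrow> ptime b \<Longrightarrow> ptime (\<lambda>e. a e \<and> b e)"
proof -
  assume "ptime a" "ptime b"
  then have "ptime (\<lambda>e. if a e then b e else False)" by (intro ptime_intros)
  moreover have "(\<lambda>e. if a e then b e else False) = (\<lambda>e. a e \<and> b e)" by auto
  ultimately show ?thesis by simp
qed

lemma ptime_disj [ptime_intros]: "ptime a \<Longrightarrow> ptime b \<Longrightarrow> ptime (\<lambda>e. a e \<or> b e)"
proof -
  assume "ptime a" "ptime b"
  then have "ptime (\<lambda>e. if a e then True else b e)" by (intro ptime_intros)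
  moreover have "(\<lambda>e. if a e then True else b e) = (\<lambda>e. a e \<or> b e)" by auto
  ultimately show ?thesis by simp
qed

lemma ptime_not [ptime_intros]: "ptime a \<Longrightarrow> ptime (\<lambda>e. \<not> a e)"
proof -
  assume "ptime a"
  then have "ptime (\<lambda>e. if a e then False else True)" by (intro ptime_intros)
  moreover have "(\<lambda>e. if a e then False else True) = (\<lambda>e. \<not> a e)" by auto
  ultimately show ?thesis by simp
qed

lemma ptime_eq [ptime_intros]: "ptime f \<Longrightarrow> ptime g \<Longrightarrow> ptime (\<lambda>e. f e = g e)"
  by (rule ptime_comp2[of "(=)"]) (auto intro!: ptimeI[OF ptime_on_eq] simp: encode_prod_def encode_bool_def)

lemma ptime_case_prod [ptime_intros]:
  "ptime (\<lambda>e. g e (fst (f e)) (snd (f e))) \<Longrightarrow> ptime (\<lambda>e. case f e of (u, v) \<Rightarrow> g e u v)"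
  by (simp add: case_prod_beta)

lemma ptime_case_list [ptime_intros]:
  fixes l :: "'a::encodable \<Rightarrow> 'b::encodable list" and f :: "'a \<Rightarrow> 'c::encodable"
  assumes "ptime l" "ptime f" "ptime (\<lambda>p. g (fst p) (fst (snd p)) (snd (snd p)))"
  shows "ptime (\<lambda>e. case l e of [] \<Rightarrow> f e | y # ys \<Rightarrow> g e y ys)"
proof -
  let ?D = "range (encode :: 'a \<Rightarrow> data)" and ?E = "range (encode :: 'a \<times> 'b \<times> 'b list \<Rightarrow> data)"
  obtain G where G: "ptime_on ?E G" "\<And>p. G (encode p) = encode (g (fst p) (fst (snd p)) (snd (snd p)))"
    using assms(3) unfolding ptime_def by blast
  obtain F where F: "ptime_on ?D F" "\<And>x. F (encode x) = encode (f x)" using assms(2) unfolding ptime_def by blast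
  obtain L where L: "ptime_on ?D L" "\<And>x. L (encode x) = encode (l x)" using assms(1) unfolding ptime_def by blast
  \<comment> \<open>A dummy head. Both branches of \<open>ptime_on_if\<close> must be defined on the
    whole domain, but \<open>Pr x Nl\<close> does not encode a triple; the program for the second
    branch therefore gets \<open>[d]\<close> in place of an empty list.\<close>
  obtain d :: 'b where True by blast
  define L' where "L' = (\<lambda>x. if L x \<noteq> Nl then L x else encode [d])"
  have L': "ptime_on ?D L'" unfolding L'_def by (intro ptime_on_if L ptime_on_const)
  have "ptime_on ?D (\<lambda>x. G (Pr x (L' x)))"
  proof (rule ptime_on_comp[OF ptime_on_pair[OF ptime_on_id L'] G(1)])
    fix x assume "x \<in> ?D"
    then obtain e :: 'a where e: "x = encode e" by blast
    have "Pr x (L' x) = encode (e, hd (case l e of [] \<Rightarrow> [d] | y # ys \<Rightarrow> y # ys), tl (case l e of [] \<Rightarrow> [d] | y # ys \<Rightarrow> y # ys))"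
      by (auto simp: e L'_def L split: list.splits)
    then show "Pr x (L' x) \<in> ?E" by blast
  qed
  note P = ptime_on_if[OF L(1) this F(1)]
  show ?thesis
  proof (rule ptimeI[OF P])
    fix e
    show "(if L (encode e) \<noteq> Nl then G (Pr (encode e) (L' (encode e))) else F (encode e)) =
         encode (case l e of [] \<Rightarrow> f e | y # ys \<Rightarrow> g e y ys)"
      using G(2)[of "(e, hd (l e), tl (l e))"] by (auto simp: L F L'_def split: list.splits)
  qed
qed

lemma spine_encode [simp]: "spine (encode xs) = map encode xs"
  by (simp add: encode_list_def)

lemma ptime_foldl:
  fixes l :: "'a::encodable \<Rightarrow> 'b::encodable list" and i :: "'a \<Rightarrow> 'c::encodable"
  assumes "ptime (\<lambda>p. f (fst p) (fst (snd p)) (snd (snd p)))" "ptime i" "ptime l"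
    and bd: "\<And>e ys zs. l e = ys @ zs \<Longrightarrow> esize (foldl (f e) (i e) ys) \<le> poly Z (esize e)"
  shows "ptime (\<lambda>e. foldl (f e) (i e) (l e))"
proof -
  let ?D = "range (encode :: 'a \<Rightarrow> data)" and ?E = "range (encode :: 'a \<times> 'c \<times> 'b \<Rightarrow> data)"
  obtain F where F: "ptime_on ?E F" "\<And>p. F (encode p) = encode (f (fst p) (fst (snd p)) (snd (snd p)))"
    using assms(1) unfolding ptime_def by blast
  obtain I where I: "ptime_on ?D I" "\<And>x. I (encode x) = encode (i x)" using assms(2) unfolding ptime_def by blast
  obtain L where L: "ptime_on ?D L" "\<And>x. L (encode x) = encode (l x)" using assms(3) unfolding ptime_def by blast
  have df: "dfold F (encode e) (encode a) (map encode ys) = encode (foldl (f e) a ys)" for e a ys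
  proof (induction ys arbitrary: a)
    case (Cons y ys)
    then show ?case using F(2)[of "(e, a, y)"] by simp
  qed simp
  have "ptime_on ?D (\<lambda>x. dfold F x (I x) (spine (L x)))"
  proof (rule ptime_on_dfold[OF F(1) L(1) I(1)])
    fix x ys z zs
    assume "x \<in> ?D" "spine (L x) = ys @ z # zs"
    then obtain e :: 'a where e: "x = encode e" "map encode (l e) = ys @ z # zs" using L by auto
    then obtain ys' :: "'b list" and z' :: 'b where "ys = map encode ys'" "z = encode z'" by (auto simp: map_eq_append_conv)
    then have "Pr x (Pr (dfold F x (I x) ys) z) = encode (e, foldl (f e) (i e) ys', z')"
      by (simp add: e I df)
    then show "Pr x (Pr (dfold F x (I x) ys) z) \<in> ?E" by blast
  next
    fix x ys zs
    assume "x \<in> ?D" "spine (L x) = ys @ zs"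
    then obtain e :: 'a where e: "x = encode e" "map encode (l e) = ys @ zs" using L by auto
    then obtain ys' zs' :: "'b list" where "ys = map encode ys'" "l e = ys' @ zs'" by (auto simp: map_eq_append_conv)
    then show "dsize (dfold F x (I x) ys) \<le> poly Z (dsize x)" by (simp add: e I df bd)
  qed
  then show ?thesis by (rule ptimeI) (simp add: I L df)
qed

lemma esize_mem: "x \<in> set xs \<Longrightarrow> esize x \<le> esize xs"
  by (induction xs) auto

lemma length_le_esize: "length xs \<le> esize xs"
  by (induction xs) auto

lemma esize_append_le: "esize ys \<le> esize (ys @ zs)"
  by (induction ys) (auto simp: Suc_leI dsize_pos)

text \<open>The side condition on growth keeps the accumulator of the loop polynomially small.\<close>

lemma ptime_foldl_add:
  fixes l :: "'a::encodable \<Rightarrow> 'b::encodable list" and i :: "'a \<Rightarrow> 'c::encodable"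
  assumes "ptime (\<lambda>p. f (fst p) (fst (snd p)) (snd (snd p)))" "ptime i" "ptime l"
    and q: "\<And>e a x. esize (f e a x) \<le> esize a + poly q (esize e + esize x)"
  shows "ptime (\<lambda>e. foldl (f e) (i e) (l e))"
proof -
  obtain r where r: "\<And>e. esize (l e) \<le> poly r (esize e)" using ptime_size[OF assms(3)] by blast
  obtain s where s: "\<And>e. esize (i e) \<le> poly s (esize e)" using ptime_size[OF assms(2)] by blast
  \<comment> \<open>The initial size, plus at most \<open>r\<close> iterations that each add
    \<open>q\<close> of the sizes of the environment and the list.\<close>
  let ?Z = "s + r * pcompose q ([:0, 1:] + r)"
  have *: "esize (foldl (f e) a ys) \<le> esize a + length ys * poly q (esize e + esize ys)" for e a ys
  proof (induction ys rule: rev_induct)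
    case (snoc y ys)
    let ?b = "poly q (esize e + esize (ys @ [y]))"
    have "poly q (esize e + esize y) \<le> ?b" "poly q (esize e + esize ys) \<le> ?b"
      by (intro poly_nat_mono add_left_mono esize_mem esize_append_le; simp)+
    moreover from this have "length ys * poly q (esize e + esize ys) \<le> length ys * ?b"
      by (intro mult_left_mono) auto
    ultimately have "esize (f e (foldl (f e) a ys) y) \<le> esize a + (length ys * ?b + ?b)"
      using snoc q[of e "foldl (f e) a ys" y] by linarith
    then show ?case by (simp add: algebra_simps)
  qed simp
  show ?thesis
  proof (rule ptime_foldl[OF assms(1-3), where Z = ?Z])
    fix e ys zs
    assume l: "l e = ys @ zs"
    have sz: "esize ys \<le> poly r (esize e)" using r[of e] esize_append_le[of ys zs] l by simp
    have "length ys * poly q (esize e + esize ys) \<le> poly r (esize e) * poly q (esize e + poly r (esize e))"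
      using sz length_le_esize[of ys] by (intro mult_mono poly_nat_mono) auto
    then show "esize (foldl (f e) (i e) ys) \<le> poly ?Z (esize e)"
      using *[of e "i e" ys] s[of e] by (simp add: poly_pcompose)
  qed
qed

section \<open>List operations and arithmetic in polynomial time\<close>

lemma ptime_rev [ptime_intros]: "ptime (l :: _ \<Rightarrow> 'b::encodable list) \<Longrightarrow> ptime (\<lambda>e. rev (l e))"
proof (rule ptime_comp[of rev])
  have "ptime (\<lambda>e :: 'b list. foldl (\<lambda>a x. x # a) [] e)"
  proof (rule ptime_foldl_add[where q = "[:1, 1:]"])
    show "esize (x # a) \<le> esize a + poly [:1, 1:] (esize e + esize x)" for e a :: "'b list" and x by simp
  qed (intro ptime_intros)+
  note F = this
  have *: "foldl (\<lambda>a x. x # a) b xs = rev xs @ b" for b xs :: "'b list"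
    by (induction xs arbitrary: b) auto
  show "ptime (rev :: 'b list \<Rightarrow> _)" by (rule ptime_cong[OF F]) (simp add: *)
qed

lemma ptime_append [ptime_intros]: "ptime (l :: _ \<Rightarrow> 'b::encodable list) \<Longrightarrow> ptime k \<Longrightarrow> ptime (\<lambda>e. l e @ k e)"
proof (rule ptime_comp2[of "(@)"])
  have "ptime (\<lambda>e :: 'b list \<times> 'b list. foldl (\<lambda>a x. x # a) (snd e) (rev (fst e)))"
  proof (rule ptime_foldl_add[where q = "[:1, 1:]"])
    show "esize (x # a) \<le> esize a + poly [:1, 1:] (esize e + esize x)"
      for e :: "'b list \<times> 'b list" and a x by simp
  qed (intro ptime_intros)+
  note F = this
  have *: "foldl (\<lambda>a x. x # a) b xs = rev xs @ b" for b xs :: "'b list"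
    by (induction xs arbitrary: b) auto
  show "ptime (\<lambda>p. fst p @ (snd p :: 'b list))" by (rule ptime_cong[OF F]) (simp add: *)
qed

lemma ptime_length [ptime_intros]: "ptime (l :: _ \<Rightarrow> 'b::encodable list) \<Longrightarrow> ptime (\<lambda>e. length (l e))"
proof (rule ptime_comp[of length])
  have "ptime (\<lambda>e :: 'b list. foldl (\<lambda>a x. Suc a) 0 e)"
  proof (rule ptime_foldl_add[where q = "[:2:]"])
    show "esize (Suc a) \<le> esize a + poly [:2:] (esize e + esize x)" for e :: "'b list" and x :: 'b and a
      by simp
  qed (intro ptime_intros)+
  note F = this
  have *: "foldl (\<lambda>a x. Suc a) b xs = b + length xs" for b and xs :: "'b list"
    by (induction xs arbitrary: b) auto
  show "ptime (length :: 'b list \<Rightarrow> _)" by (rule ptime_cong[OF F]) (simp add: *)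
qed

lemma ptime_map [ptime_intros]:
  assumes "ptime (\<lambda>p. f (fst p) (snd p))" "ptime l"
  shows "ptime (\<lambda>e. map (f e) (l e))"
proof -
  obtain q where q: "\<And>p. esize (f (fst p) (snd p)) \<le> poly q (esize p)" using ptime_size[OF assms(1)] by blast
  have "ptime (\<lambda>e. rev (foldl (\<lambda>a x. f e x # a) [] (l e)))"
  proof (intro ptime_rev ptime_foldl_add[where q = "1 + pcompose q [:1, 1:]"])
    have "ptime (\<lambda>p. (\<lambda>p. f (fst p) (snd p)) ((fst p, snd (snd p))))"
      by (rule ptime_comp[OF assms(1)]) (intro ptime_intros)
    then show "ptime (\<lambda>p. f (fst p) (snd (snd p)) # fst (snd p))" by (intro ptime_intros) simp
    show "esize (f e x # a) \<le> esize a + poly (1 + pcompose q [:1, 1:]) (esize e + esize x)" for e a x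
      using q[of "(e, x)"] by (simp add: poly_pcompose)
  qed (intro ptime_intros assms)+
  moreover have "foldl (\<lambda>a x. g x # a) b xs = rev (map g xs) @ b" for b xs and g :: "'b \<Rightarrow> 'c"
    by (induction xs arbitrary: b) auto
  ultimately show ?thesis by simp
qed

lemma ptime_filter [ptime_intros]:
  assumes "ptime (\<lambda>p. f (fst p) (snd p))" "ptime l"
  shows "ptime (\<lambda>e. filter (f e) (l e))"
proof -
  have "ptime (\<lambda>e. rev (foldl (\<lambda>a x. if f e x then x # a else a) [] (l e)))"
  proof (intro ptime_rev ptime_foldl_add[where q = "[:1, 1:]"])
    have "ptime (\<lambda>p. (\<lambda>p. f (fst p) (snd p)) ((fst p, snd (snd p))))"
      by (rule ptime_comp[OF assms(1)]) (intro ptime_intros)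
    then show "ptime (\<lambda>p. if f (fst p) (snd (snd p)) then snd (snd p) # fst (snd p) else fst (snd p))"
      by (intro ptime_intros) simp
    show "esize (if f e x then x # a else a) \<le> esize a + poly [:1, 1:] (esize e + esize x)" for e a x
      by simp
  qed (intro ptime_intros assms)+
  moreover have "foldl (\<lambda>a x. if g x then x # a else a) b xs = rev (filter g xs) @ b" for b xs and g :: "'b \<Rightarrow> bool"
    by (induction xs arbitrary: b) auto
  ultimately show ?thesis by simp
qed

lemma ptime_list_ex [ptime_intros]:
  assumes "ptime (\<lambda>p. f (fst p) (snd p))" "ptime l"
  shows "ptime (\<lambda>e. list_ex (f e) (l e))"
proof -
  have "ptime (\<lambda>e. \<not> filter (f e) (l e) = [])" by (intro ptime_intros assms)
  then show ?thesis by (simp add: list_ex_iff filter_empty_conv)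
qed

lemma ptime_list_all [ptime_intros]:
  assumes "ptime (\<lambda>p. f (fst p) (snd p))" "ptime l"
  shows "ptime (\<lambda>e. list_all (f e) (l e))"
proof -
  have "ptime (\<lambda>e. filter (\<lambda>x. \<not> f e x) (l e) = [])" by (intro ptime_intros assms)
  then show ?thesis by (simp add: list_all_iff filter_empty_conv)
qed

lemma ptime_member [ptime_intros]:
  assumes "ptime x" "ptime l"
  shows "ptime (\<lambda>e. x e \<in> set (l e))"
proof -
  have "ptime (\<lambda>e. list_ex (\<lambda>y. x e = y) (l e))" by (intro ptime_intros ptime_comp[OF assms(1)] assms(2))
  then show ?thesis by (simp add: list_ex_iff)
qed

lemma esize_append: "esize (xs @ ys) + 1 = esize xs + esize ys"
  by (induction xs) auto

lemma ptime_concat [ptime_intros]: "ptime (l :: _ \<Rightarrow> 'b::encodable list list) \<Longrightarrow> ptime (\<lambda>e. concat (l e))"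
proof (rule ptime_comp[of concat])
  have "ptime (\<lambda>e :: 'b list list. foldl (\<lambda>a x. a @ x) [] e)"
  proof (rule ptime_foldl_add[where q = "[:0, 1:]"])
    show "esize (a @ x) \<le> esize a + poly [:0, 1:] (esize e + esize x)"
      for e :: "'b list list" and a x :: "'b list"
      using esize_append[of a x] by simp
  qed (intro ptime_intros)+
  note F = this
  have *: "foldl (\<lambda>a x. a @ x) b xs = b @ concat xs" for b :: "'b list" and xs
    by (induction xs arbitrary: b) auto
  show "ptime (concat :: 'b list list \<Rightarrow> _)" by (rule ptime_cong[OF F]) (simp add: *)
qed

lemma ptime_product [ptime_intros]:
  assumes "ptime l" "ptime k"
  shows "ptime (\<lambda>e. List.product (l e) (k e))"
proof -
  have "ptime (\<lambda>e. concat (map (\<lambda>x. map (\<lambda>y. (x, y)) (k e)) (l e)))"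
    by (intro ptime_intros assms ptime_comp[OF assms(2)])
  then show ?thesis by (simp add: product_concat_map)
qed

lemma ptime_replicate: "ptime n \<Longrightarrow> ptime (\<lambda>e. replicate (n e) False)"
proof (rule ptime_comp[of "\<lambda>n. replicate n False"])
  \<comment> \<open>A unary number and a list of that many \<open>False\<close> are the same
    tree.\<close>
  have "encode n = encode (replicate n False)" for n by (induction n) auto
  then show "ptime (\<lambda>n. replicate n False)" by (intro ptimeI[OF ptime_on_id]) simp
qed

lemma ptime_funpow:
  fixes f :: "'a::encodable \<Rightarrow> 'c::encodable \<Rightarrow> 'c"
  assumes "ptime (\<lambda>p. f (fst p) (snd p))" "ptime i" "ptime n"
    and bd: "\<And>e j. j \<le> n e \<Longrightarrow> esize ((f e ^^ j) (i e)) \<le> poly Z (esize e)"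
  shows "ptime (\<lambda>e. (f e ^^ n e) (i e))"
proof -
  have *: "foldl (\<lambda>a (_ :: bool). f e a) b xs = (f e ^^ length xs) b" for e b xs
    by (induction xs rule: rev_induct) auto
  have "ptime (\<lambda>p. (\<lambda>p. f (fst p) (snd p)) ((fst p, fst (snd p))))"
    by (rule ptime_comp[OF assms(1)]) (intro ptime_intros)
  then have "ptime (\<lambda>p. f (fst p) (fst (snd (p :: 'a \<times> 'c \<times> bool))))" by simp
  then have "ptime (\<lambda>e. foldl (\<lambda>a (_ :: bool). f e a) (i e) (replicate (n e) False))"
  proof (rule ptime_foldl[OF _ assms(2) ptime_replicate[OF assms(3)], where Z = Z])
    show "esize (foldl (\<lambda>a (_ :: bool). f e a) (i e) ys) \<le> poly Z (esize e)"
      if "replicate (n e) False = ys @ zs" for e ys zs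
      unfolding * using that by (intro bd) (metis length_append length_replicate le_add1)
  qed
  then show ?thesis by (simp add: *)
qed

lemma ptime_funpow_add:
  fixes f :: "'a::encodable \<Rightarrow> 'c::encodable \<Rightarrow> 'c"
  assumes "ptime (\<lambda>p. f (fst p) (snd p))" "ptime i" "ptime n"
    and bd: "\<And>e a. esize (f e a) \<le> esize a + poly q (esize e)"
  shows "ptime (\<lambda>e. (f e ^^ n e) (i e))"
proof -
  have *: "foldl (\<lambda>a (_ :: bool). f e a) b xs = (f e ^^ length xs) b" for e b xs
    by (induction xs rule: rev_induct) auto
  have "ptime (\<lambda>p. (\<lambda>p. f (fst p) (snd p)) ((fst p, fst (snd p))))"
    by (rule ptime_comp[OF assms(1)]) (intro ptime_intros)
  then have "ptime (\<lambda>p. f (fst p) (fst (snd (p :: 'a \<times> 'c \<times> bool))))" by simp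
  then have "ptime (\<lambda>e. foldl (\<lambda>a (_ :: bool). f e a) (i e) (replicate (n e) False))"
  proof (rule ptime_foldl_add[OF _ assms(2) ptime_replicate[OF assms(3)], where q = q])
    show "esize (f e a) \<le> esize a + poly q (esize e + esize x)" for e a and x :: bool
      using bd[of e a] poly_nat_mono[of "esize e" "esize e + esize x" q] by linarith
  qed
  then show ?thesis by (simp add: *)
qed

lemma ptime_add [ptime_intros]: "ptime f \<Longrightarrow> ptime g \<Longrightarrow> ptime (\<lambda>e. f e + (g e :: nat))"
proof (rule ptime_comp2[of "(+)"])
  have "ptime (\<lambda>p. (Suc ^^ fst p) (snd p))"
    by (rule ptime_funpow_add[where q = "[:2:]"]) (intro ptime_intros | simp)+
  note F = this
  have *: "(Suc ^^ n) m = n + m" for n m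
    by (induction n) auto
  show "ptime (\<lambda>p. fst p + (snd p :: nat))" by (rule ptime_cong[OF F]) (simp add: *)
qed

lemma ptime_diff [ptime_intros]: "ptime f \<Longrightarrow> ptime g \<Longrightarrow> ptime (\<lambda>e. f e - (g e :: nat))"
proof (rule ptime_comp2[of "(-)"])
  have "esize (a - Suc 0) \<le> esize a" for a :: nat by (cases a) auto
  then have "ptime (\<lambda>p. ((\<lambda>n. n - Suc 0) ^^ snd p) (fst p))"
    by (intro ptime_funpow_add[where q = "[:2:]"] ptime_pred ptime_intros) (simp add: le_SucI)
  note F = this
  have *: "((\<lambda>n. n - Suc 0) ^^ n) m = m - n" for n m
    by (induction n) auto
  show "ptime (\<lambda>p. fst p - (snd p :: nat))" by (rule ptime_cong[OF F]) (simp add: *)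
qed

lemma ptime_le [ptime_intros]: "ptime f \<Longrightarrow> ptime g \<Longrightarrow> ptime (\<lambda>e. f e \<le> (g e :: nat))"
proof -
  assume "ptime f" "ptime g"
  then have "ptime (\<lambda>e. f e - g e = 0)" by (intro ptime_intros)
  then show ?thesis by simp
qed

lemma esize_nat: "esize (n :: nat) = 2 * n + 1"
  by (induction n) auto

lemma ptime_mult [ptime_intros]: "ptime f \<Longrightarrow> ptime g \<Longrightarrow> ptime (\<lambda>e. f e * (g e :: nat))"
proof (rule ptime_comp2[of "(*)"])
  have "ptime (\<lambda>p. ((\<lambda>n. snd p + n) ^^ fst p) (0 :: nat))"
  proof (rule ptime_funpow_add[where q = "[:0, 2:]"])
    show "esize (snd p + a) \<le> esize a + poly [:0, 2:] (esize p)" for p :: "nat \<times> nat" and a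
      by (cases p) (simp add: esize_nat)
  qed (intro ptime_intros)+
  note F = this
  have *: "((\<lambda>n. m + n) ^^ k) 0 = k * m" for k m :: nat
    by (induction k) auto
  show "ptime (\<lambda>p. fst p * (snd p :: nat))" by (rule ptime_cong[OF F]) (simp add: *)
qed

lemma ptime_upt [ptime_intros]: "ptime n \<Longrightarrow> ptime (\<lambda>e. [0..<n e])"
proof (rule ptime_comp[of "\<lambda>n. [0..<n]"])
  have *: "((\<lambda>xs. xs @ [length xs]) ^^ n) [] = [0..<n]" for n by (induction n) auto
  have "ptime (\<lambda>n. ((\<lambda>xs. xs @ [length xs]) ^^ n) [])"
  proof (rule ptime_funpow[where Z = "[:1, 2:] * [:1, 2:]"])
    fix e j :: nat
    assume "j \<le> e"
    have "esize [0..<j] \<le> 1 + j * (2 * j + 2)"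
    proof (induction j)
      case (Suc j)
      have "esize [0..<Suc j] + 1 = esize [0..<j] + esize [j]"
        using esize_append[of "[0..<j]" "[j]"] by simp
      then show ?case using Suc by (simp add: esize_nat)
    qed simp
    also have "\<dots> \<le> (1 + 2 * e) * (1 + 2 * e)"
      using mult_mono[OF \<open>j \<le> e\<close> \<open>j \<le> e\<close>] \<open>j \<le> e\<close> by (simp add: algebra_simps)
    also have "\<dots> \<le> (1 + 2 * esize e) * (1 + 2 * esize e)"
      by (intro mult_mono) (auto simp: esize_nat)
    finally show "esize (((\<lambda>xs. xs @ [length xs]) ^^ j) []) \<le> poly ([:1, 2:] * [:1, 2:]) (esize e)"
      unfolding * by (simp add: algebra_simps)
  qed (intro ptime_intros)+
  then show "ptime (\<lambda>n. [0..<n])" by (simp add: *)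
qed

lemma ptime_drop [ptime_intros]: "ptime n \<Longrightarrow> ptime (l :: _ \<Rightarrow> 'b::encodable list) \<Longrightarrow> ptime (\<lambda>e. drop (n e) (l e))"
proof (rule ptime_comp2[of drop])
  have "esize (tl xs) \<le> esize xs" for xs :: "'b list" by (cases xs) auto
  then have "ptime (\<lambda>p. (tl ^^ fst p) (snd p :: 'b list))"
    by (intro ptime_funpow_add[where q = "[:2:]"] ptime_intros) (simp add: le_SucI)
  note F = this
  have *: "(tl ^^ n) xs = drop n xs" for n and xs :: "'b list"
    by (induction n) (auto simp: drop_Suc tl_drop)
  show "ptime (\<lambda>p. drop (fst p) (snd p :: 'b list))" by (rule ptime_cong[OF F]) (simp add: *)
qed

lemma ptime_take [ptime_intros]: "ptime n \<Longrightarrow> ptime l \<Longrightarrow> ptime (\<lambda>e. take (n e) (l e))"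
proof -
  assume "ptime n" "ptime l"
  then have "ptime (\<lambda>e. rev (drop (length (l e) - n e) (rev (l e))))" by (intro ptime_intros)
  then show ?thesis
  proof (rule ptime_cong)
    show "rev (drop (length (l e) - n e) (rev (l e))) = take (n e) (l e)" for e
      by (cases "n e \<le> length (l e)") (auto simp: rev_drop)
  qed
qed

section \<open>The kernelization algorithm\<close>

lemma ptime_Let [ptime_intros]:
  "ptime f \<Longrightarrow> ptime (\<lambda>p. g (fst p) (snd p)) \<Longrightarrow> ptime (\<lambda>e. let x = f e in g e x)"
  using ptime_comp[of "\<lambda>p. g (fst p) (snd p)" "\<lambda>e. (e, f e)"] by (simp add: ptime_Pair ptime_id)

lemma ptime_comp3:
  assumes "ptime (\<lambda>p. g (fst p) (fst (snd p)) (snd (snd p)))" "ptime a" "ptime b" "ptime c"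
  shows "ptime (\<lambda>e. g (a e) (b e) (c e))"
  using ptime_comp[OF assms(1), of "\<lambda>e. (a e, b e, c e)"] assms by (simp add: ptime_Pair)

lemma ptime_comp4:
  assumes "ptime (\<lambda>p. g (fst p) (fst (snd p)) (fst (snd (snd p))) (snd (snd (snd p))))"
    "ptime a" "ptime b" "ptime c" "ptime d"
  shows "ptime (\<lambda>e. g (a e) (b e) (c e) (d e))"
  using ptime_comp[OF assms(1), of "\<lambda>e. (a e, b e, c e, d e)"] assms by (simp add: ptime_Pair)

type_synonym edges = "(nat \<times> nat) list"

definition nthd :: "'a \<Rightarrow> 'a list \<Rightarrow> nat \<Rightarrow> 'a" where
  "nthd d xs i = (case drop i xs of [] \<Rightarrow> d | y # _ \<Rightarrow> y)"

lemma ptime_nthd: "ptime (\<lambda>p. nthd d (fst p) (snd p))"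
  unfolding nthd_def[abs_def] by (intro ptime_intros)

lemmas [ptime_intros] = ptime_comp2[where g = "nthd d" for d, OF ptime_nthd]

definition edge_list :: "bool list list \<Rightarrow> edges" where
  "edge_list m = filter (\<lambda>p. nthd False (nthd [] m (fst p)) (snd p)) (List.product [0..<length m] [0..<length m])"

lemma ptime_edge_list: "ptime edge_list"
  unfolding edge_list_def[abs_def] by (intro ptime_intros)

lemmas [ptime_intros] = ptime_comp[where g = edge_list, OF ptime_edge_list]

text \<open>A binary parameter can be exponentially larger than the input, so its unary value is cut
  off at \<open>n + 1\<close>. Nothing is lost, because a parameter above the number
  \<open>n\<close> of vertices makes a no-instance.\<close>

definition capped_val :: "nat \<Rightarrow> bool list \<Rightarrow> nat" where
  "capped_val n bs = foldl (\<lambda>a b. if Suc n \<le> a + a + (if b then 1 else 0) then Suc n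
     else a + a + (if b then 1 else 0)) 0 (rev bs)"

lemma ptime_capped_val: "ptime (\<lambda>p. capped_val (fst p) (snd p))"
  unfolding capped_val_def
proof (rule ptime_foldl[where Z = "[:3, 2:]"])
    fix e :: "nat \<times> bool list" and ys
    let ?f = "\<lambda>a b. if Suc (fst e) \<le> a + a + (if b then 1 else 0) then Suc (fst e) else a + a + (if b then 1 else 0)"
    have "foldl ?f 0 ys \<le> Suc (fst e)" by (induction ys rule: rev_induct) auto
    moreover have "fst e \<le> esize e" by (cases e) (simp add: esize_nat)
    ultimately show "esize (foldl ?f 0 ys) \<le> poly [:3, 2:] (esize e)" unfolding esize_nat by simp
qed (intro ptime_intros)+

lemmas [ptime_intros] = ptime_comp2[where g = capped_val, OF ptime_capped_val]

fun incr :: "bool \<Rightarrow> bool list \<Rightarrow> bool list" where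
  "incr c [] = (if c then [True] else [])"
| "incr c (b # bs) = (c \<noteq> b) # incr (c \<and> b) bs"

text \<open>The bits that the carry passes shrink from \<open>True\<close> to \<open>False\<close>.
  The carry is absorbed either by a \<open>False\<close> that becomes \<open>True\<close>, at cost
  2, or by a new last bit, at cost 4; so repeated increments stay small.\<close>

lemma esize_incr: "esize (incr c bs) \<le> esize bs + (if c then 4 else 0)"
  by (induction c bs rule: incr.induct) (auto split: if_splits)

text \<open>Brings the increment into the form of a left fold, with the carry and the reversed
  output as accumulator, to which the loop rules apply.\<close>

lemma incr_foldl:
  "rev acc @ incr c bs = (let r = foldl (\<lambda>a b. (fst a \<and> b, (fst a \<noteq> b) # snd a)) (c, acc) bs in
     rev (snd r) @ (if fst r then [True] else []))"
proof (induction bs arbitrary: c acc)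
  case (Cons b bs)
  then show ?case using Cons[of "(c \<noteq> b) # acc" "c \<and> b"] by (simp add: Let_def)
qed simp

lemma ptime_incr: "ptime (incr True)"
proof -
  have "ptime (\<lambda>bs :: bool list. foldl (\<lambda>a b. (fst a \<and> b, (fst a \<noteq> b) # snd a)) (True, []) bs)"
  proof (rule ptime_foldl_add[where q = "[:10:]"])
    have *: "esize b \<le> 3" for b :: bool by (cases b) auto
    show "esize (fst a \<and> x, (fst a \<noteq> x) # snd a) \<le> esize a + poly [:10:] (esize e + esize x)"
      for e :: "bool list" and a x
      using *[of "fst a \<and> x"] *[of "fst a \<noteq> x"] by (cases a) simp
  qed (intro ptime_intros)+
  then have "ptime (\<lambda>bs :: bool list. let r = foldl (\<lambda>a b. (fst a \<and> b, (fst a \<noteq> b) # snd a)) (True, []) bs in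
     rev (snd r) @ (if fst r then [True] else []))"
    by (intro ptime_intros)
  then show "ptime (incr True)" by (rule ptime_cong) (use incr_foldl[of "[]" True] in simp)
qed

lemmas [ptime_intros] = ptime_comp[where g = "incr True", OF ptime_incr]

definition to_bits :: "nat \<Rightarrow> bool list" where
  "to_bits n = (incr True ^^ n) []"

lemma ptime_to_bits: "ptime to_bits"
  unfolding to_bits_def[abs_def]
proof (rule ptime_funpow_add[where q = "[:4:]"])
    show "esize (incr True bs) \<le> esize bs + poly [:4:] (esize e)" for e :: nat and bs
      using esize_incr[of True bs] by simp
qed (intro ptime_intros)+

lemmas [ptime_intros] = ptime_comp[where g = to_bits, OF ptime_to_bits]

section \<open>The reduction as a program on lists of edges\<close>

definition quads :: "nat list \<Rightarrow> nat quad list" where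
  "quads vs = List.product vs (List.product vs (List.product vs vs))"

lemma ptime_quads: "ptime quads"
  unfolding quads_def[abs_def] by (intro ptime_intros)

lemmas [ptime_intros] = ptime_comp[where g = quads, OF ptime_quads]

definition path4 :: "edges \<Rightarrow> nat quad \<Rightarrow> bool" where
  "path4 es q = (case q of (a, b, c, d) \<Rightarrow> a \<noteq> b \<and> a \<noteq> c \<and> a \<noteq> d \<and> b \<noteq> c \<and> b \<noteq> d \<and> c \<noteq> d
     \<and> (a, b) \<in> set es \<and> (b, c) \<in> set es \<and> (c, d) \<in> set es)"

lemma ptime_path4: "ptime (\<lambda>p. path4 (fst p) (snd p))"
  unfolding path4_def[abs_def] by (intro ptime_intros)

lemmas [ptime_intros] = ptime_comp2[where g = path4, OF ptime_path4]

definition qlist :: "nat quad \<Rightarrow> nat list" where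
  "qlist q = (case q of (a, b, c, d) \<Rightarrow> [a, b, c, d])"

lemma ptime_qlist: "ptime qlist"
  unfolding qlist_def[abs_def] by (intro ptime_intros)

lemmas [ptime_intros] = ptime_comp[where g = qlist, OF ptime_qlist]

definition greedy :: "nat list \<Rightarrow> edges \<Rightarrow> nat list" where
  "greedy vs es = foldl (\<lambda>A q. if path4 es q \<and> \<not> list_ex (\<lambda>v. v \<in> set A) (qlist q) then qlist q @ A else A) [] (quads vs)"

lemma ptime_greedy: "ptime (\<lambda>p. greedy (fst p) (snd p))"
  unfolding greedy_def
proof (rule ptime_foldl_add[where q = "[:10, 10:]"])
    fix e :: "nat list \<times> edges" and A q
    have "esize (qlist q) \<le> 10 + 10 * esize q" by (cases q) (auto simp: qlist_def)
    moreover have "esize (qlist q @ A) + 1 = esize (qlist q) + esize A" by (rule esize_append)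
    ultimately show "esize (if path4 (snd e) q \<and> \<not> list_ex (\<lambda>v. v \<in> set A) (qlist q) then qlist q @ A else A)
       \<le> esize A + poly [:10, 10:] (esize e + esize q)" by simp
qed (intro ptime_intros)+

lemmas [ptime_intros] = ptime_comp2[where g = greedy, OF ptime_greedy]

definition centers :: "edges \<Rightarrow> nat list \<Rightarrow> nat list" where
  "centers es R = filter (\<lambda>v.
     list_ex (\<lambda>u. list_ex (\<lambda>w. u \<noteq> w \<and> (v, u) \<in> set es \<and> (v, w) \<in> set es) R) R
     \<or> list_ex (\<lambda>w. (v, w) \<in> set es \<and> list_all (\<lambda>x. (w, x) \<notin> set es \<or> x = v) R) R) R"

lemma ptime_centers: "ptime (\<lambda>p. centers (fst p) (snd p))"
  unfolding centers_def[abs_def] by (intro ptime_intros)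

lemmas [ptime_intros] = ptime_comp2[where g = centers, OF ptime_centers]

definition gam :: "edges \<Rightarrow> nat list \<Rightarrow> nat list \<Rightarrow> nat \<Rightarrow> nat list" where
  "gam es R Cs s = filter (\<lambda>c. (s, c) \<in> set es \<or> list_ex (\<lambda>r. (s, r) \<in> set es \<and> (r, c) \<in> set es) R) Cs"

lemma ptime_gam: "ptime (\<lambda>p. gam (fst p) (fst (snd p)) (fst (snd (snd p))) (snd (snd (snd p))))"
  unfolding gam_def[abs_def] by (intro ptime_intros)

lemmas [ptime_intros] = ptime_comp4[where g = gam, OF ptime_gam]

definition rich :: "edges \<Rightarrow> nat list \<Rightarrow> nat list \<Rightarrow> nat \<Rightarrow> nat list" where
  "rich es A R k = filter (\<lambda>s. 12 * k \<le> length (gam es R (centers es R) s)) A"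

lemma ptime_rich: "ptime (\<lambda>p. rich (fst p) (fst (snd p)) (fst (snd (snd p))) (snd (snd (snd p))))"
  unfolding rich_def[abs_def] by (intro ptime_intros)

lemmas [ptime_intros] = ptime_comp4[where g = rich, OF ptime_rich]

definition delete_vs :: "edges \<Rightarrow> nat list \<Rightarrow> edges" where
  "delete_vs es X = filter (\<lambda>p. fst p \<notin> set X \<and> snd p \<notin> set X) es"

lemma ptime_delete_vs: "ptime (\<lambda>p. delete_vs (fst p) (snd p))"
  unfolding delete_vs_def[abs_def] by (intro ptime_intros)

lemmas [ptime_intros] = ptime_comp2[where g = delete_vs, OF ptime_delete_vs]

definition edge_of :: "nat quad \<Rightarrow> nat \<times> nat \<Rightarrow> bool" where
  "edge_of q p = (case q of (a, b, c, d) \<Rightarrow> p \<in> set [(a, b), (b, a), (b, c), (c, b), (c, d), (d, c)])"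

lemma ptime_edge_of: "ptime (\<lambda>p. edge_of (fst p) (snd p))"
  unfolding edge_of_def[abs_def] by (intro ptime_intros)

lemmas [ptime_intros] = ptime_comp2[where g = edge_of, OF ptime_edge_of]

definition useful :: "nat list \<Rightarrow> edges \<Rightarrow> edges" where
  "useful vs es = filter (\<lambda>p. list_ex (\<lambda>q. path4 es q \<and> edge_of q p) (quads vs)) es"

lemma ptime_useful: "ptime (\<lambda>p. useful (fst p) (snd p))"
  unfolding useful_def[abs_def] by (intro ptime_intros)

lemmas [ptime_intros] = ptime_comp2[where g = useful, OF ptime_useful]

text \<open>The number of \<open>t\<close> with \<open>t * t\<close> at most \<open>16 * k\<close>,
  that is, the floor of \<open>4 * sqrt k\<close> plus one: the least \<open>T\<close> with
  \<open>16 * k < T * T\<close>.\<close>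

definition threshold :: "nat \<Rightarrow> nat" where
  "threshold k = length (filter (\<lambda>t. t * t \<le> 16 * k) [0..<16 * k + 1])"

lemma ptime_threshold: "ptime threshold"
  unfolding threshold_def[abs_def] by (intro ptime_intros)

lemmas [ptime_intros] = ptime_comp[where g = threshold, OF ptime_threshold]

definition load_of :: "edges \<Rightarrow> nat \<Rightarrow> nat" where
  "load_of fs p = length (filter (\<lambda>x. snd x = p) fs)"

lemma ptime_load_of: "ptime (\<lambda>p. load_of (fst p) (snd p))"
  unfolding load_of_def[abs_def] by (intro ptime_intros)

lemmas [ptime_intros] = ptime_comp2[where g = load_of, OF ptime_load_of]

text \<open>An entry \<open>((b, q), p)\<close> proposes to move \<open>b\<close> from bin
  \<open>q\<close> to bin \<open>p\<close>. A gap of two is the least for which a move decreases the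
  sum of the squared loads.\<close>

definition moves :: "nat list \<Rightarrow> edges \<Rightarrow> edges \<Rightarrow> ((nat \<times> nat) \<times> nat) list" where
  "moves vs es fs = filter (\<lambda>m. (fst (fst m), snd m) \<in> set es \<and> load_of fs (snd m) + 2 \<le> load_of fs (snd (fst m)))
     (List.product fs vs)"

lemma ptime_moves: "ptime (\<lambda>p. moves (fst p) (fst (snd p)) (snd (snd p)))"
  unfolding moves_def[abs_def] by (intro ptime_intros)

lemmas [ptime_intros] = ptime_comp3[where g = moves, OF ptime_moves]

definition move :: "nat list \<Rightarrow> edges \<Rightarrow> edges \<Rightarrow> edges" where
  "move vs es fs = (case moves vs es fs of [] \<Rightarrow> fs
     | m # _ \<Rightarrow> map (\<lambda>x. if x = fst m then (fst x, snd m) else x) fs)"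

lemma ptime_move: "ptime (\<lambda>p. move (fst p) (fst (snd p)) (snd (snd p)))"
  unfolding move_def[abs_def] by (intro ptime_intros)

lemmas [ptime_intros] = ptime_comp3[where g = move, OF ptime_move]

text \<open>Every move decreases the sum of the squared loads, which is at most the square of
  \<open>length vs\<close> in the beginning; hence the iteration ends in a balanced assignment.\<close>

definition balance :: "nat list \<Rightarrow> edges \<Rightarrow> nat list \<Rightarrow> nat \<Rightarrow> edges" where
  "balance vs es its a = (move vs es ^^ (length vs * length vs)) (map (\<lambda>b. (b, a)) its)"

lemma move_fst: "map fst (move vs es fs) = map fst fs"
  by (auto simp: move_def split: list.splits)

lemma move_snd: "snd ` set (move vs es fs) \<subseteq> snd ` set fs \<union> set vs"
proof -
  have "snd m \<in> set vs" if "m \<in> set (moves vs es fs)" for m using that by (auto simp: moves_def)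
  then show ?thesis by (force simp: move_def split: list.splits)
qed

lemma moves_iterate:
  "map fst ((move vs es ^^ j) fs) = map fst fs" "snd ` set ((move vs es ^^ j) fs) \<subseteq> snd ` set fs \<union> set vs"
proof (induction j)
  case (Suc j)
  show "map fst ((move vs es ^^ Suc j) fs) = map fst fs" using Suc(1) by (simp add: move_fst)
  show "snd ` set ((move vs es ^^ Suc j) fs) \<subseteq> snd ` set fs \<union> set vs"
    using Suc(2) move_snd[of vs es "(move vs es ^^ j) fs"] by (simp, blast)
qed auto

lemma esize_list_le: "(\<And>x. x \<in> set xs \<Longrightarrow> esize x \<le> m) \<Longrightarrow> esize xs \<le> 1 + length xs * (m + 1)"
  by (induction xs) fastforce+

text \<open>Moves preserve the list of first components and use only \<open>a\<close> and elements
  of \<open>vs\<close> as bins, which bounds the size after any number of iterations.\<close>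

lemma ptime_balance:
  "ptime (\<lambda>p. balance (fst p) (fst (snd p)) (fst (snd (snd p))) (snd (snd (snd p))))"
  unfolding balance_def
proof (rule ptime_funpow[where Z = "[:1:] + [:0, 1:] * [:2, 3:]"])
    fix e :: "nat list \<times> edges \<times> nat list \<times> nat" and j
    obtain vs es its a where e: "e = (vs, es, its, a)" by (metis prod_cases4)
    define fs where "fs = (move vs es ^^ j) (map (\<lambda>b. (b, a)) its)"
    have m: "map fst fs = its" using moves_iterate(1)[where fs = "map (\<lambda>b. (b, a)) its"] by (simp add: fs_def comp_def)
    have s: "snd ` set fs \<subseteq> insert a (set vs)"
      using moves_iterate(2)[where fs = "map (\<lambda>b. (b, a)) its"] by (force simp: fs_def)
    have "esize x \<le> 1 + esize its + (esize a + esize vs)" if x: "x \<in> set fs" for x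
    proof -
      have "fst x \<in> set its" using x m by force
      then have "esize (fst x) \<le> esize its" by (rule esize_mem)
      moreover have "esize (snd x) \<le> esize a + esize vs" using s x esize_mem[of "snd x" vs] by force
      ultimately show ?thesis by (cases x) simp
    qed
    then have "esize fs \<le> 1 + length fs * (1 + esize its + (esize a + esize vs) + 1)" by (rule esize_list_le)
    also have "length fs = length its" using m by (metis length_map)
    also have "1 + length its * (1 + esize its + (esize a + esize vs) + 1) \<le> 1 + esize e * (2 + 3 * esize e)"
      using length_le_esize[of its] by (intro add_left_mono mult_mono) (auto simp: e)
    finally show "esize ((move (fst e) (fst (snd e)) ^^ j) (map (\<lambda>b. (b, snd (snd (snd e)))) (fst (snd (snd e)))))
      \<le> poly ([:1:] + [:0, 1:] * [:2, 3:]) (esize e)"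
      by (simp add: e fs_def algebra_simps)
qed (intro ptime_intros)+

lemmas [ptime_intros] = ptime_comp4[where g = balance, OF ptime_balance]

text \<open>\<open>Bs\<close> and \<open>T\<close> are paired so that four arguments remain, the
  number handled by \<open>ptime_comp4\<close>. An entry \<open>(a, b, p)\<close> records that
  \<open>a\<close> keeps \<open>b\<close> in bin \<open>p\<close>.\<close>

definition kept_at :: "nat list \<Rightarrow> edges \<Rightarrow> nat list \<times> nat \<Rightarrow> nat \<Rightarrow> (nat \<times> nat \<times> nat) list" where
  "kept_at vs es BT a = concat (map (\<lambda>p. map (\<lambda>x. (a, fst x, p)) (take (Suc (snd BT))
     (filter (\<lambda>x. snd x = p) (balance vs es (filter (\<lambda>b. (a, b) \<in> set es) (fst BT)) a)))) vs)"

lemma ptime_kept_at: "ptime (\<lambda>p. kept_at (fst p) (fst (snd p)) (fst (snd (snd p))) (snd (snd (snd p))))"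
  unfolding kept_at_def[abs_def] by (intro ptime_intros)

lemmas [ptime_intros] = ptime_comp4[where g = kept_at, OF ptime_kept_at]

definition kept :: "nat list \<Rightarrow> edges \<Rightarrow> nat list \<Rightarrow> nat \<Rightarrow> (nat \<times> nat \<times> nat) list" where
  "kept vs es Bs T = concat (map (kept_at vs es (Bs, T)) (filter (\<lambda>a. a \<notin> set Bs) vs))"

lemma ptime_kept: "ptime (\<lambda>p. kept (fst p) (fst (snd p)) (fst (snd (snd p))) (snd (snd (snd p))))"
  unfolding kept_def[abs_def] by (intro ptime_intros)

lemmas [ptime_intros] = ptime_comp4[where g = kept, OF ptime_kept]

definition sparse :: "nat list \<Rightarrow> edges \<Rightarrow> nat list \<Rightarrow> nat \<Rightarrow> edges" where
  "sparse vs es Bs T = filter (\<lambda>p. fst p \<notin> set Bs \<and> snd p \<notin> set Bs) es @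
     concat (map (\<lambda>(a, b, p). [(a, b), (b, a), (b, p), (p, b)]) (kept vs es Bs T))"

lemma ptime_sparse: "ptime (\<lambda>p. sparse (fst p) (fst (snd p)) (fst (snd (snd p))) (snd (snd (snd p))))"
  unfolding sparse_def[abs_def] by (intro ptime_intros)

lemmas [ptime_intros] = ptime_comp4[where g = sparse, OF ptime_sparse]

text \<open>Isolated vertices are removed, for a kernel must be bounded in its number of vertices as
  well; what remains has no more vertices than \<open>es\<close> has pairs.\<close>

definition restrict_matrix :: "nat list \<Rightarrow> edges \<Rightarrow> bool list list" where
  "restrict_matrix vs es = (let W = filter (\<lambda>v. list_ex (\<lambda>p. fst p = v) es) vs in
     map (\<lambda>u. map (\<lambda>v. (u, v) \<in> set es) W) W)"

lemma ptime_restrict_matrix: "ptime (\<lambda>p. restrict_matrix (fst p) (snd p))"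
  unfolding restrict_matrix_def[abs_def] by (intro ptime_intros)

lemmas [ptime_intros] = ptime_comp2[where g = restrict_matrix, OF ptime_restrict_matrix]

definition reduce :: "nat list \<Rightarrow> edges \<Rightarrow> nat list \<Rightarrow> nat \<Rightarrow> bool list list \<times> bool list" where
  "reduce vs es A k = (let R = filter (\<lambda>v. v \<notin> set A) vs; Cs = centers es R;
     Bs = filter (\<lambda>v. v \<notin> set Cs) R; X = rich es A R k in
     (restrict_matrix vs (sparse vs (useful vs (delete_vs es X)) Bs (threshold k)), to_bits (k - length X)))"

lemma ptime_reduce: "ptime (\<lambda>p. reduce (fst p) (fst (snd p)) (fst (snd (snd p))) (snd (snd (snd p))))"
  unfolding reduce_def[abs_def] by (intro ptime_intros)

lemmas [ptime_intros] = ptime_comp4[where g = reduce, OF ptime_reduce]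

text \<open>The empty graph with parameter 1 or 0 serves as a trivial no- or yes-instance.\<close>

definition kernel :: "bool list list \<times> bool list \<Rightarrow> bool list list \<times> bool list" where
  "kernel x = (let n = length (fst x); k = capped_val n (snd x); vs = [0..<n]; es = edge_list (fst x);
     A = greedy vs es in
     if \<not> k \<le> n then ([], [True]) else if 4 * k \<le> length A then ([], []) else reduce vs es A k)"

lemma ptime_kernel: "ptime kernel"
  unfolding kernel_def by (intro ptime_intros)

section \<open>Correctness of the algorithm\<close>

abbreviation edge_rel :: "edges \<Rightarrow> nat \<Rightarrow> nat \<Rightarrow> bool" where
  "edge_rel es u v \<equiv> (u, v) \<in> set es"

lemma path4_iff: "path4 es q \<longleftrightarrow> P4 (edge_rel es) q"
  by (cases q) (auto simp: path4_def)

lemma set_qlist: "set (qlist q) = qverts q"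
  by (cases q) (auto simp: qlist_def)

lemma qlist_path4: "path4 es q \<Longrightarrow> distinct (qlist q) \<and> length (qlist q) = 4"
  by (cases q) (auto simp: qlist_def path4_def)

lemma set_quads: "q \<in> set (quads vs) \<longleftrightarrow> qverts q \<subseteq> set vs"
  by (cases q) (auto simp: quads_def)

text \<open>\<open>A\<close> only grows, so a quadruple that was rejected, or accepted, keeps
  meeting \<open>A\<close>; after all quadruples have been tried the packing is maximal.\<close>

lemma greedy_spec:
  fixes vs :: "nat list" and es :: edges
  defines "A \<equiv> greedy vs es"
  shows "\<exists>M. packing (edge_rel es) M \<and> covered M = set A \<and> length A = 4 * card M"
    and "distinct A" and "set A \<subseteq> set vs"
    and "P4 (edge_rel es) q \<Longrightarrow> qverts q \<subseteq> set vs \<Longrightarrow> qverts q \<inter> set A \<noteq> {}"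
proof -
  define f where "f = (\<lambda>A q. if path4 es q \<and> \<not> list_ex (\<lambda>v. v \<in> set A) (qlist q) then qlist q @ A else A)"
  define I where "I = (\<lambda>qs A. (\<exists>M. packing (edge_rel es) M \<and> covered M = set A \<and> length A = 4 * card M)
    \<and> distinct A \<and> set A \<subseteq> set vs \<and> (\<forall>q\<in>set qs. path4 es q \<longrightarrow> qverts q \<inter> set A \<noteq> {}))"
  have "I qs (foldl f [] qs)" if "set qs \<subseteq> set (quads vs)" for qs
    using that
  proof (induction qs rule: rev_induct)
    case Nil
    show ?case unfolding I_def
      by (auto simp: packing_def covered_def intro!: exI[of _ "{}"])
  next
    case (snoc q qs)
    let ?A = "foldl f [] qs"
    have qvs: "qverts q \<subseteq> set vs" using snoc.prems set_quads by auto
    have IH: "I qs ?A" using snoc by auto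
    show ?case
    proof (cases "path4 es q \<and> qverts q \<inter> set ?A = {}")
      case True
      then have fA: "foldl f [] (qs @ [q]) = qlist q @ ?A"
        by (auto simp: f_def list_ex_iff set_qlist)
      obtain M where M: "packing (edge_rel es) M" "covered M = set ?A" "length ?A = 4 * card M"
        using IH by (auto simp: I_def)
      have fin: "finite M" using M(1) by (simp add: packing_def)
      have dis: "qverts q \<inter> qverts r = {}" if "r \<in> M" for r using True M(2) that by (auto simp: covered_def)
      have qM: "q \<notin> M" using dis[of q] by auto
      have "packing (edge_rel es) (insert q M)"
        using M(1) True dis fin unfolding packing_def by (auto simp: Int_commute path4_iff)
      moreover have "covered (insert q M) = set (qlist q @ ?A)" using M(2) by (auto simp: covered_def set_qlist)
      moreover have "length (qlist q @ ?A) = 4 * card (insert q M)"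
        using qlist_path4[of es q] True M(3) fin qM by simp
      moreover have "distinct (qlist q @ ?A)"
        using qlist_path4[of es q] True IH by (simp add: I_def set_qlist)
      moreover have "set (qlist q @ ?A) \<subseteq> set vs" using IH qvs by (auto simp: I_def set_qlist)
      moreover have "\<forall>r\<in>set (qs @ [q]). path4 es r \<longrightarrow> qverts r \<inter> set (qlist q @ ?A) \<noteq> {}"
      proof
        fix r assume "r \<in> set (qs @ [q])"
        then consider "r \<in> set qs" | "r = q" by auto
        then show "path4 es r \<longrightarrow> qverts r \<inter> set (qlist q @ ?A) \<noteq> {}"
        proof cases
          case 1 then show ?thesis using IH by (auto simp: I_def)
        next
          case 2 then show ?thesis by (simp add: set_qlist Int_Un_distrib)
        qed
      qed
      ultimately show ?thesis unfolding I_def fA by blast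
    next
      case False
      then have "foldl f [] (qs @ [q]) = ?A" by (auto simp: f_def list_ex_iff set_qlist)
      then show ?thesis using IH False by (auto simp: I_def)
    qed
  qed
  from this[of "quads vs"] have I: "I (quads vs) A" by (simp add: A_def greedy_def f_def)
  then show "\<exists>M. packing (edge_rel es) M \<and> covered M = set A \<and> length A = 4 * card M" "distinct A" "set A \<subseteq> set vs"
    by (auto simp: I_def)
  show "P4 (edge_rel es) q \<Longrightarrow> qverts q \<subseteq> set vs \<Longrightarrow> qverts q \<inter> set A \<noteq> {}"
    using I set_quads by (auto simp: I_def path4_iff)
qed

text \<open>The potential decreases until \<open>Q\<close> holds, and from then on the state is
  fixed. Hence a number of iterations known beforehand replaces a test for termination.\<close>

lemma funpow_stable:
  fixes \<Phi> :: "'a \<Rightarrow> nat" and s :: "'a \<Rightarrow> 'a"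
  assumes inv: "\<And>x. P x \<Longrightarrow> P (s x)" and dec: "\<And>x. P x \<Longrightarrow> \<not> Q x \<Longrightarrow> \<Phi> (s x) < \<Phi> x"
    and stop: "\<And>x. Q x \<Longrightarrow> s x = x"
    and "P x" "\<Phi> x \<le> N"
  shows "P ((s ^^ N) x) \<and> Q ((s ^^ N) x)"
  using assms(4,5)
proof (induction N arbitrary: x)
  case 0
  then show ?case using dec[of x] by auto
next
  case (Suc N)
  show ?case
  proof (cases "Q x")
    case True
    then have "(s ^^ j) x = x" for j by (induction j) (auto simp: stop)
    from this[of "Suc N"] show ?thesis using True Suc.prems by (simp only:)
  next
    case False
    then have "\<Phi> (s x) \<le> N" using dec[OF Suc.prems(1)] Suc.prems(2) by fastforce
    then have "P ((s ^^ N) (s x)) \<and> Q ((s ^^ N) (s x))" using Suc.IH inv Suc.prems(1) by blast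
    then show ?thesis by (simp only: funpow_Suc_right comp_apply)
  qed
qed

section \<open>Balanced assignments by descent on the sum of squared loads\<close>

lemma load_of_card: "distinct fs \<Longrightarrow> load_of fs p = card {x \<in> set fs. snd x = p}"
  unfolding load_of_def using distinct_length_filter[of fs "\<lambda>x. snd x = p"]
  by (simp add: Int_def conj_commute)

lemma load_of_move:
  assumes d: "distinct (map fst fs)" and x: "(b, q) \<in> set fs" and pq: "p \<noteq> q"
  defines "gs \<equiv> map (\<lambda>x. if x = (b, q) then (b, p) else x) fs"
  shows "load_of gs r = (if r = p then load_of fs p + 1 else if r = q then load_of fs q - 1 else load_of fs r)"
    and "load_of fs q \<ge> 1"
proof -
  have df: "distinct fs" using d by (simp add: distinct_map)
  have "map fst gs = map fst fs" by (auto simp: gs_def)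
  then have dg: "distinct gs" using d by (metis distinct_map)
  have nb: "(b, p) \<notin> set fs" 
    using d x pq inj_onD[of fst "set fs" "(b, q)" "(b, p)"] by (auto simp: distinct_map)
  have sg: "set gs = insert (b, p) (set fs - {(b, q)})" using x by (auto simp: gs_def)
  have g: "{x \<in> set gs. snd x = r} = (if r = p then insert (b, p) {x \<in> set fs. snd x = p}
     else if r = q then {x \<in> set fs. snd x = q} - {(b, q)} else {x \<in> set fs. snd x = r})"
    using pq by (auto simp: sg)
  show "load_of gs r = (if r = p then load_of fs p + 1 else if r = q then load_of fs q - 1 else load_of fs r)"
    unfolding load_of_card[OF dg] load_of_card[OF df] g using nb x by auto
  have "card {(b, q)} \<le> card {x \<in> set fs. snd x = q}" using x by (intro card_mono) auto
  then show "load_of fs q \<ge> 1" unfolding load_of_card[OF df] by simp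
qed

text \<open>With \<open>l q = l p + 2 + d\<close> the sum drops by \<open>2 * d + 2\<close>.\<close>

lemma sum_square_move:
  fixes l l' :: "'a \<Rightarrow> nat"
  assumes "finite V" "p \<in> V" "q \<in> V" "p \<noteq> q" "l p + 2 \<le> l q"
    and "l' p = l p + 1" "l' q = l q - 1" "\<And>r. r \<noteq> p \<Longrightarrow> r \<noteq> q \<Longrightarrow> l' r = l r"
  shows "(\<Sum>r\<in>V. l' r * l' r) < (\<Sum>r\<in>V. l r * l r)"
proof -
  have split: "(\<Sum>r\<in>V. g r) = g p + (g q + (\<Sum>r\<in>V - {p} - {q}. g r))" for g :: "'a \<Rightarrow> nat"
    using assms(1-4) by (simp add: sum.remove[of V p] sum.remove[of "V - {p}" q])
  have rest: "(\<Sum>r\<in>V - {p} - {q}. l' r * l' r) = (\<Sum>r\<in>V - {p} - {q}. l r * l r)"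
    using assms(8) by (intro sum.cong) auto
  obtain d where d: "l q = l p + 2 + d" using assms(5) le_Suc_ex by blast
  show ?thesis unfolding split rest assms(6,7) d by (simp add: algebra_simps)
qed

lemma sum_load:
  assumes "distinct fs" "snd ` set fs \<subseteq> V" "finite V"
  shows "(\<Sum>p\<in>V. load_of fs p) = length fs"
proof -
  have "(\<Sum>p\<in>V. card {x \<in> set fs. snd x = p}) = card (\<Union>p\<in>V. {x \<in> set fs. snd x = p})"
    using assms(3) by (intro card_UN_disjoint[symmetric]) auto
  also have "(\<Union>p\<in>V. {x \<in> set fs. snd x = p}) = set fs" using assms(2) by auto
  finally show ?thesis using assms(1) by (simp add: load_of_card distinct_card)
qed

lemma balance_spec:
  assumes its: "distinct its" "length its \<le> length vs" "\<forall>b\<in>set its. (b, a) \<in> set es"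
    and a: "a \<in> set vs"
  defines "fs \<equiv> balance vs es its a"
  shows "map fst fs = its"
    and "x \<in> set fs \<Longrightarrow> x \<in> set es"
    and "snd ` set fs \<subseteq> set vs"
    and "x \<in> set fs \<Longrightarrow> (fst x, p) \<in> set es \<Longrightarrow> p \<in> set vs \<Longrightarrow> load_of fs (snd x) \<le> load_of fs p + 1"
proof -
  define P where "P = (\<lambda>fs. map fst fs = its \<and> set fs \<subseteq> set es \<and> snd ` set fs \<subseteq> set vs)"
  define \<Phi> where "\<Phi> = (\<lambda>fs. \<Sum>p\<in>set vs. load_of fs p * load_of fs p)"
  let ?i = "map (\<lambda>b. (b, a)) its"
  have step: "P (move vs es gs) \<and> (moves vs es gs \<noteq> [] \<longrightarrow> \<Phi> (move vs es gs) < \<Phi> gs)" if "P gs" for gs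
  proof (cases "moves vs es gs")
    case Nil
    then show ?thesis using that by (simp add: move_def)
  next
    case (Cons m ms)
    obtain b q p where m: "m = ((b, q), p)" by (metis prod.collapse)
    have "m \<in> set (moves vs es gs)" using Cons by simp
    then have mm: "(b, q) \<in> set gs" "p \<in> set vs" "(b, p) \<in> set es" "load_of gs p + 2 \<le> load_of gs q"
      by (auto simp: moves_def m)
    have pq: "p \<noteq> q" using mm by auto
    have mv: "move vs es gs = map (\<lambda>x. if x = (b, q) then (b, p) else x) gs"
      using Cons by (simp add: move_def m)
    have d: "distinct (map fst gs)" using that its by (simp add: P_def)
    note ld = load_of_move[OF d mm(1) pq, folded mv]
    have "P (move vs es gs)"
      using that mm move_fst[of vs es gs] unfolding P_def by (auto simp: mv)
    moreover have "\<Phi> (move vs es gs) < \<Phi> gs" unfolding \<Phi>_def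
    proof (rule sum_square_move[OF _ mm(2) _ pq mm(4)])
      show "q \<in> set vs" using that mm(1) by (auto simp: P_def)
    qed (use ld pq in auto)
    ultimately show ?thesis by simp
  qed
  have Pi: "P ?i" using its a by (auto simp: P_def comp_def)
  have "\<Phi> ?i \<le> length vs * length vs"
  proof -
    have di: "distinct ?i" using its(1) by (simp add: distinct_map inj_on_def)
    have le: "load_of ?i p \<le> length its" for p unfolding load_of_def
      using length_filter_le[of "\<lambda>x. snd x = p" ?i] by simp
    \<comment> \<open>Each load is at most \<open>length its\<close>, and the loads add up to
      \<open>length its\<close>.\<close>
    have "\<Phi> ?i \<le> (\<Sum>p\<in>set vs. load_of ?i p * length its)"
      unfolding \<Phi>_def using le by (intro sum_mono mult_left_mono) auto
    also have "\<dots> = length its * length its"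
      using sum_load[of ?i "set vs"] di a by (simp add: sum_distrib_right[symmetric] image_subset_iff)
    also have "\<dots> \<le> length vs * length vs" using its(2) by (intro mult_mono) auto
    finally show ?thesis .
  qed
  then have "P ((move vs es ^^ (length vs * length vs)) ?i) \<and> moves vs es ((move vs es ^^ (length vs * length vs)) ?i) = []"
    using step Pi by (intro funpow_stable[where P = P and \<Phi> = \<Phi>]) (auto simp: move_def)
  then have fs: "P fs" "moves vs es fs = []" by (auto simp: fs_def balance_def)
  then show "map fst fs = its" "x \<in> set fs \<Longrightarrow> x \<in> set es" "snd ` set fs \<subseteq> set vs" by (auto simp: P_def)
  show "load_of fs (snd x) \<le> load_of fs p + 1" if "x \<in> set fs" "(fst x, p) \<in> set es" "p \<in> set vs"
  proof (rule ccontr)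
    assume "\<not> ?thesis"
    then have "(x, p) \<in> set (moves vs es fs)" using that by (auto simp: moves_def)
    then show False using fs(2) by simp
  qed
qed

section \<open>The programs for balancing and keeping satisfy the abstract sparsification\<close>

locale edge_list_sparsification =
  fixes vs :: "nat list" and es :: edges and Bs :: "nat list" and T k :: nat
  assumes dv: "distinct vs" and dB: "distinct Bs" and Bv: "set Bs \<subseteq> set vs"
    and es_sym: "(u, v) \<in> set es \<Longrightarrow> (v, u) \<in> set es"
    and es_irr: "(u, u) \<notin> set es"
    and es_vs: "(u, v) \<in> set es \<Longrightarrow> u \<in> set vs"
    and B_indep: "b \<in> set Bs \<Longrightarrow> b' \<in> set Bs \<Longrightarrow> (b, b') \<notin> set es"
    and T_large: "16 * k < T * T"
begin

definition its :: "nat \<Rightarrow> nat list" where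
  "its a = filter (\<lambda>b. (a, b) \<in> set es) Bs"

definition fs :: "nat \<Rightarrow> edges" where
  "fs a = balance vs es (its a) a"

definition bin :: "nat \<Rightarrow> nat \<Rightarrow> nat" where
  "bin a b = the (map_of (fs a) b)"

definition kept_in :: "nat \<Rightarrow> nat \<Rightarrow> edges" where
  "kept_in a p = take (Suc T) (filter (\<lambda>x. snd x = p) (fs a))"

definition Kp :: "nat \<Rightarrow> nat \<Rightarrow> bool" where
  "Kp a b \<longleftrightarrow> a \<in> set vs \<and> a \<notin> set Bs \<and> b \<in> fst ` set (kept_in a (bin a b))"

lemma its_props: "distinct (its a)" "length (its a) \<le> length vs" "\<forall>b\<in>set (its a). (b, a) \<in> set es"
proof -
  show d: "distinct (its a)" using dB by (simp add: its_def)
  have "card (set (its a)) \<le> card (set vs)" using Bv by (intro card_mono) (auto simp: its_def)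
  then show "length (its a) \<le> length vs" using d dv by (simp add: distinct_card)
qed (auto simp: its_def dest: es_sym)

lemma
  assumes "a \<in> set vs"
  shows fs_fst: "map fst (fs a) = its a" and fs_es: "x \<in> set (fs a) \<Longrightarrow> x \<in> set es"
    and fs_vs: "snd ` set (fs a) \<subseteq> set vs"
    and fs_bal: "x \<in> set (fs a) \<Longrightarrow> (fst x, p) \<in> set es \<Longrightarrow> load_of (fs a) (snd x) \<le> load_of (fs a) p + 1"
proof -
  note B = balance_spec[OF its_props(1)[of a] its_props(2)[of a] its_props(3)[of a] assms, folded fs_def]
  show "map fst (fs a) = its a" by (rule B(1))
  show "x \<in> set (fs a) \<Longrightarrow> x \<in> set es" by (rule B(2))
  show "snd ` set (fs a) \<subseteq> set vs" by (rule B(3))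
  show "load_of (fs a) (snd x) \<le> load_of (fs a) p + 1" if "x \<in> set (fs a)" "(fst x, p) \<in> set es"
    using B(4)[OF that] es_vs[OF es_sym[OF that(2)]] by simp
qed

lemma distinct_fs: "a \<in> set vs \<Longrightarrow> distinct (map fst (fs a))"
  using fs_fst its_props(1) by simp

lemma mem_fs: "a \<in> set vs \<Longrightarrow> (b, p) \<in> set (fs a) \<longleftrightarrow> b \<in> set (its a) \<and> bin a b = p"
proof -
  assume a: "a \<in> set vs"
  have "fst ` set (fs a) = set (its a)" using fs_fst[OF a] by (metis set_map)
  then show ?thesis
    using distinct_fs[OF a] map_of_eq_Some_iff[of "fs a" b] map_of_eq_None_iff[of "fs a" b]
    by (force simp: bin_def)
qed

lemma load_fs: "a \<in> set vs \<Longrightarrow> card {b \<in> set Bs. (a, b) \<in> set es \<and> bin a b = p} = load_of (fs a) p"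
proof -
  assume a: "a \<in> set vs"
  have "{x \<in> set (fs a). snd x = p} = (\<lambda>b. (b, p)) ` {b \<in> set Bs. (a, b) \<in> set es \<and> bin a b = p}"
    using mem_fs[OF a] by (force simp: its_def)
  moreover have "distinct (fs a)" using distinct_fs[OF a] by (simp add: distinct_map)
  ultimately show ?thesis by (simp add: load_of_card card_image inj_on_def)
qed

lemma kept_in_fs: "x \<in> set (kept_in a p) \<Longrightarrow> x \<in> set (fs a) \<and> snd x = p"
  unfolding kept_in_def by (auto dest: in_set_takeD)

lemma kept_bin: "a \<in> set vs \<Longrightarrow> a \<notin> set Bs \<Longrightarrow> {b. Kp a b \<and> bin a b = p} = fst ` set (kept_in a p)"
proof
  assume a: "a \<in> set vs" "a \<notin> set Bs"
  show "{b. Kp a b \<and> bin a b = p} \<subseteq> fst ` set (kept_in a p)" by (auto simp: Kp_def)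
  show "fst ` set (kept_in a p) \<subseteq> {b. Kp a b \<and> bin a b = p}"
  proof
    fix b assume "b \<in> fst ` set (kept_in a p)"
    then have b: "(b, p) \<in> set (kept_in a p)" using kept_in_fs by force
    then have "bin a b = p" using kept_in_fs mem_fs[OF a(1)] by blast
    then show "b \<in> {b. Kp a b \<and> bin a b = p}" using a b by (force simp: Kp_def)
  qed
qed

lemma card_kept_bin: "a \<in> set vs \<Longrightarrow> a \<notin> set Bs \<Longrightarrow>
    card {b. Kp a b \<and> bin a b = p} = min (load_of (fs a) p) (Suc T)"
proof -
  assume a: "a \<in> set vs" "a \<notin> set Bs"
  have "distinct (map fst (filter (\<lambda>x. snd x = p) (fs a)))"
    using distinct_fs[OF a(1)] by (rule distinct_map_filter)
  then have "distinct (map fst (kept_in a p))"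
    unfolding kept_in_def by (simp only: take_map[symmetric] distinct_take)
  then have "card (set (map fst (kept_in a p))) = length (kept_in a p)" by (metis distinct_card length_map)
  then show ?thesis unfolding kept_bin[OF a] by (simp add: kept_in_def load_of_def min.commute)
qed

sublocale sparsification "edge_rel es" "set Bs" bin Kp T k
proof
  show "(v, u) \<in> set es" if "(u, v) \<in> set es" for u v using es_sym that .
  show "(u, u) \<notin> set es" for u by (rule es_irr)
  show "finite {b. (a, b) \<in> set es}" for a
    by (rule finite_subset[of _ "snd ` set es"]) force+
  show "(b, b') \<notin> set es" if "b \<in> set Bs" "b' \<in> set Bs" for b b' using B_indep that .
  fix a b assume ab: "a \<notin> set Bs" "b \<in> set Bs" "(a, b) \<in> set es"
  have a: "a \<in> set vs" using es_vs ab by blast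
  have m: "(b, bin a b) \<in> set (fs a)" using mem_fs[OF a] ab by (simp add: its_def)
  show "(b, bin a b) \<in> set es" using fs_es[OF a m] .
  show "card {b' \<in> set Bs. (a, b') \<in> set es \<and> bin a b' = bin a b}
      \<le> card {b' \<in> set Bs. (a, b') \<in> set es \<and> bin a b' = p} + 1" if "(b, p) \<in> set es" for p
    using fs_bal[OF a m] that by (simp add: load_fs[OF a])
  show "T + 2 \<le> card {b' \<in> set Bs. (a, b') \<in> set es \<and> bin a b' = bin a b}" if "\<not> Kp a b"
  proof (rule ccontr)
    assume "\<not> ?thesis"
    \<comment> \<open>\<open>take (Suc T)\<close> keeps a bin of at most \<open>T + 1\<close>
      entries entirely, so \<open>b\<close> would have been kept.\<close>
    then have "length (filter (\<lambda>x. snd x = bin a b) (fs a)) \<le> Suc T" by (simp add: load_fs[OF a] load_of_def)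
    then have "set (kept_in a (bin a b)) = {x \<in> set (fs a). snd x = bin a b}" by (simp add: kept_in_def)
    then show False using m that a ab by (force simp: Kp_def)
  qed
next
  fix a b assume K: "Kp a b"
  then have a: "a \<in> set vs" "a \<notin> set Bs" by (auto simp: Kp_def)
  obtain p where "(b, p) \<in> set (fs a)" using K kept_in_fs by (force simp: Kp_def)
  then show "a \<notin> set Bs \<and> b \<in> set Bs \<and> (a, b) \<in> set es" using a mem_fs[OF a(1)] by (simp add: its_def)
next
  fix a p assume a: "a \<notin> set Bs"
  show "min (card {b \<in> set Bs. (a, b) \<in> set es \<and> bin a b = p}) (T + 1) \<le> card {b. Kp a b \<and> bin a b = p}"
  proof (cases "a \<in> set vs")
    case True
    then show ?thesis using a by (simp add: load_fs card_kept_bin)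
  next
    case False
    then have "{b \<in> set Bs. (a, b) \<in> set es \<and> bin a b = p} = {}" using es_vs by auto
    then show ?thesis by (simp only: card.empty)
  qed
qed (rule T_large)

lemma card_kept_le: "card {b. Kp a b \<and> bin a b = p} \<le> T + 1"
proof (cases "a \<in> set vs \<and> a \<notin> set Bs")
  case True
  then show ?thesis by (simp add: card_kept_bin)
next
  case False
  then have "{b. Kp a b \<and> bin a b = p} = {}" by (auto simp: Kp_def)
  then show ?thesis by (simp only: card.empty)
qed

lemma set_kept: "set (kept vs es Bs T) = {(a, b, p). Kp a b \<and> p = bin a b}"
proof -
  have "(a, b, p) \<in> set (kept vs es Bs T) \<longleftrightarrow> Kp a b \<and> p = bin a b" for a b p
  proof
    assume "(a, b, p) \<in> set (kept vs es Bs T)"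
    then have a: "a \<in> set vs" "a \<notin> set Bs" and b: "b \<in> fst ` set (kept_in a p)"
      by (auto simp: kept_def kept_at_def kept_in_def fs_def its_def)
    then show "Kp a b \<and> p = bin a b" using kept_bin[OF a, of p] by auto
  next
    assume K: "Kp a b \<and> p = bin a b"
    then have a: "a \<in> set vs" "a \<notin> set Bs" and b: "b \<in> fst ` set (kept_in a p)" by (auto simp: Kp_def)
    then have "p \<in> set vs" using kept_in_fs fs_vs[OF a(1)] by force
    then show "(a, b, p) \<in> set (kept vs es Bs T)" using a b
      by (auto simp: kept_def kept_at_def kept_in_def fs_def its_def)
  qed
  then show ?thesis by auto
qed

lemma set_sparse: "(u, v) \<in> set (sparse vs es Bs T) \<longleftrightarrow> E' u v"
proof -
  have "(u, v) \<in> set (sparse vs es Bs T) \<longleftrightarrow> (u, v) \<in> set es \<and> u \<notin> set Bs \<and> v \<notin> set Bs \<or>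
      Kp u v \<or> Kp v u \<or> (\<exists>a. Kp a u \<and> bin a u = v) \<or> (\<exists>a. Kp a v \<and> bin a v = u)"
    unfolding sparse_def set_append set_concat set_map set_kept by auto
  moreover have "(u, v) \<in> set es" if "Kp u v \<or> Kp v u \<or> (\<exists>a. Kp a u \<and> bin a u = v) \<or> (\<exists>a. Kp a v \<and> bin a v = u)"
    using that Kp_E' Kp_bin_E' E'_E by blast
  ultimately show ?thesis unfolding E'_def by blast
qed

end

lemma threshold_square: "16 * k < threshold k * threshold k"
proof (rule ccontr)
  let ?S = "{t. t < 16 * k + 1 \<and> t * t \<le> 16 * k}"
  have T: "threshold k = card ?S"
    unfolding threshold_def by (subst distinct_length_filter) (auto intro: arg_cong[of _ _ card])
  assume "\<not> ?thesis"
  then have *: "threshold k * threshold k \<le> 16 * k" by simp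
  have "{..threshold k} \<subseteq> ?S"
  proof
    fix t assume "t \<in> {..threshold k}"
    then have "t * t \<le> threshold k * threshold k" by (intro mult_mono) auto
    moreover have "t \<le> t * t" by (cases t) auto
    ultimately have "t * t \<le> 16 * k" "t \<le> 16 * k" using * by linarith+
    then show "t \<in> ?S" by simp
  qed
  then have "card {..threshold k} \<le> card ?S" by (intro card_mono) auto
  then show False by (simp add: T)
qed

lemma threshold_le: "real (threshold k) \<le> 4 * sqrt (real k) + 1"
proof -
  let ?S = "{t. t < 16 * k + 1 \<and> t * t \<le> 16 * k}"
  have T: "threshold k = card ?S"
    unfolding threshold_def by (subst distinct_length_filter) (auto intro: arg_cong[of _ _ card])
  have "?S \<subseteq> {..nat \<lfloor>4 * sqrt (real k)\<rfloor>}"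
  proof
    fix t assume "t \<in> ?S"
    then have "real t ^ 2 \<le> 16 * real k" by (simp add: power2_eq_square flip: of_nat_mult)
    then have "real t \<le> sqrt (16 * real k)" by (simp add: real_le_rsqrt)
    also have "\<dots> = 4 * sqrt (real k)" using real_sqrt_mult[of 16 "real k"] by (simp add: real_sqrt_unique)
    finally show "t \<in> {..nat \<lfloor>4 * sqrt (real k)\<rfloor>}" by (simp add: le_nat_floor)
  qed
  then have "card ?S \<le> card {..nat \<lfloor>4 * sqrt (real k)\<rfloor>}" by (intro card_mono) auto
  then have "threshold k \<le> nat \<lfloor>4 * sqrt (real k)\<rfloor> + 1" by (simp add: T)
  then have "real (threshold k) \<le> real (nat \<lfloor>4 * sqrt (real k)\<rfloor>) + 1" by linarith
  also have "real (nat \<lfloor>4 * sqrt (real k)\<rfloor>) \<le> 4 * sqrt (real k)" by (simp add: of_nat_floor)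
  finally show ?thesis by simp
qed

text \<open>Serves two purposes: with the identity it is monotonicity in the edge relation, with an
  indexing map or its inverse it is the renumbering of vertices.\<close>

lemma has_packing_embed:
  assumes g: "inj_on g U" and E: "\<And>u v. E u v \<Longrightarrow> u \<in> U \<and> v \<in> U \<and> F (g u) (g v)"
    and "has_packing E k"
  shows "has_packing F k"
proof -
  obtain M where M: "packing E M" "card M = k" using assms(3) by (auto simp: has_packing_def)
  define h where "h = (\<lambda>(a, b, c, d). (g a, g b, g c, g d))"
  have qU: "qverts q \<subseteq> U" if "q \<in> M" for q
  proof -
    have "P4 E q" using M that by (simp add: packing_def)
    then show ?thesis using E by (cases q) auto
  qed
  have qh: "qverts (h q) = g ` qverts q" for q by (cases q) (auto simp: h_def)
  have p: "P4 F (h q)" if "q \<in> M" for q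
  proof -
    obtain a b c d where q: "q = (a, b, c, d)" by (metis prod_cases4)
    have "P4 E q" using M that by (simp add: packing_def)
    then show ?thesis using E qU[OF that] inj_on_eq_iff[OF g] by (auto simp: q h_def)
  qed
  have dis: "qverts (h q) \<inter> qverts (h r) = {}" if "q \<in> M" "r \<in> M" "q \<noteq> r" for q r
  proof -
    have "qverts q \<inter> qverts r = {}" using M that by (simp add: packing_def)
    then show ?thesis unfolding qh using inj_on_image_Int[OF g qU[OF that(1)] qU[OF that(2)]] by auto
  qed
  have "inj_on h M"
  proof (rule inj_onI, rule ccontr)
    fix q r assume "q \<in> M" "r \<in> M" "h q = h r" "q \<noteq> r"
    then show False using dis[of q r] by simp
  qed
  then have "card (h ` M) = k" using M by (simp add: card_image)
  moreover have "packing F (h ` M)"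
    unfolding packing_def
  proof (intro conjI ballI impI)
    show "finite (h ` M)" using M by (simp add: packing_def)
    show "P4 F q" if "q \<in> h ` M" for q using that p by blast
    show "qverts q \<inter> qverts r = {}" if qr: "q \<in> h ` M" "r \<in> h ` M" "q \<noteq> r" for q r
    proof -
      obtain q' r' where "q = h q'" "r = h r'" "q' \<in> M" "r' \<in> M" using qr by blast
      then show ?thesis using dis[of q' r'] qr(3) by blast
    qed
  qed
  ultimately show ?thesis by (auto simp: has_packing_def)
qed

section \<open>The list programs compute the sets of the abstract reduction\<close>

locale kernel_step =
  fixes vs :: "nat list" and es :: edges and k :: nat
  assumes dvs: "distinct vs"
    and esym: "(u, v) \<in> set es \<Longrightarrow> (v, u) \<in> set es"
    and eirr: "(u, u) \<notin> set es"
    and evs: "(u, v) \<in> set es \<Longrightarrow> u \<in> set vs"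
    and few: "\<not> 4 * k \<le> length (greedy vs es)"
begin

abbreviation A :: "nat list" where "A \<equiv> greedy vs es"

definition Rl :: "nat list" where "Rl = filter (\<lambda>v. v \<notin> set A) vs"
definition Cl :: "nat list" where "Cl = centers es Rl"
definition Bl :: "nat list" where "Bl = filter (\<lambda>v. v \<notin> set Cl) Rl"
definition Xl :: "nat list" where "Xl = rich es A Rl k"
definition es1 :: "edges" where "es1 = delete_vs es Xl"
definition es2 :: "edges" where "es2 = useful vs es1"
definition es3 :: "edges" where "es3 = sparse vs es2 Bl (threshold k)"

sublocale maximal_packing "edge_rel es" "set vs" "set A" k
proof
  show "card (set A) \<le> 4 * k" using card_length[of A] few by linarith
  fix q assume q: "P4 (edge_rel es) q"
  then have "qverts q \<subseteq> set vs" using evs esym by (cases q) auto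
  then show "qverts q \<inter> set A \<noteq> {}" using greedy_spec(4)[of es q vs] q by blast
next
  show "set A \<subseteq> set vs" by (rule greedy_spec(3))
qed (use esym eirr evs in auto)

lemma set_Rl: "set Rl = R"
  by (auto simp: Rl_def R_def)

lemma set_Cl: "set Cl = C"
  unfolding Cl_def centers_def C_def set_filter list_ex_iff list_all_iff set_Rl by blast

lemma set_Bl: "set Bl = B"
  unfolding Bl_def B_def set_filter set_Rl set_Cl by blast

lemma set_gam: "set (gam es Rl Cl s) = Gam s"
  unfolding gam_def Gam_def set_filter list_ex_iff set_Rl set_Cl by blast

lemma length_gam: "length (gam es Rl Cl s) = card (Gam s)"
proof -
  have "distinct (gam es Rl Cl s)" using dvs by (simp add: gam_def Cl_def centers_def Rl_def)
  then show ?thesis using distinct_card[of "gam es Rl Cl s"] by (simp only: set_gam)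
qed

lemma set_Xl: "set Xl = X"
  unfolding Xl_def rich_def X_def set_filter Cl_def[symmetric] length_gam by blast

lemma length_Xl: "length Xl = card X"
proof -
  have "distinct Xl" using greedy_spec(2)[of vs es] by (simp add: Xl_def rich_def)
  then show ?thesis using distinct_card[of Xl] by (simp only: set_Xl)
qed

lemma es1_iff: "edge_rel es1 = E1"
  by (intro ext) (auto simp: es1_def delete_vs_def set_Xl E1_def)

lemma es2_iff: "edge_rel es2 = E2"
proof (intro ext)
  fix u v
  show "edge_rel es2 u v \<longleftrightarrow> E2 u v"
  proof
    assume "edge_rel es2 u v"
    then obtain q where "path4 es1 q" "edge_of q (u, v)" unfolding es2_def useful_def by (auto simp: list_ex_iff)
    then show "E2 u v" unfolding path4_iff es1_iff E2_def edge_of_def by (cases q) auto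
  next
    assume e: "E2 u v"
    then obtain a b c d where q: "P4 E1 (a, b, c, d)"
      and uv: "(u, v) \<in> {(a, b), (b, a), (b, c), (c, b), (c, d), (d, c)}" unfolding E2_def by blast
    have "qverts (a, b, c, d) \<subseteq> set vs" using q evs esym by (auto simp: E1_def)
    then have "(a, b, c, d) \<in> set (quads vs)" by (simp only: set_quads)
    moreover have "path4 es1 (a, b, c, d)" using q by (simp only: path4_iff es1_iff)
    moreover have "edge_of (a, b, c, d) (u, v)" using uv by (auto simp: edge_of_def)
    moreover have "edge_rel es1 u v" using E2_E1[OF e] es1_iff by metis
    ultimately show "edge_rel es2 u v" unfolding es2_def useful_def by (auto simp: list_ex_iff)
  qed
qed

sublocale sp: edge_list_sparsification vs es2 Bl "threshold k" "k - card X"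
proof
  have i: "(u, v) \<in> set es2 \<longleftrightarrow> E2 u v" for u v using es2_iff by metis
  show "(v, u) \<in> set es2" if "(u, v) \<in> set es2" for u v using that E2_sym by (simp only: i)
  show "(u, u) \<notin> set es2" for u using E2_E irr by (simp only: i) blast
  show "u \<in> set vs" if "(u, v) \<in> set es2" for u v using that E2_E EV by (simp only: i) blast
  show "(b, b') \<notin> set es2" if "b \<in> set Bl" "b' \<in> set Bl" for b b'
    using that B_indep E2_E unfolding i set_Bl by blast
  \<comment> \<open>The threshold is computed from the original \<open>k\<close>, so it is large
    enough for the decreased parameter too.\<close>
  show "16 * (k - card X) < threshold k * threshold k" using threshold_square[of k] by linarith
qed (use dvs in \<open>auto simp: Bl_def Rl_def\<close>)

lemma es3_iff: "edge_rel es3 = sp.E'"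
  unfolding es3_def by (intro ext) (rule sp.set_sparse)

lemma es3_E2: "(u, v) \<in> set es3 \<Longrightarrow> E2 u v"
  using es3_iff es2_iff sp.E'_E by metis

lemma reduce_packing: "has_packing (edge_rel es3) (k - length Xl) \<longleftrightarrow> has_packing (edge_rel es) k"
proof
  assume "has_packing (edge_rel es3) (k - length Xl)"
  then have "has_packing E2 (k - card X)" unfolding length_Xl
    by (rule has_packing_embed[of id UNIV, rotated 2]) (simp_all add: es3_E2)
  then show "has_packing (edge_rel es) k" using has_packing_E2 delete_rich by blast
next
  assume "has_packing (edge_rel es) k"
  then have "has_packing E2 (k - card X)" using has_packing_E2 delete_rich by blast
  then show "has_packing (edge_rel es3) (k - length Xl)"
    unfolding length_Xl es3_iff by (intro sp.sparsified_packing) (simp only: es2_iff)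
qed

text \<open>The partners bound the bins in use: \<open>1024\<close> is the factor 4 of
  \<open>card_sparsified\<close> times the \<open>256\<close> of
  \<open>card_Partners\<close>.\<close>

lemma card_es3: "card (set es3) \<le> 400 * k\<^sup>2 + 1024 * k\<^sup>2 * (threshold k + 1)"
proof -
  have K: "(a, sp.bin a b) \<in> Partners" if "sp.Kp a b" for a b
  proof -
    have "a \<notin> B" "b \<in> B" "E2 a b" using sp.keep[OF that] es2_iff unfolding set_Bl by metis+
    moreover have "E2 b (sp.bin a b)" using sp.Kp_bin_E'(2)[OF that] sp.E'_E es2_iff by metis
    ultimately show ?thesis unfolding Partners_def by blast
  qed
  have S: "set es3 = {(u, v). sp.E' u v}" using es3_iff by (auto simp: fun_eq_iff)
  have O: "{(u, v). (u, v) \<in> set es2 \<and> u \<notin> set Bl \<and> v \<notin> set Bl} = {(u, v). E2 u v \<and> u \<notin> B \<and> v \<notin> B}"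
    using es2_iff unfolding set_Bl by metis
  have "finite {(u, v). (u, v) \<in> set es2 \<and> u \<notin> set Bl \<and> v \<notin> set Bl}"
    by (rule finite_subset[of _ "set es2"]) auto
  from sp.card_sparsified(2)[OF finite_Partners K sp.card_kept_le this]
  have "card (set es3) \<le> 400 * k\<^sup>2 + 4 * (card Partners * (threshold k + 1))"
    unfolding O S[symmetric] using card_outer_edges by linarith
  also have "4 * (card Partners * (threshold k + 1)) \<le> 4 * (256 * k\<^sup>2 * (threshold k + 1))"
    using card_Partners by (intro mult_left_mono mult_right_mono) auto
  finally show ?thesis by (simp add: algebra_simps)
qed

lemma es3_props: "(u, v) \<in> set es3 \<Longrightarrow> (v, u) \<in> set es3" "(u, u) \<notin> set es3" "(u, v) \<in> set es3 \<Longrightarrow> u \<in> set vs"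
proof -
  have i: "(u, v) \<in> set es3 \<longleftrightarrow> sp.E' u v" for u v using es3_iff by metis
  show "(u, v) \<in> set es3 \<Longrightarrow> (v, u) \<in> set es3" unfolding i by (rule sp.E'_sym)
  have e: "(u, v) \<in> set es" if "(u, v) \<in> set es3" for u v
    using that sp.E'_E[of u v] es2_iff E2_E unfolding i by metis
  show "(u, u) \<notin> set es3" using e eirr by blast
  show "(u, v) \<in> set es3 \<Longrightarrow> u \<in> set vs" using e evs by blast
qed

end

section \<open>Graphs and their encodings\<close>

definition edge_in :: "'a sgraph \<Rightarrow> 'a \<Rightarrow> 'a \<Rightarrow> bool" where
  "edge_in G u v \<longleftrightarrow> {u, v} \<in> edges G"

lemma path_graph_3: "path_graph 3 = \<lparr>verts = {0, 1, 2, 3}, edges = {{0, 1}, {1, 2}, {2, 3}}\<rparr>"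
proof -
  have "{{i, Suc i} | i. i < 3} = {{0, 1}, {1, 2}, {2, 3 :: nat}}"
  proof -
    have "{{i, Suc i} | i. i < 3} = (\<lambda>i. {i, Suc i}) ` {..<3}" by auto
    also have "{..<3 :: nat} = {0, 1, 2}" by auto
    finally show ?thesis by (simp add: numeral_3_eq_3 numeral_2_eq_2)
  qed
  moreover have "{0..3 :: nat} = {0, 1, 2, 3}" by auto
  ultimately show ?thesis by (simp add: path_graph_def)
qed

definition path_of :: "'a quad \<Rightarrow> 'a sgraph" where
  "path_of q = (case q of (a, b, c, d) \<Rightarrow> \<lparr>verts = {a, b, c, d}, edges = {{a, b}, {b, c}, {c, d}}\<rparr>)"

lemma verts_path_of [simp]: "verts (path_of q) = qverts q"
  by (cases q) (simp add: path_of_def)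

lemma path_of_P3:
  assumes "P4 (edge_in G) q" "simple_graph G"
  shows "subgraph_of (path_of q) G \<and> isomorphic (path_graph 3) (path_of q)"
proof -
  obtain a b c d where q: "q = (a, b, c, d)" by (metis prod_cases4)
  have ne: "distinct [a, b, c, d]" and e: "{a, b} \<in> edges G" "{b, c} \<in> edges G" "{c, d} \<in> edges G"
    using assms(1) by (auto simp: q edge_in_def)
  have v: "{a, b} \<subseteq> verts G" "{b, c} \<subseteq> verts G" "{c, d} \<subseteq> verts G"
    using e assms(2) by (auto simp: simple_graph_def)
  have "simple_graph (path_of q)" using ne by (auto simp: simple_graph_def path_of_def q)
  then have "subgraph_of (path_of q) G" using e v by (auto simp: subgraph_of_def path_of_def q)
  moreover have "isomorphic (path_graph 3) (path_of q)"
    unfolding isomorphic_def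
  proof (intro exI conjI)
    let ?f = "\<lambda>i::nat. if i = 0 then a else if i = 1 then b else if i = 2 then c else d"
    show "bij_betw ?f (verts (path_graph 3)) (verts (path_of q))"
      using ne by (auto simp: bij_betw_def inj_on_def path_graph_3 path_of_def q)
    show "edges (path_of q) = (\<lambda>e. ?f ` e) ` edges (path_graph 3)"
      by (simp add: path_graph_3 path_of_def q insert_commute[of b a "{}"] insert_commute[of c b "{}"]
        insert_commute[of d c "{}"])
  qed
  ultimately show ?thesis ..
qed

lemma P3_path_of:
  assumes "subgraph_of H G" "isomorphic (path_graph 3) H"
  shows "\<exists>q. P4 (edge_in G) q \<and> qverts q = verts H"
proof -
  obtain f :: "nat \<Rightarrow> 'a" where f: "bij_betw f {0, 1, 2, 3} (verts H)" "edges H = (\<lambda>e. f ` e) ` {{0, 1}, {1, 2}, {2, 3}}"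
    using assms(2) by (auto simp: isomorphic_def path_graph_3)
  have E: "edges H \<subseteq> edges G" using assms(1) by (simp add: subgraph_of_def)
  have "distinct [f 0, f 1, f 2, f 3]" using f(1) by (auto simp: bij_betw_def inj_on_def)
  moreover have "edge_in G (f 0) (f 1)" "edge_in G (f 1) (f 2)" "edge_in G (f 2) (f 3)"
    using f(2) E by (auto simp: edge_in_def)
  moreover have "qverts (f 0, f 1, f 2, f 3) = verts H" using f(1) by (auto simp: bij_betw_def)
  ultimately show ?thesis by (metis P4.simps)
qed

text \<open>A quadruple and its reversal describe the same subgraph, so the correspondence is not
  bijective. On a packing it is injective in either direction all the same, because the vertex sets
  are disjoint and nonempty.\<close>

lemma graph_matching_iff:
  assumes G: "simple_graph G"
  shows "graph_matching (path_graph 3) (G, k) \<longleftrightarrow> has_packing (edge_in G) k"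
proof
  assume "graph_matching (path_graph 3) (G, k)"
  then obtain M where M: "finite M" "card M = k" "\<And>H. H \<in> M \<Longrightarrow> subgraph_of H G \<and> isomorphic (path_graph 3) H"
    and dis: "pairwise (\<lambda>H H'. disjnt (verts H) (verts H')) M" by (auto simp: graph_matching_def)
  have "\<forall>H\<in>M. \<exists>q. P4 (edge_in G) q \<and> qverts q = verts H" using M(3) P3_path_of by blast
  from bchoice[OF this] obtain g where g: "\<forall>H\<in>M. P4 (edge_in G) (g H) \<and> qverts (g H) = verts H" ..
  have d: "qverts (g H) \<inter> qverts (g H') = {}" if "H \<in> M" "H' \<in> M" "H \<noteq> H'" for H H'
    using dis g that by (auto simp: pairwise_def disjnt_def)
  have "inj_on g M"
  proof (rule inj_onI, rule ccontr)
    fix H H' assume "H \<in> M" "H' \<in> M" "g H = g H'" "H \<noteq> H'"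
    then show False using d[of H H'] by simp
  qed
  then have "card (g ` M) = k" using M by (simp add: card_image)
  moreover have "packing (edge_in G) (g ` M)"
    unfolding packing_def
  proof (intro conjI ballI impI)
    show "finite (g ` M)" using M by simp
    show "P4 (edge_in G) q" if "q \<in> g ` M" for q using that g by auto
    show "qverts q \<inter> qverts r = {}" if qr: "q \<in> g ` M" "r \<in> g ` M" "q \<noteq> r" for q r
    proof -
      obtain H H' where "q = g H" "r = g H'" "H \<in> M" "H' \<in> M" using qr by blast
      then show ?thesis using d[of H H'] qr(3) by blast
    qed
  qed
  ultimately show "has_packing (edge_in G) k" by (auto simp: has_packing_def)
next
  assume "has_packing (edge_in G) k"
  then obtain M where M: "packing (edge_in G) M" "card M = k" by (auto simp: has_packing_def)
  have d: "qverts q \<inter> qverts r = {}" if "q \<in> M" "r \<in> M" "q \<noteq> r" for q r using M that by (simp add: packing_def)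
  have "inj_on path_of M"
  proof (rule inj_onI, rule ccontr)
    fix q r assume *: "q \<in> M" "r \<in> M" "path_of q = path_of r" "q \<noteq> r"
    then have "qverts q = qverts r" by (metis verts_path_of)
    then show False using d[of q r] * by simp
  qed
  then have c: "card (path_of ` M) = k" using M by (simp add: card_image)
  show "graph_matching (path_graph 3) (G, k)"
    unfolding graph_matching_def case_prod_conv
  proof (intro exI[of _ "path_of ` M"] conjI ballI c)
    show "finite (path_of ` M)" using M by (simp add: packing_def)
    have "subgraph_of H G \<and> isomorphic (path_graph 3) H" if "H \<in> path_of ` M" for H
      using that path_of_P3[OF _ G] M by (auto simp: packing_def)
    then show "subgraph_of H G" "isomorphic (path_graph 3) H" if "H \<in> path_of ` M" for H
      using that by blast+
    show "pairwise (\<lambda>H H'. disjnt (verts H) (verts H')) (path_of ` M)"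
    proof (rule pairwiseI)
      fix H H' assume *: "H \<in> path_of ` M" "H' \<in> path_of ` M" "H \<noteq> H'"
      then obtain q r where "q \<in> M" "r \<in> M" "H = path_of q" "H' = path_of r" by blast
      then show "disjnt (verts H) (verts H')" using d[of q r] * by (auto simp: disjnt_def)
    qed
  qed
qed

section \<open>Adjacency matrices and binary numbers as data\<close>

definition matrix_of :: "nat sgraph \<Rightarrow> bool list list" where
  "matrix_of G = (let n = card (verts G) in map (\<lambda>u. map (\<lambda>v. {u, v} \<in> edges G) [0..<n]) [0..<n])"

definition graph_of :: "bool list list \<Rightarrow> nat sgraph" where
  "graph_of m = \<lparr>verts = {..<length m}, edges = {{i, j} | i j. i < length m \<and> j < length m \<and> m ! i ! j}\<rparr>"

fun bits_of :: "nat \<Rightarrow> bool list" where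
  "bits_of n = (if n = 0 then [] else odd n # bits_of (n div 2))"

declare bits_of.simps [simp del]

fun val :: "bool list \<Rightarrow> nat" where
  "val [] = 0"
| "val (b # bs) = (if b then 1 else 0) + 2 * val bs"

lemma val_bits_of: "val (bits_of n) = n"
proof (induction n rule: bits_of.induct)
  case (1 n)
  then show ?case by (subst bits_of.simps) (auto simp: odd_two_times_div_two_succ)
qed

lemma enc_nat_bits: "enc_nat n = encode (bits_of n)"
proof (induction n rule: bits_of.induct)
  case (1 n)
  then show ?case by (subst bits_of.simps, subst enc_nat.simps) (auto simp: encode_bool_def)
qed

lemma enc_graph_matrix: "enc_graph G = encode (matrix_of G)"
  by (simp add: enc_graph_def matrix_of_def Let_def encode_list_def encode_bool_def comp_def)

lemma enc_instance_encode: "enc_instance (G, k) = encode (matrix_of G, bits_of k)"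
  by (simp add: enc_graph_matrix enc_nat_bits)

lemma incr_False: "incr False bs = bs"
  by (induction bs) auto

lemma incr_bits: "incr True (bits_of n) = bits_of (Suc n)"
proof (induction n rule: bits_of.induct)
  case (1 n)
  show ?case
  proof (cases "n = 0")
    case True
    then show ?thesis by (simp add: bits_of.simps)
  next
    case False
    show ?thesis
    proof (cases "odd n")
      case True
      then have "Suc n div 2 = Suc (n div 2)" by simp
      then show ?thesis using 1 False True
        by (subst bits_of.simps, subst (2) bits_of.simps) simp
    next
      case even: False
      then have "Suc n div 2 = n div 2" by simp
      then show ?thesis using 1 False even
        by (subst bits_of.simps, subst (2) bits_of.simps) (simp add: incr_False)
    qed
  qed
qed

lemma to_bits_bits_of: "to_bits n = bits_of n"
  by (induction n) (simp_all add: to_bits_def incr_bits, simp add: bits_of.simps)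

lemma capped_val: "capped_val n bs = min (Suc n) (val bs)"
proof -
  let ?f = "\<lambda>a b. if Suc n \<le> a + a + (if b then 1 else 0) then Suc n else a + a + (if b then 1 else 0)"
  have "foldl ?f 0 (rev bs) = min (Suc n) (val bs)"
    by (induction bs) auto
  then show ?thesis by (simp add: capped_val_def)
qed

lemma nthd_nth: "i < length xs \<Longrightarrow> nthd d xs i = xs ! i"
  by (simp add: nthd_def Cons_nth_drop_Suc[symmetric])

lemma matrix_of_nth: "u < card (verts G) \<Longrightarrow> v < card (verts G) \<Longrightarrow> matrix_of G ! u ! v \<longleftrightarrow> {u, v} \<in> edges G"
  by (simp add: matrix_of_def Let_def)

lemma length_matrix_of: "length (matrix_of G) = card (verts G)" "u < card (verts G) \<Longrightarrow> length (matrix_of G ! u) = card (verts G)"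
  by (simp_all add: matrix_of_def Let_def)

lemma edge_list_matrix:
  assumes "simple_graph G" "verts G = {..<n}"
  shows "(u, v) \<in> set (edge_list (matrix_of G)) \<longleftrightarrow> edge_in G u v"
proof -
  have n: "card (verts G) = n" using assms(2) by simp
  have "(u, v) \<in> set (edge_list (matrix_of G)) \<longleftrightarrow> u < n \<and> v < n \<and> {u, v} \<in> edges G"
    by (auto simp: edge_list_def length_matrix_of n nthd_nth matrix_of_nth)
  moreover have "u < n \<and> v < n" if "{u, v} \<in> edges G" using that assms by (auto simp: simple_graph_def)
  ultimately show ?thesis by (auto simp: edge_in_def)
qed

text \<open>These are the adjacency matrices of simple graphs, for which \<open>matrix_of\<close>
  undoes \<open>graph_of\<close>.\<close>

definition valid_matrix :: "bool list list \<Rightarrow> bool" where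
  "valid_matrix m \<longleftrightarrow> (\<forall>i<length m. length (m ! i) = length m \<and> \<not> m ! i ! i) \<and>
     (\<forall>i<length m. \<forall>j<length m. m ! i ! j \<longrightarrow> m ! j ! i)"

lemma edge_in_graph_of:
  "valid_matrix m \<Longrightarrow> edge_in (graph_of m) u v \<longleftrightarrow> u < length m \<and> v < length m \<and> m ! u ! v"
  by (auto simp: edge_in_def graph_of_def valid_matrix_def doubleton_eq_iff)

lemma graph_of_instance: "valid_matrix m \<Longrightarrow> (graph_of m, k) \<in> instances"
  by (auto simp: instances_def simple_graph_def graph_of_def valid_matrix_def card_2_iff) blast+

lemma matrix_of_graph_of:
  assumes m: "valid_matrix m" shows "matrix_of (graph_of m) = m"
proof -
  have c: "card (verts (graph_of m)) = length m" by (simp add: graph_of_def)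
  show ?thesis
  proof (rule nth_equalityI)
    show "length (matrix_of (graph_of m)) = length m" by (simp add: length_matrix_of c)
    fix i assume "i < length (matrix_of (graph_of m))"
    then have i: "i < length m" by (simp add: length_matrix_of c)
    show "matrix_of (graph_of m) ! i = m ! i"
    proof (rule nth_equalityI)
      show "length (matrix_of (graph_of m) ! i) = length (m ! i)"
        using i m by (simp add: length_matrix_of c valid_matrix_def)
      fix j assume "j < length (matrix_of (graph_of m) ! i)"
      then have j: "j < length m" using i by (simp add: length_matrix_of c)
      show "matrix_of (graph_of m) ! i ! j = m ! i ! j"
        using i j edge_in_graph_of[OF m, of i j] by (simp add: matrix_of_nth c edge_in_def)
    qed
  qed
qed

context
  fixes vs :: "nat list" and es :: edges
  assumes dvs: "distinct vs" and sym: "\<And>u v. (u, v) \<in> set es \<Longrightarrow> (v, u) \<in> set es"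
    and irr: "\<And>u. (u, u) \<notin> set es" and es_vs: "\<And>u v. (u, v) \<in> set es \<Longrightarrow> u \<in> set vs"
begin

private definition W :: "nat list" where
  "W = filter (\<lambda>v. list_ex (\<lambda>p. fst p = v) es) vs"

private lemma set_W: "set W = fst ` set es"
  using es_vs by (force simp: W_def list_ex_iff)

private lemma distinct_W: "distinct W"
  using dvs by (simp add: W_def)

private lemma restrict_W: "restrict_matrix vs es = map (\<lambda>u. map (\<lambda>v. (u, v) \<in> set es) W) W"
  by (simp add: restrict_matrix_def W_def Let_def)

private lemma restrict_nth: "i < length W \<Longrightarrow> j < length W \<Longrightarrow> restrict_matrix vs es ! i ! j \<longleftrightarrow> (W ! i, W ! j) \<in> set es"
  by (simp add: restrict_W)

lemma valid_restrict: "valid_matrix (restrict_matrix vs es)"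
  using sym irr by (auto simp: valid_matrix_def restrict_nth) (auto simp: restrict_W)

lemma length_restrict: "length (restrict_matrix vs es) \<le> card (set es)"
proof -
  have "length W = card (fst ` set es)" using distinct_W set_W by (metis distinct_card)
  then show ?thesis using card_image_le[of "set es" fst] by (simp add: restrict_W)
qed

lemma restrict_edge: "edge_in (graph_of (restrict_matrix vs es)) i j \<longleftrightarrow>
    i < length W \<and> j < length W \<and> (W ! i, W ! j) \<in> set es"
proof -
  have "length (restrict_matrix vs es) = length W" by (simp add: restrict_W)
  then show ?thesis unfolding edge_in_graph_of[OF valid_restrict] using restrict_nth by auto
qed

lemma restrict_packing: "has_packing (edge_in (graph_of (restrict_matrix vs es))) k \<longleftrightarrow> has_packing (edge_rel es) k"
proof
  let ?g = "\<lambda>i. W ! i" and ?U = "{..<length W}"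
  have inj: "inj_on ?g ?U" using distinct_W by (auto simp: inj_on_def nth_eq_iff_index_eq)
  have img: "?g ` ?U = set W" by (auto simp: set_conv_nth)
  show "has_packing (edge_rel es) k" if "has_packing (edge_in (graph_of (restrict_matrix vs es))) k"
    by (rule has_packing_embed[OF inj _ that]) (auto simp: restrict_edge)
  show "has_packing (edge_in (graph_of (restrict_matrix vs es))) k" if "has_packing (edge_rel es) k"
  proof (rule has_packing_embed[OF _ _ that])
    show "inj_on (inv_into ?U ?g) (set W)" using inj_on_inv_into[of "set W" ?g ?U] img by simp
    fix u v assume e: "(u, v) \<in> set es"
    then have uv: "u \<in> set W" "v \<in> set W" using sym set_W by force+
    then have "inv_into ?U ?g u \<in> ?U" "?g (inv_into ?U ?g u) = u" "inv_into ?U ?g v \<in> ?U" "?g (inv_into ?U ?g v) = v"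
      using img by (metis inv_into_into f_inv_into_f)+
    then show "u \<in> set W \<and> v \<in> set W \<and> edge_in (graph_of (restrict_matrix vs es)) (inv_into ?U ?g u) (inv_into ?U ?g v)"
      using uv e by (simp add: restrict_edge)
  qed
qed

lemma card_edges_restrict: "card (edges (graph_of (restrict_matrix vs es))) \<le> card (set es)"
proof -
  let ?P = "{(i, j). edge_in (graph_of (restrict_matrix vs es)) i j}"
  have P: "?P = {(i, j). i < length W \<and> j < length W \<and> (W ! i, W ! j) \<in> set es}"
    unfolding restrict_edge ..
  have inj: "inj_on (\<lambda>(i, j). (W ! i, W ! j)) ?P"
    unfolding P using distinct_W by (auto simp: inj_on_def nth_eq_iff_index_eq)
  have "card ?P \<le> card (set es)"
    by (rule card_inj_on_le[OF inj]) (auto simp: P)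
  moreover have "finite ?P" unfolding P by (rule finite_subset[of _ "{..<length W} \<times> {..<length W}"]) auto
  moreover have "edges (graph_of (restrict_matrix vs es)) \<subseteq> (\<lambda>(i, j). {i, j}) ` ?P"
    by (auto simp: graph_of_def edge_in_def)
  ultimately show ?thesis by (meson card_image_le card_mono finite_imageI order_trans)
qed

end

lemma esize_bool_le: "esize (b :: bool) \<le> 3"
  by (cases b) auto

lemma esize_bools: "esize (bs :: bool list) \<le> 1 + length bs * 4"
  using esize_list_le[of bs 3] esize_bool_le by simp

lemma esize_valid_matrix: "valid_matrix m \<Longrightarrow> esize m \<le> 1 + length m * (2 + length m * 4)"
proof -
  assume m: "valid_matrix m"
  have "esize r \<le> 1 + length m * 4" if "r \<in> set m" for r
  proof -
    have "length r = length m" using that m by (auto simp: in_set_conv_nth valid_matrix_def)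
    then show ?thesis using esize_bools[of r] by simp
  qed
  from esize_list_le[of m, OF this] show ?thesis by (simp add: algebra_simps)
qed

lemma length_bits_of: "length (bits_of n) \<le> n"
proof (induction n rule: bits_of.induct)
  case (1 n)
  show ?case
  proof (cases "n = 0")
    case False
    then have "length (bits_of n) = Suc (length (bits_of (n div 2)))" by (subst bits_of.simps) simp
    also have "\<dots> \<le> Suc (n div 2)" using 1 False by simp
    also have "\<dots> \<le> n" using False by linarith
    finally show ?thesis .
  qed (simp add: bits_of.simps)
qed

section \<open>Assembling the kernelization\<close>

definition edge_bound :: "nat \<Rightarrow> nat" where
  "edge_bound k = 400 * k\<^sup>2 + 1024 * k\<^sup>2 * (threshold k + 1)"

text \<open>The valid matrix and the canonical bit list guarantee that decoding the output and
  encoding it again returns the tree that the program has computed. The bounds on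
  \<open>val bs\<close> and \<open>length m\<close> yield a size depending on \<open>k\<close>
  alone.\<close>

lemma kernel_correct:
  assumes "(G, k) \<in> instances" and m: "kernel (matrix_of G, bits_of k) = (m, bs)"
  shows "valid_matrix m" "bs = bits_of (val bs)" "val bs \<le> k + 1"
    "has_packing (edge_in (graph_of m)) (val bs) \<longleftrightarrow> has_packing (edge_in G) k"
    "length m \<le> edge_bound k" "card (edges (graph_of m)) \<le> edge_bound k"
proof -
  obtain n where G: "simple_graph G" "verts G = {..<n}" using assms(1) by (auto simp: instances_def)
  define es where "es = edge_list (matrix_of G)"
  define vs where "vs = [0..<n]"
  let ?A = "greedy vs es"
  have n: "length (matrix_of G) = n" using G by (simp add: length_matrix_of)
  have c: "capped_val n (bits_of k) = min (Suc n) k" by (simp add: capped_val val_bits_of)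
  have e: "(u, v) \<in> set es \<longleftrightarrow> edge_in G u v" for u v unfolding es_def by (rule edge_list_matrix[OF G])
  then have er: "edge_rel es = edge_in G" by blast
  have sym: "(u, v) \<in> set es \<Longrightarrow> (v, u) \<in> set es" for u v unfolding e by (simp add: edge_in_def insert_commute)
  have irr: "(u, u) \<notin> set es" for u unfolding e using G by (auto simp: edge_in_def simple_graph_def)
  have evs: "(u, v) \<in> set es \<Longrightarrow> u \<in> set vs" for u v
    unfolding e using G by (auto simp: edge_in_def simple_graph_def vs_def)
  have empty: "valid_matrix []" "graph_of [] = \<lparr>verts = {}, edges = {}\<rparr>"
    by (auto simp: valid_matrix_def graph_of_def)
  have K: "kernel (matrix_of G, bits_of k) = (if \<not> k \<le> n then ([], [True])
      else if 4 * k \<le> length ?A then ([], []) else reduce vs es ?A k)"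
    by (auto simp: kernel_def Let_def n c es_def vs_def min_def)
  have small: "k \<le> n" if hp: "has_packing (edge_in G) k"
  proof -
    obtain M where M: "packing (edge_rel es) M" "card M = k" 
      using hp unfolding er[symmetric] has_packing_def by blast
    have fin: "finite M" using M by (simp add: packing_def)
    have "covered M \<subseteq> set vs"
    proof
      fix v assume "v \<in> covered M"
      then obtain q where q: "q \<in> M" "v \<in> qverts q" by (auto simp: covered_def)
      then have "P4 (edge_rel es) q" using M by (simp add: packing_def)
      then show "v \<in> set vs" using q evs sym by (cases q) auto
    qed
    \<comment> \<open>Counting a single vertex per path is crude, but it is all that the cut-off at
      \<open>n + 1\<close> requires.\<close>
    have "k \<le> (\<Sum>q\<in>M. card (qverts q))"
      using sum_bounded_below[of M 1 "\<lambda>q. card (qverts q)"] M(2) by (simp add: Suc_le_eq card_gt_0_iff)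
    also have "\<dots> = card (covered M)" unfolding covered_def using M fin
      by (intro card_UN_disjoint[symmetric]) (simp_all add: packing_def)
    also have "\<dots> \<le> card (set vs)" using \<open>covered M \<subseteq> set vs\<close> by (intro card_mono) auto
    finally show ?thesis by (simp add: vs_def)
  qed
  consider (no) "\<not> k \<le> n" | (yes) "k \<le> n" "4 * k \<le> length ?A" | (red) "k \<le> n" "\<not> 4 * k \<le> length ?A" by blast
  then have "valid_matrix m \<and> bs = bits_of (val bs) \<and> val bs \<le> k + 1 \<and>
    (has_packing (edge_in (graph_of m)) (val bs) \<longleftrightarrow> has_packing (edge_in G) k) \<and>
    length m \<le> edge_bound k \<and> card (edges (graph_of m)) \<le> edge_bound k"
  proof cases
    case no
    then have mb: "m = []" "bs = [True]" using m K by auto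
    have "\<not> has_packing (edge_in (graph_of [])) 1"
      unfolding empty has_packing_def packing_def by (auto simp: card_1_singleton_iff edge_in_def)
    then show ?thesis using no small by (auto simp: mb empty bits_of.simps)
  next
    case yes
    then have mb: "m = []" "bs = []" using m K by auto
    obtain M where M: "packing (edge_rel es) M" "length ?A = 4 * card M" using greedy_spec(1) by blast
    then have "has_packing (edge_in G) (card M)" by (auto simp: has_packing_def er)
    then have "has_packing (edge_in G) k" by (rule has_packing_mono) (use M yes in auto)
    moreover have "has_packing E 0" for E :: "nat \<Rightarrow> nat \<Rightarrow> bool"
      unfolding has_packing_def packing_def by (rule exI[of _ "{}"]) simp
    ultimately show ?thesis by (simp add: mb empty bits_of.simps)
  next
    case red
    interpret kernel_step vs es k
      by unfold_locales (use sym irr evs red in \<open>auto simp: vs_def\<close>)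
    have mb: "m = restrict_matrix vs es3" "bs = bits_of (k - length Xl)"
      using m K red by (auto simp: reduce_def Let_def to_bits_bits_of es3_def es2_def es1_def Bl_def Xl_def Cl_def Rl_def)
    have dv: "distinct vs" by (simp add: vs_def)
    note p = es3_props
    have "valid_matrix m" unfolding mb by (rule valid_restrict[OF dv p])
    moreover have "has_packing (edge_in (graph_of m)) (val bs) \<longleftrightarrow> has_packing (edge_in G) k"
      using restrict_packing[OF dv p] reduce_packing by (simp only: mb val_bits_of er)
    moreover have "length m \<le> edge_bound k"
      unfolding mb edge_bound_def by (rule order_trans[OF length_restrict[OF dv p] card_es3])
    moreover have "card (edges (graph_of m)) \<le> edge_bound k"
      unfolding mb edge_bound_def by (rule order_trans[OF card_edges_restrict[OF dv p] card_es3])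
    ultimately show ?thesis by (simp add: mb val_bits_of)
  qed
  then show "valid_matrix m" "bs = bits_of (val bs)" "val bs \<le> k + 1"
    "has_packing (edge_in (graph_of m)) (val bs) \<longleftrightarrow> has_packing (edge_in G) k"
    "length m \<le> edge_bound k" "card (edges (graph_of m)) \<le> edge_bound k" by blast+
qed

definition kernelize :: "nat sgraph \<times> nat \<Rightarrow> nat sgraph \<times> nat" where
  "kernelize x = (let r = kernel (matrix_of (fst x), bits_of (snd x)) in (graph_of (fst r), val (snd r)))"

lemma kernelize_cases:
  assumes "(G, k) \<in> instances"
  obtains m bs where "kernel (matrix_of G, bits_of k) = (m, bs)" "kernelize (G, k) = (graph_of m, val bs)"
  by (cases "kernel (matrix_of G, bits_of k)") (auto simp: kernelize_def)

lemma enc_kernelize: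
  assumes "(G, k) \<in> instances"
  shows "enc_instance (kernelize (G, k)) = encode (kernel (matrix_of G, bits_of k))"
proof -
  obtain m bs where r: "kernel (matrix_of G, bits_of k) = (m, bs)" "kernelize (G, k) = (graph_of m, val bs)"
    using kernelize_cases[OF assms] by blast
  show ?thesis using kernel_correct(1,2)[OF assms r(1)]
    unfolding r enc_instance_encode by (simp add: matrix_of_graph_of)
qed

lemma kernelize_polytime: "polytime_computable_on instances enc_instance enc_instance kernelize"
proof -
  obtain g where g: "ptime_on (range (encode :: bool list list \<times> bool list \<Rightarrow> data)) g" "\<And>x. g (encode x) = encode (kernel x)"
    using ptime_kernel by (rule ptimeE) blast
  obtain c N p where c: "computes (range (encode :: bool list list \<times> bool list \<Rightarrow> data)) c N p g"
    using g(1) unfolding ptime_on_def by blast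
  show ?thesis
    unfolding polytime_computable_on_def
  proof (rule exI[of _ c], rule exI[of _ p], rule ballI)
    fix x assume x: "x \<in> instances"
    obtain G k where Gk: "x = (G, k)" by (cases x)
    let ?y = "(matrix_of G, bits_of k)"
    have ex: "enc_instance x = encode ?y" by (simp only: Gk enc_instance_encode)
    have "\<exists>t s'. exec c ((\<lambda>_. Nl)(0 := encode ?y)) t s' \<and> t \<le> poly p (dsize (encode ?y))
        \<and> s' 0 = g (encode ?y) \<and> dsize (g (encode ?y)) \<le> poly p (dsize (encode ?y))
        \<and> (\<forall>v\<ge>N. s' v = ((\<lambda>_. Nl)(0 := encode ?y)) v)"
      by (rule computesD[OF c _ rangeI]) simp
    then obtain t s' where "exec c ((\<lambda>_. Nl)(0 := encode ?y)) t s'" "t \<le> poly p (dsize (encode ?y))"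
      "s' 0 = g (encode ?y)" by blast
    then show "\<exists>t. t \<le> poly p (dsize (enc_instance x)) \<and> runs c (enc_instance x) t (enc_instance (kernelize x))"
      unfolding ex runs_def using g(2)[of ?y] enc_kernelize x Gk by auto
  qed
qed

text \<open>For positive \<open>k\<close>, \<open>threshold k + 1\<close> is at most
  \<open>4 * sqrt k + 2\<close> and thus at most \<open>6 * sqrt k\<close>; the constant is
  \<open>400 + 1024 * 6\<close>.\<close>

lemma edge_bound_real: "k > 0 \<Longrightarrow> real (edge_bound k) \<le> 6544 * real k powr (5 / 2)"
proof -
  assume k: "k > 0"
  have p: "real k powr (5 / 2) = (real k)\<^sup>2 * sqrt (real k)"
  proof -
    have "real k powr (5 / 2) = real k powr (2 + 1 / 2)" by simp
    also have "\<dots> = real k powr 2 * real k powr (1 / 2)" by (rule powr_add)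
    finally show ?thesis using k by (simp add: powr_half_sqrt)
  qed
  have s: "1 \<le> sqrt (real k)" using k by simp
  have "real (threshold k) + 1 \<le> 6 * sqrt (real k)" using threshold_le[of k] s by linarith
  then have "(real k)\<^sup>2 * (real (threshold k) + 1) \<le> (real k)\<^sup>2 * (6 * sqrt (real k))"
    by (rule mult_left_mono) simp
  moreover have "(real k)\<^sup>2 * 1 \<le> (real k)\<^sup>2 * sqrt (real k)" using s by (rule mult_left_mono) simp
  moreover have "real (edge_bound k) = 400 * (real k)\<^sup>2 + 1024 * ((real k)\<^sup>2 * (real (threshold k) + 1))"
    by (simp add: edge_bound_def algebra_simps)
  ultimately show ?thesis unfolding p by linarith
qed

theorem theorem5:
  "has_kernels_with_edges (graph_matching (path_graph 3)) (\<lambda>k. real k powr (5 / 2))"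
  unfolding has_kernels_with_edges_def
proof (intro exI conjI bexI)
  have main: "kernelize x \<in> instances \<and> (graph_matching (path_graph 3) (kernelize x) \<longleftrightarrow> graph_matching (path_graph 3) x)"
    if x: "x \<in> instances" for x
  proof -
    obtain G k where Gk: "x = (G, k)" by (cases x)
    have i: "(G, k) \<in> instances" using x Gk by simp
    obtain m bs where r: "kernel (matrix_of G, bits_of k) = (m, bs)" "kernelize (G, k) = (graph_of m, val bs)"
      using kernelize_cases[OF i] by blast
    note K = kernel_correct[OF i r(1)]
    have m: "(graph_of m, val bs) \<in> instances" by (rule graph_of_instance[OF K(1)])
    have s: "simple_graph G" "simple_graph (graph_of m)" using i m by (auto simp: instances_def)
    show ?thesis unfolding Gk r(2) using m K(4) by (simp add: graph_matching_iff s)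
  qed
  \<comment> \<open>The root, the matrix with \<open>edge_bound k\<close> rows and columns, and at
    most \<open>k + 1\<close> bits; a Boolean entry of a list takes at most
    \<open>3 + 1\<close>.\<close>
  let ?h = "\<lambda>k. 1 + (1 + edge_bound k * (2 + edge_bound k * 4)) + (1 + (k + 1) * 4)"
  show "kernelization (graph_matching (path_graph 3)) kernelize"
    unfolding kernelization_def
  proof (intro conjI exI ballI)
    show "polytime_computable_on instances enc_instance enc_instance kernelize" by (rule kernelize_polytime)
    show "kernelize x \<in> instances" "graph_matching (path_graph 3) (kernelize x) = graph_matching (path_graph 3) x"
      if "x \<in> instances" for x using main[OF that] by auto
    show "case x of (G, k) \<Rightarrow> dsize (enc_instance (kernelize (G, k))) \<le> ?h k" if x: "x \<in> instances" for x
    proof -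
      obtain G k where Gk: "x = (G, k)" by (cases x)
      have i: "(G, k) \<in> instances" using x Gk by simp
      obtain m bs where r: "kernel (matrix_of G, bits_of k) = (m, bs)" "kernelize (G, k) = (graph_of m, val bs)"
        using kernelize_cases[OF i] by blast
      note K = kernel_correct[OF i r(1)]
      have "length bs \<le> k + 1" using K(2,3) length_bits_of[of "val bs"] by simp
      then have "length bs * 4 \<le> (k + 1) * 4" by (rule mult_right_mono) simp
      then have "esize bs \<le> 1 + (k + 1) * 4" using esize_bools[of bs] by (rule le_trans[rotated, OF add_left_mono])
      moreover have "length m * (2 + length m * 4) \<le> edge_bound k * (2 + edge_bound k * 4)"
        using K(5) by (intro mult_mono add_left_mono) auto
      then have "esize m \<le> 1 + edge_bound k * (2 + edge_bound k * 4)" using esize_valid_matrix[OF K(1)] by linarith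
      ultimately show ?thesis by (simp add: Gk enc_kernelize[OF i] r(1))
    qed
  qed
  let ?f = "\<lambda>k. 6544 * real k powr (5 / 2)"
  show "?f \<in> O(\<lambda>k. real k powr (5 / 2))" by simp
  show "\<forall>(G, k)\<in>instances. real (card (edges (fst (kernelize (G, k))))) \<le> ?f k"
  proof clarify
    fix G k assume i: "(G, k) \<in> instances"
    obtain m bs where r: "kernel (matrix_of G, bits_of k) = (m, bs)" "kernelize (G, k) = (graph_of m, val bs)"
      using kernelize_cases[OF i] by blast
    have *: "card (edges (graph_of m)) \<le> edge_bound k" by (rule kernel_correct(6)[OF i r(1)])
    show "real (card (edges (fst (kernelize (G, k))))) \<le> ?f k"
    proof (cases "k = 0")
      case True
      \<comment> \<open>\<open>0 powr (5 / 2)\<close> is \<open>0\<close>, so at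
        \<open>k = 0\<close> no slack is left and the kernel has no edges at all.\<close>
      then have "edge_bound k = 0" by (simp add: edge_bound_def)
      then show ?thesis using * r by simp
    next
      case False
      then show ?thesis using edge_bound_real[of k] * r by simp
    qed
  qed
qed

end
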